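(* Let $G\sim G(n,1/2)$ and $d=d(n)=\left\lfloor\frac{7}{32}n-\frac{\sqrt{15n\log n}}{16}\right\rfloor$. Then asymptotically almost surely (i.e. with probability tending to $1$ as $n\to\infty$), $G$ is $d$-rigid.
   Context: $G(n,p)$ is the Erdős–Rényi random graph on $n$ vertices in which each pair of vertices is an edge independently with probability $p$. A graph $G$ is $d$-rigid if some (equivalently every) generic $d$-dimensional bar-and-joint framework $(G,p)$ (with $p:V(G)\to\mathbb{R}^d$ having coordinates algebraically independent over $\mathbb{Q}$) is rigid, i.e. admits no continuous edge-length-preserving motion that changes some pairwise distance between vertices. *)

theory Defs
  imports "HOL-Probability.Probability"
begin

text \<open>Simple graphs on the vertex set {0..<n}: a graph is its set of edges,
  each edge being a 2-element set of vertices.\<close>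

definition all_pairs :: "nat \<Rightarrow> nat set set" where
  "all_pairs n = {e. \<exists>u v. u < n \<and> v < n \<and> u \<noteq> v \<and> e = {u, v}}"

definition erdos_renyi :: "nat \<Rightarrow> real \<Rightarrow> nat set set pmf" where
  "erdos_renyi n p =
     map_pmf (\<lambda>f. {e \<in> all_pairs n. f e}) (Pi_pmf (all_pairs n) False (\<lambda>_. bernoulli_pmf p))"

text \<open>Algebraic independence over Q of a finite family of reals c indexed by I:
  no nonzero polynomial with rational coefficients in the variables (X_i)_{i in I}
  vanishes at c. A polynomial is a finite set M of exponent vectors (supported in I)
  with rational coefficients a.\<close>

definition alg_indep_rat :: "'i set \<Rightarrow> ('i \<Rightarrow> real) \<Rightarrow> bool" where
  "alg_indep_rat I c \<longleftrightarrow>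
     (\<forall>(M :: ('i \<Rightarrow> nat) set) (a :: ('i \<Rightarrow> nat) \<Rightarrow> rat).
        finite M \<longrightarrow> (\<forall>m\<in>M. \<forall>i. i \<notin> I \<longrightarrow> m i = 0) \<longrightarrow>
        (\<Sum>m\<in>M. of_rat (a m) * (\<Prod>i\<in>I. c i ^ m i)) = 0 \<longrightarrow>
        (\<forall>m\<in>M. a m = 0))"

text \<open>A d-dimensional framework on vertices {0..<n}: q v k is the k-th coordinate
  (k < d) of the point of vertex v (v < n).\<close>

definition sqdist :: "nat \<Rightarrow> (nat \<Rightarrow> nat \<Rightarrow> real) \<Rightarrow> nat \<Rightarrow> nat \<Rightarrow> real" where
  "sqdist d q u v = (\<Sum>k<d. (q u k - q v k)^2)"

definition generic_framework :: "nat \<Rightarrow> nat \<Rightarrow> (nat \<Rightarrow> nat \<Rightarrow> real) \<Rightarrow> bool" where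
  "generic_framework d n q \<longleftrightarrow> alg_indep_rat ({..<n} \<times> {..<d}) (\<lambda>(v, k). q v k)"

definition rigid_framework ::
  "nat \<Rightarrow> nat \<Rightarrow> nat set set \<Rightarrow> (nat \<Rightarrow> nat \<Rightarrow> real) \<Rightarrow> bool" where
  "rigid_framework d n E q \<longleftrightarrow>
     (\<forall>x :: real \<Rightarrow> nat \<Rightarrow> nat \<Rightarrow> real.
        (\<forall>v<n. \<forall>k<d. continuous_on {0..1} (\<lambda>t. x t v k)) \<longrightarrow>
        (\<forall>v<n. \<forall>k<d. x 0 v k = q v k) \<longrightarrow>
        (\<forall>t\<in>{0..1}. \<forall>u v. {u, v} \<in> E \<longrightarrow> sqdist d (x t) u v = sqdist d q u v) \<longrightarrow>
        (\<forall>t\<in>{0..1}. \<forall>u<n. \<forall>v<n. sqdist d (x t) u v = sqdist d q u v))"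

definition d_rigid :: "nat \<Rightarrow> nat \<Rightarrow> nat set set \<Rightarrow> bool" where
  "d_rigid d n E \<longleftrightarrow> (\<exists>q. generic_framework d n q \<and> rigid_framework d n E q)"

end

theory Submission
  imports Defs "HOL-Library.Z2" "HOL-Library.Function_Algebras" "HOL-Real_Asymp.Real_Asymp"
begin

text \<open>
  Let \<open>H\<close> be the set of non-edges. A framework \<open>q\<close> spanning \<open>d\<close>-space is rigid as soon as no nonzero symmetric
  matrix supported on \<open>H\<close> vanishes, as a bilinear form, on the space of affine dependencies of \<open>q\<close>; in
  Gale-dual terms, one needs vectors \<open>z v\<close> in dimension \<open>D = n - d - 1\<close> whose symmetric products \<open>z u * z v\<close>,
  for \<open>{u, v}\<close> in \<open>H\<close>, are linearly independent.

  Pair up almost all vertices (about \<open>31 n / 64\<close> pairs) and contract the pairs: dually, the two vertices of pair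
  \<open>i\<close> get the vectors \<open>e i\<close> and \<open>y i - e i\<close>, and the other vertices \<open>v\<close> get \<open>y v\<close>. Two pairs are non-adjacent in
  the contracted graph with probability only \<open>1/16\<close>. The vectors \<open>y\<close> live in about \<open>19 n / 64\<close> dimensions, more
  than the number of cells that, for a given pair, consist of vertices non-adjacent to some vertex of the pair;
  hence the \<open>y\<close> of these cells can be independent, and then the condition for the graph follows from that for
  the contracted graph. A linear number of vertices stays unpaired because with a perfect pairing the two numbers
  would agree to first order.

  There the \<open>y\<close> are found by counting modulo 2. A form of rank \<open>r\<close> supported on the non-edges is determined by \<open>r\<close>
  of its rows, so there are few such forms, whereas a random subspace of dimension \<open>p\<close> is isotropic for it with
  probability about \<open>2 powr (- p * r / 2 + r\<^sup>2 / 8)\<close>. An integer matrix that is injective modulo 2 is injective over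
  the reals.
\<close>

section \<open>Linear systems\<close>

text \<open>Counting forms on \<open>G\<close> itself cannot work: a form of rank \<open>r\<close>
  on the non-edges has about \<open>r * n / 2\<close> free bits, isotropy of a subspace of dimension
  \<open>D\<close> costs only about \<open>r * D / 2\<close> bits, and \<open>D < n\<close>.
  Contraction shrinks the first number. With \<open>m = n / 64\<close>, about \<open>31 m\<close>
  pairs and \<open>d\<close> near \<open>14 m\<close>, about \<open>19 m\<close> dimensions remain
  for the \<open>y\<close>, while a pair misses about \<open>9/16 * 31 m + 3/4 * 2 m\<close>, just
  below \<open>19 m\<close>; with \<open>32 m\<close> pairs both numbers are \<open>18 m\<close>.

  Affine dependencies must sum to zero, which random columns do not. They are multiplied, cell by
  cell, by a nowhere vanishing relation between the \<open>y\<close>; rescaling a form on both sides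
  keeps its support.

  The framework found this way need not be generic. Hence the certificate carries explicit constants
  that survive perturbation, and algebraically independent points are dense. Continuous motions are
  treated without derivatives: near \<open>q\<close>, the defect in the squared distances is bounded
  by a constant times its own square, so it cannot leave zero continuously.\<close>

lemma homogeneous_system_nontrivial:
  fixes a :: "'i \<Rightarrow> 'j \<Rightarrow> 'a::field"
  assumes "finite I" "finite J" "card I < card J"
  shows "\<exists>x. (\<exists>j\<in>J. x j \<noteq> 0) \<and> (\<forall>i\<in>I. (\<Sum>j\<in>J. a i j * x j) = 0)"
  using assms
proof (induction I arbitrary: J a rule: finite_induct)
  case empty
  then obtain j where "j \<in> J" by (metis card.empty card_0_eq less_irrefl equals0I)
  then show ?case by (intro exI[of _ "\<lambda>_. 1"]) auto
next
  case (insert i I)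
  show ?case
  proof (cases "\<forall>j\<in>J. a i j = 0")
    case True
    have "card I < card J" using insert by simp
    from insert.IH[OF insert.prems(1) this, of a] obtain x where
      "\<exists>j\<in>J. x j \<noteq> 0" "\<forall>i\<in>I. (\<Sum>j\<in>J. a i j * x j) = 0" by blast
    with True show ?thesis by (intro exI[of _ x]) auto
  next
    case False
    then obtain p where p: "p \<in> J" "a i p \<noteq> 0" by blast
    define b where "b = (\<lambda>i' j. a i' j - a i' p * a i j / a i p)"
    have "finite (J - {p})" "card I < card (J - {p})"
      using insert p by auto
    from insert.IH[OF this, of b] obtain x where
      x: "\<exists>j\<in>J-{p}. x j \<noteq> 0" "\<forall>i\<in>I. (\<Sum>j\<in>J-{p}. b i j * x j) = 0" by blast
    define S where "S = (\<Sum>j\<in>J-{p}. a i j * x j)"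
    define x' where "x' = x(p := - S / a i p)"
    have split: "(\<Sum>j\<in>J. a i' j * x' j) = (\<Sum>j\<in>J-{p}. a i' j * x j) - a i' p * S / a i p" for i'
    proof -
      have "(\<Sum>j\<in>J. a i' j * x' j) = a i' p * x' p + (\<Sum>j\<in>J-{p}. a i' j * x' j)"
        using insert.prems(1) p(1) by (rule sum.remove)
      also have "(\<Sum>j\<in>J-{p}. a i' j * x' j) = (\<Sum>j\<in>J-{p}. a i' j * x j)"
        by (rule sum.cong) (auto simp: x'_def)
      finally show ?thesis by (simp add: x'_def)
    qed
    have "(\<Sum>j\<in>J. a i' j * x' j) = 0" if "i' \<in> I" for i'
    proof -
      have "0 = (\<Sum>j\<in>J-{p}. b i' j * x j)" using x(2) that by simp
      also have "\<dots> = (\<Sum>j\<in>J-{p}. a i' j * x j - (a i' p / a i p) * (a i j * x j))"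
        by (rule sum.cong) (auto simp: b_def algebra_simps)
      also have "\<dots> = (\<Sum>j\<in>J-{p}. a i' j * x j) - a i' p * S / a i p"
        by (simp add: sum_subtractf S_def sum_distrib_left sum_divide_distrib)
      finally show ?thesis using split by simp
    qed
    moreover have "(\<Sum>j\<in>J. a i j * x' j) = 0"
      unfolding split using p(2) by (simp add: S_def)
    moreover have "\<exists>j\<in>J. x' j \<noteq> 0" using x(1) by (auto simp: x'_def)
    ultimately show ?thesis by (intro exI[of _ x']) auto
  qed
qed

lemma square_system_solvable:
  fixes M :: "'i \<Rightarrow> 'j \<Rightarrow> 'a::field"
  assumes fin: "finite I" "finite J" and card: "card I = card J"
    and inj: "\<And>x. (\<And>i. i \<in> I \<Longrightarrow> (\<Sum>j\<in>J. M i j * x j) = 0) \<Longrightarrow> \<forall>j\<in>J. x j = 0"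
  shows "\<exists>x. \<forall>i\<in>I. (\<Sum>j\<in>J. M i j * x j) = b i"
proof -
  \<comment> \<open>The right-hand side becomes the coefficient of an extra unknown
    \<open>None\<close>, so there are more unknowns than equations. Injectivity of \<open>M\<close>
    makes this unknown nonzero in a nontrivial solution, and dividing by it solves the
    system.\<close>
  define a where "a = (\<lambda>i jo. case jo of None \<Rightarrow> - b i | Some j \<Rightarrow> M i j)"
  define J' where "J' = insert None (Some ` J)"
  have "finite J'" "card I < card J'"
    using fin card by (auto simp: J'_def card_image)
  from homogeneous_system_nontrivial[OF fin(1) this, of a] obtain x where
    x: "\<exists>j\<in>J'. x j \<noteq> 0" "\<forall>i\<in>I. (\<Sum>j\<in>J'. a i j * x j) = 0" by blast
  have s: "(\<Sum>j\<in>J. M i j * x (Some j)) = b i * x None" if "i \<in> I" for i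
  proof -
    have "(\<Sum>j\<in>J'. a i j * x j) = - b i * x None + (\<Sum>j\<in>J. M i j * x (Some j))"
      using fin by (simp add: J'_def a_def sum.reindex)
    thus ?thesis using x(2) that by (simp add: add_eq_0_iff)
  qed
  have "x None \<noteq> 0"
  proof
    assume z: "x None = 0"
    have "\<forall>j\<in>J. x (Some j) = 0" by (rule inj) (simp add: s z)
    with z x(1) show False by (auto simp: J'_def)
  qed
  then have "(\<Sum>j\<in>J. M i j * (x (Some j) / x None)) = b i" if "i \<in> I" for i
    using s[OF that] by (simp add: sum_divide_distrib[symmetric])
  thus ?thesis by (intro exI[of _ "\<lambda>j. x (Some j) / x None"]) blast
qed

text \<open>The left inverse is \<open>(M\<^sup>T M)\<^sup>-\<^sup>1 M\<^sup>T\<close>, which is where the order is needed.\<close>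

lemma left_inverse_matrix:
  fixes M :: "'i \<Rightarrow> 'j \<Rightarrow> 'a::linordered_field"
  assumes fin: "finite I" "finite J"
    and inj: "\<And>x. (\<And>i. i \<in> I \<Longrightarrow> (\<Sum>j\<in>J. M i j * x j) = 0) \<Longrightarrow> \<forall>j\<in>J. x j = 0"
  shows "\<exists>G. \<forall>j\<in>J. \<forall>j'\<in>J. (\<Sum>i\<in>I. G j i * M i j') = (if j = j' then 1 else 0)"
proof -
  define A where "A = (\<lambda>j j'. \<Sum>i\<in>I. M i j * M i j')"
  have injA: "\<forall>j\<in>J. x j = 0" if h: "\<And>j. j \<in> J \<Longrightarrow> (\<Sum>j'\<in>J. A j j' * x j') = 0" for x
  proof (rule inj)
    fix i assume i: "i \<in> I"
    have "(\<Sum>i\<in>I. (\<Sum>j\<in>J. M i j * x j)^2) = (\<Sum>i\<in>I. \<Sum>j\<in>J. \<Sum>j'\<in>J. x j * (M i j * M i j' * x j'))"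
      by (simp add: power2_eq_square sum_product mult_ac)
    also have "\<dots> = (\<Sum>j\<in>J. \<Sum>j'\<in>J. \<Sum>i\<in>I. x j * (M i j * M i j' * x j'))"
      by (subst sum.swap, rule sum.cong[OF refl], rule sum.swap)
    also have "\<dots> = (\<Sum>j\<in>J. x j * (\<Sum>j'\<in>J. A j j' * x j'))"
      by (simp add: A_def sum_distrib_left sum_distrib_right)
    also have "\<dots> = 0" using h by simp
    finally have "(\<Sum>i\<in>I. (\<Sum>j\<in>J. M i j * x j)^2) = 0" .
    with i fin(1) show "(\<Sum>j\<in>J. M i j * x j) = 0"
      by (simp add: sum_nonneg_eq_0_iff)
  qed
  have "\<exists>x. \<forall>j'\<in>J. (\<Sum>l\<in>J. A j' l * x l) = (if j = j' then 1 else 0)" for j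
    by (rule square_system_solvable[OF fin(2) fin(2) refl]) (rule injA)
  then obtain g where g: "\<And>j. \<forall>j'\<in>J. (\<Sum>l\<in>J. A j' l * g j l) = (if j = j' then 1 else 0)"
    by metis
  have "(\<Sum>i\<in>I. (\<Sum>l\<in>J. g j l * M i l) * M i j') = (if j = j' then 1 else 0)" if "j' \<in> J" for j j'
  proof -
    have "(\<Sum>i\<in>I. (\<Sum>l\<in>J. g j l * M i l) * M i j') = (\<Sum>l\<in>J. \<Sum>i\<in>I. g j l * M i l * M i j')"
      by (simp add: sum_distrib_right) (rule sum.swap)
    also have "\<dots> = (\<Sum>l\<in>J. A j' l * g j l)"
      by (simp add: A_def sum_distrib_left sum_distrib_right mult_ac)
    finally show ?thesis using g that by simp
  qed
  thus ?thesis by (intro exI[of _ "\<lambda>j i. \<Sum>l\<in>J. g j l * M i l"]) auto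
qed

lemma left_inverse_apply:
  fixes M :: "'i \<Rightarrow> 'j \<Rightarrow> 'a::comm_ring_1"
  assumes "finite J" "j \<in> J" "\<forall>j'\<in>J. (\<Sum>i\<in>I. g i * M i j') = (if j = j' then 1 else 0)"
  shows "(\<Sum>i\<in>I. g i * (\<Sum>j'\<in>J. M i j' * x j')) = x j"
proof -
  have "(\<Sum>i\<in>I. g i * (\<Sum>j'\<in>J. M i j' * x j')) = (\<Sum>j'\<in>J. (\<Sum>i\<in>I. g i * M i j') * x j')"
    by (simp add: sum_distrib_left sum_distrib_right mult_ac) (rule sum.swap)
  also have "\<dots> = (\<Sum>j'\<in>J. if j' = j then x j else 0)"
    using assms(3) by (intro sum.cong) auto
  also have "\<dots> = x j" using assms by simp
  finally show ?thesis .
qed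

text \<open>Infinite descent: parity makes every solution even, and half of a solution is a solution
  with a smaller sum of absolute values.\<close>

lemma int_kernel_trivial_of_parity:
  fixes M :: "'i \<Rightarrow> 'j \<Rightarrow> int"
  assumes fin: "finite J"
    and par: "\<And>x. (\<And>i. i \<in> I \<Longrightarrow> even (\<Sum>j\<in>J. M i j * x j)) \<Longrightarrow> \<forall>j\<in>J. even (x j)"
    and ker: "\<And>i. i \<in> I \<Longrightarrow> (\<Sum>j\<in>J. M i j * x j) = 0"
  shows "\<forall>j\<in>J. x j = 0"
  using ker
proof (induction "nat (\<Sum>j\<in>J. \<bar>x j\<bar>)" arbitrary: x rule: less_induct)
  case less
  show ?case
  proof (rule ccontr)
    assume neg: "\<not> (\<forall>j\<in>J. x j = 0)"
    have ev: "\<forall>j\<in>J. even (x j)" by (rule par) (simp add: less.prems)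
    define y where "y = (\<lambda>j. x j div 2)"
    have xy: "x j = 2 * y j" if "j \<in> J" for j using ev that by (simp add: y_def)
    have s: "(\<Sum>j\<in>J. \<bar>x j\<bar>) = 2 * (\<Sum>j\<in>J. \<bar>y j\<bar>)"
      by (simp add: sum_distrib_left xy abs_mult)
    have "(\<Sum>j\<in>J. \<bar>x j\<bar>) \<noteq> 0"
      using neg fin by (auto simp: sum_nonneg_eq_0_iff)
    moreover have "(\<Sum>j\<in>J. \<bar>x j\<bar>) \<ge> 0" by (simp add: sum_nonneg)
    ultimately have "nat (\<Sum>j\<in>J. \<bar>y j\<bar>) < nat (\<Sum>j\<in>J. \<bar>x j\<bar>)" using s by linarith
    moreover have "(\<Sum>j\<in>J. M i j * y j) = 0" if "i \<in> I" for i
    proof -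
      have "2 * (\<Sum>j\<in>J. M i j * y j) = (\<Sum>j\<in>J. M i j * x j)"
        by (simp add: sum_distrib_left xy mult_ac)
      thus ?thesis using less.prems that by simp
    qed
    ultimately have "\<forall>j\<in>J. y j = 0" by (rule less.hyps)
    with xy neg show False by simp
  qed
qed

lemma common_denominator:
  fixes x :: "'j \<Rightarrow> rat"
  assumes "finite J"
  shows "\<exists>(c::int) y. c \<noteq> 0 \<and> (\<forall>j\<in>J. of_int c * x j = of_int (y j))"
proof -
  define a b where "a = (\<lambda>j. fst (quotient_of (x j)))" and "b = (\<lambda>j. snd (quotient_of (x j)))"
  have b0: "b j \<noteq> 0" for j using quotient_of_denom_pos'[of "x j"] by (simp add: b_def)
  have x: "of_int (b j) * x j = of_int (a j)" for j
  proof -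
    have "x j = of_int (a j) / of_int (b j)" by (rule quotient_of_div) (simp add: a_def b_def)
    then show ?thesis using b0[of j] by simp
  qed
  have "of_int (\<Prod>j\<in>J. b j) * x j = of_int ((\<Prod>i\<in>J-{j}. b i) * a j)" if "j \<in> J" for j
  proof -
    have "(\<Prod>j\<in>J. b j) = b j * (\<Prod>i\<in>J-{j}. b i)" using assms that by (rule prod.remove)
    then have "of_int (\<Prod>j\<in>J. b j) * x j = of_int (\<Prod>i\<in>J-{j}. b i) * (of_int (b j) * x j)"
      by (simp only: of_int_mult mult_ac)
    then show ?thesis by (simp only: x of_int_mult)
  qed
  moreover have "(\<Prod>j\<in>J. b j) \<noteq> 0" using assms b0 by simp
  ultimately show ?thesis by (intro exI conjI ballI)
qed

text \<open>Clearing denominators takes a rational kernel vector to the integers, where parity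
  applies. A rational left inverse remains a left inverse over the reals, and this settles real
  kernel vectors.\<close>

lemma real_kernel_trivial_of_parity:
  fixes M :: "'i \<Rightarrow> 'j \<Rightarrow> int" and x :: "'j \<Rightarrow> real"
  assumes fin: "finite I" "finite J"
    and par: "\<And>x. (\<And>i. i \<in> I \<Longrightarrow> even (\<Sum>j\<in>J. M i j * x j)) \<Longrightarrow> \<forall>j\<in>J. even (x j)"
    and ker: "\<And>i. i \<in> I \<Longrightarrow> (\<Sum>j\<in>J. of_int (M i j) * x j) = 0"
  shows "\<forall>j\<in>J. x j = 0"
proof -
  have rat: "\<forall>j\<in>J. w j = 0" if w: "\<And>i. i \<in> I \<Longrightarrow> (\<Sum>j\<in>J. of_int (M i j) * w j) = 0" for w :: "'j \<Rightarrow> rat"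
  proof -
    obtain c y where cy: "c \<noteq> 0" "\<forall>j\<in>J. of_int c * w j = of_int (y j)"
      using common_denominator[OF fin(2)] by blast
    have "(\<Sum>j\<in>J. M i j * y j) = 0" if "i \<in> I" for i
    proof -
      have "of_int (\<Sum>j\<in>J. M i j * y j) = (\<Sum>j\<in>J. of_int (M i j) * (of_int c * w j))"
        using cy by simp
      also have "\<dots> = of_int c * (\<Sum>j\<in>J. of_int (M i j) * w j)"
        by (simp add: sum_distrib_left mult_ac)
      finally have "of_int (\<Sum>j\<in>J. M i j * y j) = (0::rat)" using w[OF that] by simp
      thus ?thesis by (simp only: of_int_eq_0_iff)
    qed
    with fin(2) par have "\<forall>j\<in>J. y j = 0"
      by (rule int_kernel_trivial_of_parity[where I = I and M = M])
    with cy show ?thesis by auto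
  qed
  have "\<exists>G. \<forall>j\<in>J. \<forall>j'\<in>J. (\<Sum>i\<in>I. G j i * of_int (M i j')) = (if j = j' then 1 else (0::rat))"
    by (rule left_inverse_matrix[OF fin]) (rule rat)
  then obtain G where
    G: "\<forall>j\<in>J. \<forall>j'\<in>J. (\<Sum>i\<in>I. G j i * of_int (M i j')) = (if j = j' then 1 else (0::rat))" ..
  show ?thesis
  proof
    fix j assume j: "j \<in> J"
    have "\<forall>j'\<in>J. (\<Sum>i\<in>I. of_rat (G j i) * (of_int (M i j') :: real)) = (if j = j' then 1 else 0)"
    proof
      fix j' assume "j' \<in> J"
      with G j have "of_rat (\<Sum>i\<in>I. G j i * of_int (M i j')) = (of_rat (if j = j' then 1 else 0) :: real)"
        by simp
      thus "(\<Sum>i\<in>I. of_rat (G j i) * (of_int (M i j') :: real)) = (if j = j' then 1 else 0)"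
        by (auto simp: of_rat_sum of_rat_mult split: if_splits)
    qed
    from left_inverse_apply[where g = "\<lambda>i. of_rat (G j i)" and M = "\<lambda>i j. of_int (M i j)" and x = x, OF fin(2) j this]
    show "x j = 0" by (simp add: ker)
  qed
qed

section \<open>Rigidity from a stress certificate\<close>

definition form_val :: "nat \<Rightarrow> (nat \<Rightarrow> nat \<Rightarrow> real) \<Rightarrow> (nat \<Rightarrow> real) \<Rightarrow> (nat \<Rightarrow> real) \<Rightarrow> real" where
  "form_val n om x y = (\<Sum>u<n. \<Sum>v<n. x u * om u v * y v)"

definition nonedge_form :: "nat \<Rightarrow> nat set set \<Rightarrow> (nat \<Rightarrow> nat \<Rightarrow> real) \<Rightarrow> bool" where
  "nonedge_form n E om \<longleftrightarrow> (\<forall>u v. om u v = om v u) \<and>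
     (\<forall>u v. om u v \<noteq> 0 \<longrightarrow> u < n \<and> v < n \<and> u \<noteq> v \<and> {u, v} \<notin> E)"

text \<open>The \<open>z a\<close> are affine dependencies of \<open>q\<close>, and \<open>C\<close>
  quantifies that no nonzero non-edge form vanishes on them. The \<open>w j\<close> witness that
  \<open>q\<close> affinely spans \<open>d\<close>-space: they send \<open>q\<close> to a
  \<open>d\<close> by \<open>d\<close> matrix whose conditioning is measured by \<open>l\<close>.
  Both constants enter the distance within which no other set of pairwise distances has the same
  edge lengths.\<close>

definition rigidity_certificate ::
  "nat \<Rightarrow> nat \<Rightarrow> nat set set \<Rightarrow> (nat \<Rightarrow> nat \<Rightarrow> real) \<Rightarrow> bool" where
  "rigidity_certificate d n E q \<longleftrightarrow>
     (\<exists>(D::nat) z C w l. l > 0 \<and>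
        (\<forall>a<D. (\<Sum>v<n. z a v) = 0 \<and> (\<forall>k<d. (\<Sum>v<n. z a v * q v k) = 0)) \<and>
        (\<forall>om B. nonedge_form n E om \<longrightarrow> (\<forall>a<D. \<forall>b<D. \<bar>form_val n om (z a) (z b)\<bar> \<le> B) \<longrightarrow>
            0 \<le> B \<longrightarrow> (\<forall>u v. \<bar>om u v\<bar> \<le> C * B)) \<and>
        (\<forall>j<d. (\<Sum>v<n. w j v) = 0) \<and>
        (\<forall>c. l * (\<Sum>j<d. (c j)^2) \<le> (\<Sum>k<d. (\<Sum>j<d. c j * (\<Sum>v<n. w j v * q v k))^2)))"

text \<open>The squared norms of the single points are killed by the zero sums, and only inner
  products survive: squared distances determine the Gram matrix of combinations with coefficient sum
  zero.\<close>

lemma form_val_sqdist: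
  assumes "(\<Sum>v<n. x v) = 0" "(\<Sum>v<n. y v) = 0"
  shows "form_val n (sqdist d p) x y = -2 * (\<Sum>k<d. (\<Sum>v<n. x v * p v k) * (\<Sum>v<n. y v * p v k))"
proof -
  have "form_val n (sqdist d p) x y =
    (\<Sum>u<n. \<Sum>v<n. \<Sum>k<d. x u * (p u k)^2 * y v + x u * ((p v k)^2 * y v) - 2 * (x u * p u k * (y v * p v k)))"
    unfolding form_val_def sqdist_def sum_distrib_left sum_distrib_right
    by (intro sum.cong refl) (simp add: power2_eq_square algebra_simps)
  also have "\<dots> = (\<Sum>k<d. \<Sum>u<n. \<Sum>v<n. x u * (p u k)^2 * y v + x u * ((p v k)^2 * y v) - 2 * (x u * p u k * (y v * p v k)))"
    by (rule trans[OF sum.cong[OF refl sum.swap] sum.swap])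
  also have "\<dots> = (\<Sum>k<d. (\<Sum>u<n. x u * (p u k)^2) * (\<Sum>v<n. y v) + (\<Sum>u<n. x u) * (\<Sum>v<n. (p v k)^2 * y v)
       - 2 * ((\<Sum>v<n. x v * p v k) * (\<Sum>v<n. y v * p v k)))"
    by (simp only: sum.distrib sum_subtractf sum_product sum_distrib_left[of "2::real"])
  also have "\<dots> = -2 * (\<Sum>k<d. (\<Sum>v<n. x v * p v k) * (\<Sum>v<n. y v * p v k))"
    by (simp add: assms sum_distrib_left sum_negf)
  finally show ?thesis .
qed

lemma form_val_diff: "form_val n (\<lambda>u v. a u v - b u v) x y = form_val n a x y - form_val n b x y"
  by (simp add: form_val_def sum_subtractf algebra_simps)

lemma form_val_cong:
  "(\<And>u v. u < n \<Longrightarrow> v < n \<Longrightarrow> a u v = b u v) \<Longrightarrow> form_val n a x y = form_val n b x y"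
  by (simp add: form_val_def)

lemma abs_form_val_le:
  assumes "\<And>u v. u < n \<Longrightarrow> v < n \<Longrightarrow> \<bar>om u v\<bar> \<le> m"
  shows "\<bar>form_val n om x y\<bar> \<le> m * ((\<Sum>v<n. \<bar>x v\<bar>) * (\<Sum>v<n. \<bar>y v\<bar>))"
proof -
  have "\<bar>form_val n om x y\<bar> \<le> (\<Sum>u<n. \<Sum>v<n. \<bar>x u * om u v * y v\<bar>)"
    unfolding form_val_def by (rule order.trans[OF sum_abs]) (intro sum_mono sum_abs)
  also have "\<dots> \<le> (\<Sum>u<n. \<Sum>v<n. m * (\<bar>x u\<bar> * \<bar>y v\<bar>))"
  proof (intro sum_mono)
    fix u v assume "u \<in> {..<n}" "v \<in> {..<n}"
    then have "\<bar>om u v\<bar> * (\<bar>x u\<bar> * \<bar>y v\<bar>) \<le> m * (\<bar>x u\<bar> * \<bar>y v\<bar>)"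
      by (intro mult_right_mono assms) auto
    then show "\<bar>x u * om u v * y v\<bar> \<le> m * (\<bar>x u\<bar> * \<bar>y v\<bar>)" by (simp add: abs_mult mult_ac)
  qed
  also have "\<dots> = m * ((\<Sum>v<n. \<bar>x v\<bar>) * (\<Sum>v<n. \<bar>y v\<bar>))"
    by (simp only: sum_product sum_distrib_left[of m])
  finally show ?thesis .
qed

lemma sum_abs_le_total:
  fixes z :: "nat \<Rightarrow> nat \<Rightarrow> real"
  assumes "a < D"
  shows "(\<Sum>v<n. \<bar>z a v\<bar>) \<le> (\<Sum>a<D. \<Sum>v<n. \<bar>z a v\<bar>)"
  by (rule member_le_sum[where f = "\<lambda>a. \<Sum>v<n. \<bar>z a v\<bar>"]) (use assms in \<open>auto intro: sum_nonneg\<close>)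

lemma nonedge_form_max:
  assumes om: "nonedge_form n E om"
  obtains m where "m \<ge> 0" "\<And>u v. \<bar>om u v\<bar> \<le> m" "m = 0 \<or> (\<exists>u v. m = \<bar>om u v\<bar>)"
proof
  define P where "P = (\<lambda>(u, v). \<bar>om u v\<bar>) ` ({..<n} \<times> {..<n})"
  have fP: "finite P" by (simp add: P_def)
  show m0: "Max (insert 0 P) \<ge> 0" using fP by auto
  have "Max (insert 0 P) \<in> insert 0 P" by (rule Max_in) (use fP in auto)
  then show "Max (insert 0 P) = 0 \<or> (\<exists>u v. Max (insert 0 P) = \<bar>om u v\<bar>)" by (auto simp: P_def)
  fix u v
  show "\<bar>om u v\<bar> \<le> Max (insert 0 P)"
  proof (cases "om u v = 0")
    case False
    then have "u < n" "v < n" using om by (auto simp: nonedge_form_def)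
    then show ?thesis by (intro Max_ge) (use fP in \<open>auto simp: P_def\<close>)
  qed (use m0 in simp)
qed

lemma sum_abs_square_le: "(\<Sum>j<d. \<bar>c j\<bar>)^2 \<le> real d * (\<Sum>j<d. (c j)^2)"
proof -
  have "(\<Sum>j<d. \<bar>c j\<bar> * 1)^2 \<le> (\<Sum>j<d. \<bar>c j\<bar>^2) * (\<Sum>j<d. 1^2)"
    by (rule Cauchy_Schwarz_ineq_sum)
  then show ?thesis by (simp add: mult.commute)
qed

text \<open>For a framework \<open>y\<close> with the edge lengths of \<open>q\<close>, the matrix
  \<open>om = sqdist y - sqdist q\<close> lives on the non-edges. Since the \<open>z a\<close> annihilate \<open>q\<close>, the vectors
  \<open>r a = (\<Sum>v. z a v * y v)\<close> are linear in \<open>om\<close>, while the values of \<open>om\<close> on the \<open>z a\<close> are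
  \<open>-2 * (r a \<bullet> r b)\<close>, so \<open>om = O(om\<^sup>2)\<close> and \<open>om\<close> cannot be small without being zero.\<close>

lemma certificate_gap:
  assumes "rigidity_certificate d n E q"
  shows "\<exists>e>0. \<forall>y. (\<forall>u v. {u, v} \<in> E \<longrightarrow> sqdist d y u v = sqdist d q u v) \<longrightarrow>
     (\<forall>u<n. \<forall>v<n. \<bar>sqdist d y u v - sqdist d q u v\<bar> \<le> e) \<longrightarrow>
     (\<forall>u<n. \<forall>v<n. sqdist d y u v = sqdist d q u v)"
proof -
  from assms[unfolded rigidity_certificate_def] obtain D :: nat and z C w l where l: "l > 0"
    and c1: "\<forall>a<D. (\<Sum>v<n. z a v) = 0 \<and> (\<forall>k<d. (\<Sum>v<n. z a v * q v k) = 0)"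
    and c2: "\<forall>om B. nonedge_form n E om \<longrightarrow> (\<forall>a<D. \<forall>b<D. \<bar>form_val n om (z a) (z b)\<bar> \<le> B) \<longrightarrow>
            0 \<le> B \<longrightarrow> (\<forall>u v. \<bar>om u v\<bar> \<le> C * B)"
    and c3: "\<forall>j<d. (\<Sum>v<n. w j v) = 0"
    and wq': "\<forall>c. l * (\<Sum>j<d. (c j)^2) \<le> (\<Sum>k<d. (\<Sum>j<d. c j * (\<Sum>v<n. w j v * q v k))^2)"
    by (elim exE conjE) (rule that)
  have z0: "\<And>a. a < D \<Longrightarrow> (\<Sum>v<n. z a v) = 0"
    and zq: "\<And>a k. a < D \<Longrightarrow> k < d \<Longrightarrow> (\<Sum>v<n. z a v * q v k) = 0"
    using c1 by simp_all
  have C: "\<And>om B u v. nonedge_form n E om \<Longrightarrow> (\<And>a b. a < D \<Longrightarrow> b < D \<Longrightarrow> \<bar>form_val n om (z a) (z b)\<bar> \<le> B)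
          \<Longrightarrow> 0 \<le> B \<Longrightarrow> \<bar>om u v\<bar> \<le> C * B"
    using c2 by simp
  have w0: "\<And>j. j < d \<Longrightarrow> (\<Sum>v<n. w j v) = 0" using c3 by simp
  have wq: "\<And>c. l * (\<Sum>j<d. (c j)^2) \<le> (\<Sum>k<d. (\<Sum>j<d. c j * (\<Sum>v<n. w j v * q v k))^2)"
    using wq' by (rule spec)
  define S where "S = 1 + (\<Sum>a<D. \<Sum>v<n. \<bar>z a v\<bar>) + (\<Sum>j<d. \<Sum>v<n. \<bar>w j v\<bar>)"
  have nn: "(\<Sum>a<D. \<Sum>v<n. \<bar>z a v\<bar>) \<ge> 0" "(\<Sum>j<d. \<Sum>v<n. \<bar>w j v\<bar>) \<ge> 0"
    by (intro sum_nonneg, simp)+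
  then have S1: "S \<ge> 1" by (simp add: S_def)
  have Sz: "(\<Sum>v<n. \<bar>z a v\<bar>) \<le> S" if "a < D" for a
    using sum_abs_le_total[OF that, where z = z and n = n] nn by (simp add: S_def)
  have Sw: "(\<Sum>v<n. \<bar>w a v\<bar>) \<le> S" if "a < d" for a
    using sum_abs_le_total[OF that, where z = w and n = n] nn by (simp add: S_def)
  define K where "K = S^4 * real d / (2 * l)"
  have K0: "K \<ge> 0" using l by (simp add: K_def)
  \<comment> \<open>The first bound keeps the matrix \<open>f\<close> of the nearby framework
    invertible, with constant \<open>l / 2\<close>. The second makes
    \<open>2 * \<bar>C\<bar> * K * m < 1\<close> whenever \<open>m \<le> e\<close>, which
    contradicts \<open>m \<le> C * (2 * K * m^2)\<close> unless \<open>m = 0\<close>.\<close>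
  define e where "e = min (l / (S^2 * real d + 1)) (1 / (4 * \<bar>C\<bar> * K + 1))"
  have e0: "e > 0" using l K0 S1 by (auto simp: e_def add_nonneg_pos)
  have eS: "e * (S^2 * real d) \<le> l"
  proof -
    have "e * (S^2 * real d) \<le> e * (S^2 * real d + 1)" using e0 by simp
    also have "\<dots> \<le> l / (S^2 * real d + 1) * (S^2 * real d + 1)"
      by (rule mult_right_mono) (auto simp: e_def)
    also have "\<dots> = l" by (simp add: add_nonneg_pos[THEN less_imp_neq, symmetric])
    finally show ?thesis .
  qed
  have eC: "e * (2 * \<bar>C\<bar> * K) < 1"
  proof -
    have p: "4 * \<bar>C\<bar> * K + 1 > 0" using K0 by (auto intro: add_nonneg_pos)
    have "e * (2 * \<bar>C\<bar> * K) \<le> 1 / (4 * \<bar>C\<bar> * K + 1) * (2 * \<bar>C\<bar> * K)"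
      using K0 by (intro mult_right_mono) (auto simp: e_def)
    also have "\<dots> < 1" using p K0 by (simp add: field_simps)
    finally show ?thesis .
  qed
  have main: "\<forall>u<n. \<forall>v<n. sqdist d y u v = sqdist d q u v"
    if edges: "\<And>u v. {u, v} \<in> E \<Longrightarrow> sqdist d y u v = sqdist d q u v"
      and small: "\<And>u v. u < n \<Longrightarrow> v < n \<Longrightarrow> \<bar>sqdist d y u v - sqdist d q u v\<bar> \<le> e" for y
  proof -
    define om where "om = (\<lambda>u v. if u < n \<and> v < n then sqdist d y u v - sqdist d q u v else 0)"
    have sym: "sqdist d p u v = sqdist d p v u" for p u v
      by (simp add: sqdist_def power2_commute)
    have ne: "nonedge_form n E om"
      using edges by (auto simp: nonedge_form_def om_def sym split: if_splits) (auto simp: sqdist_def)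
    obtain m where m0: "m \<ge> 0" and m: "\<And>u v. \<bar>om u v\<bar> \<le> m" and mP: "m = 0 \<or> (\<exists>u v. m = \<bar>om u v\<bar>)"
      by (rule nonedge_form_max[OF ne]) (rule that)
    have me: "m \<le> e" using mP e0 small by (auto simp: om_def)
    have omv: "form_val n om a b = form_val n (sqdist d y) a b - form_val n (sqdist d q) a b" for a b
      by (subst form_val_diff[symmetric]) (rule form_val_cong, simp add: om_def)
    define f where "f = (\<lambda>j k. \<Sum>v<n. w j v * y v k)"
    define r where "r = (\<lambda>a k. \<Sum>v<n. z a v * y v k)"
    \<comment> \<open>Evaluating \<open>om\<close> on the combination \<open>W\<close> of the
      \<open>w j\<close> compares the Gram matrices of \<open>y\<close> and \<open>q\<close>, which
      differ little because \<open>om\<close> is small.\<close>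
    have f: "l / 2 * (\<Sum>j<d. (c j)^2) \<le> (\<Sum>k<d. (\<Sum>j<d. c j * f j k)^2)" for c
    proof -
      define W where "W = (\<lambda>v. \<Sum>j<d. c j * w j v)"
      have W0: "(\<Sum>v<n. W v) = 0"
        unfolding W_def by (subst sum.swap) (simp add: w0 flip: sum_distrib_left)
      have Wp: "(\<Sum>v<n. W v * p v k) = (\<Sum>j<d. c j * (\<Sum>v<n. w j v * p v k))" for p :: "nat \<Rightarrow> nat \<Rightarrow> real" and k
        unfolding W_def sum_distrib_left sum_distrib_right by (subst sum.swap) (simp add: mult_ac)
      have Wabs: "(\<Sum>v<n. \<bar>W v\<bar>) \<le> S * (\<Sum>j<d. \<bar>c j\<bar>)"
      proof -
        have "(\<Sum>v<n. \<bar>W v\<bar>) \<le> (\<Sum>v<n. \<Sum>j<d. \<bar>c j\<bar> * \<bar>w j v\<bar>)"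
          unfolding W_def by (intro sum_mono order.trans[OF sum_abs]) (simp add: abs_mult)
        also have "\<dots> = (\<Sum>j<d. \<bar>c j\<bar> * (\<Sum>v<n. \<bar>w j v\<bar>))"
          by (subst sum.swap) (simp add: sum_distrib_left)
        also have "\<dots> \<le> (\<Sum>j<d. \<bar>c j\<bar> * S)"
          by (intro sum_mono mult_left_mono Sw) auto
        also have "\<dots> = S * (\<Sum>j<d. \<bar>c j\<bar>)"
          by (subst mult.commute) (rule sum_distrib_right[symmetric])
        finally show ?thesis .
      qed
      have "\<bar>form_val n om W W\<bar> \<le> m * ((\<Sum>v<n. \<bar>W v\<bar>) * (\<Sum>v<n. \<bar>W v\<bar>))"
        by (rule abs_form_val_le) (rule m)
      also have "\<dots> \<le> m * ((S * (\<Sum>j<d. \<bar>c j\<bar>)) * (S * (\<Sum>j<d. \<bar>c j\<bar>)))"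
        using m0 S1 by (intro mult_left_mono mult_mono Wabs) (auto intro!: sum_nonneg mult_nonneg_nonneg)
      also have "\<dots> = m * S^2 * (\<Sum>j<d. \<bar>c j\<bar>)^2" by (simp add: power2_eq_square mult_ac)
      also have "\<dots> \<le> m * S^2 * (real d * (\<Sum>j<d. (c j)^2))"
        using m0 by (intro mult_left_mono sum_abs_square_le) auto
      also have "\<dots> \<le> (e * (S^2 * real d)) * (\<Sum>j<d. (c j)^2)"
      proof -
        have "m * (S^2 * real d * (\<Sum>j<d. (c j)^2)) \<le> e * (S^2 * real d * (\<Sum>j<d. (c j)^2))"
          using me by (intro mult_right_mono mult_nonneg_nonneg sum_nonneg) auto
        then show ?thesis by (simp only: mult.assoc)
      qed
      also have "\<dots> \<le> l * (\<Sum>j<d. (c j)^2)"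
        by (rule mult_right_mono[OF eS]) (simp add: sum_nonneg)
      finally have b: "\<bar>form_val n om W W\<bar> \<le> l * (\<Sum>j<d. (c j)^2)" .
      have eq: "(\<Sum>k<d. (\<Sum>j<d. c j * (\<Sum>v<n. w j v * p v k))^2) = - form_val n (sqdist d p) W W / 2" for p
        by (simp add: form_val_sqdist[OF W0 W0] Wp power2_eq_square)
      have "(\<Sum>k<d. (\<Sum>j<d. c j * f j k)^2) = - form_val n om W W / 2 - form_val n (sqdist d q) W W / 2"
        unfolding f_def eq by (simp add: omv field_simps)
      moreover have "- form_val n (sqdist d q) W W / 2 \<ge> l * (\<Sum>j<d. (c j)^2)"
        using wq[of c] unfolding eq .
      ultimately show ?thesis using b by (simp add: field_simps)
    qed
    \<comment> \<open>The inner product of \<open>r a\<close> with a row \<open>f j\<close> is, up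
      to the factor -2, the value of \<open>om\<close> on \<open>z a\<close> and \<open>w j\<close>,
      since \<open>q\<close> contributes nothing; hence it is \<open>O(m)\<close>. Writing
      \<open>r a\<close> as a combination of the rows of the invertible matrix \<open>f\<close>
      turns this into a bound on \<open>r a\<close> itself.\<close>
    have R: "(\<Sum>k<d. (r a k)^2) \<le> K * m^2" if a: "a < D" for a
    proof -
      have "\<exists>c. \<forall>k\<in>{..<d}. (\<Sum>j<d. f j k * c j) = r a k"
      proof (rule square_system_solvable)
        fix x assume h: "\<And>i. i \<in> {..<d} \<Longrightarrow> (\<Sum>j<d. f j i * x j) = 0"
        have "l / 2 * (\<Sum>j<d. (x j)^2) \<le> 0"
          using f[of x] h by (simp add: mult.commute)
        then have "(\<Sum>j<d. (x j)^2) \<le> 0" using l by (simp add: mult_le_0_iff)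
        then have "(\<Sum>j<d. (x j)^2) = 0" by (intro antisym sum_nonneg) auto
        then show "\<forall>j\<in>{..<d}. x j = 0" by (simp add: sum_nonneg_eq_0_iff)
      qed auto
      then obtain c where c: "\<And>k. k < d \<Longrightarrow> (\<Sum>j<d. c j * f j k) = r a k" by (auto simp: mult.commute)
      define T where "T = (\<Sum>k<d. (r a k)^2)"
      have T0: "T \<ge> 0" by (simp add: T_def sum_nonneg)
      have rf: "\<bar>\<Sum>k<d. r a k * f j k\<bar> \<le> m * S^2 / 2" if j: "j < d" for j
      proof -
        have "form_val n (sqdist d y) (z a) (w j) = -2 * (\<Sum>k<d. r a k * f j k)"
          by (simp add: form_val_sqdist[OF z0[OF a] w0[OF j]] r_def f_def)
        moreover have "form_val n (sqdist d q) (z a) (w j) = 0"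
          by (simp add: form_val_sqdist[OF z0[OF a] w0[OF j]] zq[OF a])
        ultimately have "2 * \<bar>\<Sum>k<d. r a k * f j k\<bar> = \<bar>form_val n om (z a) (w j)\<bar>"
          by (simp add: omv abs_mult)
        also have "\<dots> \<le> m * ((\<Sum>v<n. \<bar>z a v\<bar>) * (\<Sum>v<n. \<bar>w j v\<bar>))"
          by (rule abs_form_val_le) (rule m)
        also have "\<dots> \<le> m * (S * S)"
          using m0 S1 by (intro mult_left_mono mult_mono Sz Sw a j) (auto intro!: sum_nonneg)
        finally show ?thesis by (simp add: power2_eq_square)
      qed
      have "T = (\<Sum>k<d. \<Sum>j<d. c j * (r a k * f j k))"
        unfolding T_def power2_eq_square
        by (intro sum.cong refl) (simp add: c[symmetric] sum_distrib_left mult_ac)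
      also have "\<dots> = (\<Sum>j<d. c j * (\<Sum>k<d. r a k * f j k))"
        by (subst sum.swap) (simp add: sum_distrib_left)
      also have "\<dots> \<le> (\<Sum>j<d. \<bar>c j\<bar> * (m * S^2 / 2))"
      proof (rule sum_mono)
        fix j assume "j \<in> {..<d}"
        then have "\<bar>c j\<bar> * \<bar>\<Sum>k<d. r a k * f j k\<bar> \<le> \<bar>c j\<bar> * (m * S^2 / 2)"
          by (intro mult_left_mono rf) auto
        then show "c j * (\<Sum>k<d. r a k * f j k) \<le> \<bar>c j\<bar> * (m * S^2 / 2)"
          using abs_ge_self[of "c j * (\<Sum>k<d. r a k * f j k)"] by (simp only: abs_mult)
      qed
      also have "\<dots> = (m * S^2 / 2) * (\<Sum>j<d. \<bar>c j\<bar>)"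
        by (subst mult.commute) (rule sum_distrib_right[symmetric])
      finally have "T \<le> (m * S^2 / 2) * (\<Sum>j<d. \<bar>c j\<bar>)" .
      then have "T^2 \<le> ((m * S^2 / 2) * (\<Sum>j<d. \<bar>c j\<bar>))^2" using T0 by (rule power_mono)
      also have "\<dots> = m^2 * S^4 / 4 * (\<Sum>j<d. \<bar>c j\<bar>)^2"
        by (simp add: power_mult_distrib power_divide power_mult[symmetric])
      also have "\<dots> \<le> m^2 * S^4 / 4 * (real d * (\<Sum>j<d. (c j)^2))"
        by (intro mult_left_mono sum_abs_square_le) auto
      also have "\<dots> \<le> m^2 * S^4 / 4 * (real d * (2 / l * T))"
      proof -
        have "l / 2 * (\<Sum>j<d. (c j)^2) \<le> T" using f[of c] by (simp add: c T_def)
        then have "(\<Sum>j<d. (c j)^2) \<le> 2 / l * T" using l by (simp add: field_simps)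
        then show ?thesis by (intro mult_left_mono) auto
      qed
      also have "\<dots> = (K * m^2) * T" by (simp add: K_def)
      finally have "T * T \<le> (K * m^2) * T" by (simp add: power2_eq_square)
      then show ?thesis
        using T0 K0 unfolding T_def[symmetric]
        by (cases "T = 0") auto
    qed
    have "\<bar>form_val n om (z a) (z b)\<bar> \<le> 2 * K * m^2" if ab: "a < D" "b < D" for a b
    proof -
      have "form_val n (sqdist d y) (z a) (z b) = -2 * (\<Sum>k<d. r a k * r b k)"
        by (simp add: form_val_sqdist[OF z0[OF ab(1)] z0[OF ab(2)]] r_def)
      moreover have "form_val n (sqdist d q) (z a) (z b) = 0"
        by (simp add: form_val_sqdist[OF z0[OF ab(1)] z0[OF ab(2)]] zq ab)
      ultimately have "\<bar>form_val n om (z a) (z b)\<bar> = 2 * \<bar>\<Sum>k<d. r a k * r b k\<bar>"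
        by (simp add: omv abs_mult)
      also have "\<dots> \<le> (\<Sum>k<d. 2 * \<bar>r a k * r b k\<bar>)"
        by (simp add: sum_abs flip: sum_distrib_left)
      also have "\<dots> \<le> (\<Sum>k<d. (r a k)^2 + (r b k)^2)"
      proof (rule sum_mono)
        fix k
        have "0 \<le> (\<bar>r a k\<bar> - \<bar>r b k\<bar>)^2" by simp
        then show "2 * \<bar>r a k * r b k\<bar> \<le> (r a k)^2 + (r b k)^2"
          by (simp add: power2_diff abs_mult)
      qed
      also have "\<dots> \<le> 2 * K * m^2" using R[OF ab(1)] R[OF ab(2)] by (simp add: sum.distrib)
      finally show ?thesis .
    qed
    then have bd: "\<bar>om u v\<bar> \<le> C * (2 * K * m^2)" for u v
      by (rule C[OF ne]) (use K0 in auto)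
    have "m = 0"
    proof (rule ccontr)
      assume "m \<noteq> 0"
      with mP obtain u v where uv: "m = \<bar>om u v\<bar>" by blast
      have "m \<le> C * (2 * K * m^2)" using bd[of u v] uv by simp
      also have "\<dots> \<le> \<bar>C\<bar> * (2 * K * m^2)" using K0 by (intro mult_right_mono) auto
      also have "\<dots> = m * (m * (2 * \<bar>C\<bar> * K))" by (simp add: power2_eq_square)
      also have "\<dots> \<le> m * (e * (2 * \<bar>C\<bar> * K))"
        using me m0 K0 by (intro mult_left_mono mult_right_mono) auto
      also have "\<dots> < m * 1" using eC m0 \<open>m \<noteq> 0\<close> by (intro mult_strict_left_mono) auto
      finally show False by simp
    qed
    then have "om u v = 0" if "u < n" "v < n" for u v using m[of u v] by simp
    then show ?thesis by (auto simp: om_def)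
  qed
  show ?thesis
    by (intro exI[of _ e] conjI e0 allI impI) (rule main[rule_format], simp_all)
qed

text \<open>Along a motion the total defect \<open>phi\<close> is continuous and starts at 0, but it
  takes no value above 0 and up to \<open>e\<close>. By the intermediate value theorem it stays
  0.\<close>

lemma certificate_imp_rigid:
  assumes "rigidity_certificate d n E q"
  shows "rigid_framework d n E q"
  unfolding rigid_framework_def
proof (intro allI impI)
  fix x :: "real \<Rightarrow> nat \<Rightarrow> nat \<Rightarrow> real"
  assume cont: "\<forall>v<n. \<forall>k<d. continuous_on {0..1} (\<lambda>t. x t v k)"
    and start: "\<forall>v<n. \<forall>k<d. x 0 v k = q v k"
    and edges: "\<forall>t\<in>{0..1}. \<forall>u v. {u, v} \<in> E \<longrightarrow> sqdist d (x t) u v = sqdist d q u v"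
  from certificate_gap[OF assms] obtain e where e: "e > 0" and
    gap: "\<forall>y. (\<forall>u v. {u, v} \<in> E \<longrightarrow> sqdist d y u v = sqdist d q u v) \<longrightarrow>
     (\<forall>u<n. \<forall>v<n. \<bar>sqdist d y u v - sqdist d q u v\<bar> \<le> e) \<longrightarrow>
     (\<forall>u<n. \<forall>v<n. sqdist d y u v = sqdist d q u v)"
    by (elim exE conjE) (rule that)
  define phi where "phi = (\<lambda>t. \<Sum>u<n. \<Sum>v<n. \<bar>sqdist d (x t) u v - sqdist d q u v\<bar>)"
  have phi_cont: "continuous_on {0..1} phi"
    unfolding phi_def sqdist_def using cont by (intro continuous_intros) auto
  have phi_ge: "\<bar>sqdist d (x t) u v - sqdist d q u v\<bar> \<le> phi t" if "u < n" "v < n" for t u v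
  proof -
    have "\<bar>sqdist d (x t) u v - sqdist d q u v\<bar> \<le> (\<Sum>v<n. \<bar>sqdist d (x t) u v - sqdist d q u v\<bar>)"
      by (rule member_le_sum[where f = "\<lambda>v. \<bar>sqdist d (x t) u v - sqdist d q u v\<bar>"]) (use that in auto)
    also have "\<dots> \<le> phi t" unfolding phi_def
      by (rule member_le_sum[where f = "\<lambda>u. \<Sum>v<n. \<bar>sqdist d (x t) u v - sqdist d q u v\<bar>"])
        (use that in \<open>auto intro: sum_nonneg\<close>)
    finally show ?thesis .
  qed
  have phi0: "phi 0 = 0" unfolding phi_def sqdist_def using start by simp
  have phi_gap: "phi t = 0" if "t \<in> {0..1}" "phi t \<le> e" for t
  proof -
    have "\<forall>u<n. \<forall>v<n. sqdist d (x t) u v = sqdist d q u v"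
    proof (rule gap[THEN spec, THEN mp, THEN mp])
      show "\<forall>u v. {u, v} \<in> E \<longrightarrow> sqdist d (x t) u v = sqdist d q u v" using edges that(1) by simp
      show "\<forall>u<n. \<forall>v<n. \<bar>sqdist d (x t) u v - sqdist d q u v\<bar> \<le> e"
        by (intro allI impI order.trans[OF phi_ge that(2)])
    qed
    then show ?thesis by (simp add: phi_def)
  qed
  have zero: "phi t = 0" if t: "t \<in> {0..1}" for t
  proof (rule ccontr)
    assume "phi t \<noteq> 0"
    with phi_gap t have "phi t > e" by force
    have "\<exists>s. 0 \<le> s \<and> s \<le> t \<and> phi s = e"
    proof (rule IVT')
      show "continuous_on {0..t} phi"
        by (rule continuous_on_subset[OF phi_cont]) (use t in auto)
    qed (use \<open>phi t > e\<close> e phi0 t in auto)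
    then obtain s where "0 \<le> s" "s \<le> t" "phi s = e" by blast
    with phi_gap[of s] t e show False by auto
  qed
  show "\<forall>t\<in>{0..1}. \<forall>u<n. \<forall>v<n. sqdist d (x t) u v = sqdist d q u v"
  proof (intro ballI allI impI)
    fix t :: real and u v assume "t \<in> {0..1}" "u < n" "v < n"
    with phi_ge[of u v t] zero[of t] show "sqdist d (x t) u v = sqdist d q u v" by simp
  qed
qed

section \<open>Perturbing a certificate\<close>

definition nonedges :: "nat \<Rightarrow> nat set set \<Rightarrow> (nat \<times> nat) set" where
  "nonedges n E = {(u, v). u < v \<and> v < n \<and> {u, v} \<notin> E}"

lemma finite_nonedges [simp]: "finite (nonedges n E)"
  by (rule finite_subset[of _ "{..<n} \<times> {..<n}"]) (auto simp: nonedges_def)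

lemma sum_over_nonedges:
  fixes g :: "nat \<Rightarrow> nat \<Rightarrow> 'a::comm_monoid_add"
  assumes zero: "\<And>u v. u = v \<or> {u, v} \<in> E \<Longrightarrow> g u v = 0"
  shows "(\<Sum>u<n. \<Sum>v<n. g u v) = (\<Sum>(u, v)\<in>nonedges n E. g u v + g v u)"
proof -
  define P where "P = nonedges n E"
  define g' where "g' = (\<lambda>(u, v). g u v)"
  have sw: "inj_on prod.swap P" by (rule inj_onI) auto
  have fin: "finite P" "finite (prod.swap ` P)" by (simp_all add: P_def)
  have "(\<Sum>u<n. \<Sum>v<n. g u v) = sum g' ({..<n} \<times> {..<n})"
    by (simp add: g'_def sum.cartesian_product)
  also have "\<dots> = sum g' (P \<union> prod.swap ` P)"
  proof (rule sum.mono_neutral_right)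
    show "P \<union> prod.swap ` P \<subseteq> {..<n} \<times> {..<n}" by (auto simp: P_def nonedges_def)
    show "\<forall>i\<in>{..<n} \<times> {..<n} - (P \<union> prod.swap ` P). g' i = 0"
    proof
      fix i assume i: "i \<in> {..<n} \<times> {..<n} - (P \<union> prod.swap ` P)"
      obtain u v where uv: "i = (u, v)" by (cases i)
      have "(v, u) \<notin> P"
      proof
        assume "(v, u) \<in> P"
        then have "prod.swap (v, u) \<in> prod.swap ` P" by (rule imageI)
        with i show False by (simp add: uv)
      qed
      then have "u = v \<or> {u, v} \<in> E"
        using i by (auto simp: uv P_def nonedges_def insert_commute)
      then show "g' i = 0" using zero by (simp add: uv g'_def)
    qed
  qed simp
  also have "\<dots> = sum g' P + sum g' (prod.swap ` P)"
    by (rule sum.union_disjoint) (use fin in \<open>auto simp: P_def nonedges_def\<close>)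
  also have "sum g' (prod.swap ` P) = sum (g' \<circ> prod.swap) P" by (rule sum.reindex[OF sw])
  also have "sum g' P + sum (g' \<circ> prod.swap) P = (\<Sum>(u, v)\<in>P. g u v + g v u)"
    unfolding sum.distrib[symmetric] by (intro sum.cong refl) (auto simp: g'_def)
  finally show ?thesis by (simp add: P_def)
qed

lemma form_val_nonedges:
  assumes "nonedge_form n E om"
  shows "form_val n om x y = (\<Sum>(u, v)\<in>nonedges n E. om u v * (x u * y v + x v * y u))"
proof -
  have sym: "om u v = om v u" and z: "u = v \<or> {u, v} \<in> E \<Longrightarrow> om u v = 0" for u v
    using assms unfolding nonedge_form_def by blast+
  have "form_val n om x y = (\<Sum>(u, v)\<in>nonedges n E. x u * om u v * y v + x v * om v u * y u)"
    unfolding form_val_def by (rule sum_over_nonedges) (use z in auto)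
  also have "\<dots> = (\<Sum>(u, v)\<in>nonedges n E. om u v * (x u * y v + x v * y u))"
    using sym by (intro sum.cong refl) (auto simp: algebra_simps)
  finally show ?thesis .
qed

text \<open>An injective linear map between finite-dimensional spaces has a bounded inverse. The
  constant is read off a left inverse of the matrix whose rows are pairs of test vectors and whose
  columns are non-edges.\<close>

lemma nonedge_form_bound:
  fixes z :: "nat \<Rightarrow> nat \<Rightarrow> real" and D :: nat
  assumes inj: "\<And>om. nonedge_form n E om \<Longrightarrow> (\<And>a b. a < D \<Longrightarrow> b < D \<Longrightarrow> form_val n om (z a) (z b) = 0)
     \<Longrightarrow> \<forall>u v. om u v = 0"
  shows "\<exists>C\<ge>0. \<forall>om B. nonedge_form n E om \<longrightarrow> (\<forall>a<D. \<forall>b<D. \<bar>form_val n om (z a) (z b)\<bar> \<le> B) \<longrightarrow>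
            0 \<le> B \<longrightarrow> (\<forall>u v. \<bar>om u v\<bar> \<le> C * B)"
proof -
  define P where "P = nonedges n E"
  define I where "I = {..<D} \<times> {..<D}"
  define M where "M = (\<lambda>(a, b) (u, v). z a u * z b v + z a v * z b u)"
  have fv: "form_val n om (z a) (z b) = (\<Sum>p\<in>P. M (a, b) p * om (fst p) (snd p))"
    if "nonedge_form n E om" for om a b
    unfolding form_val_nonedges[OF that] P_def by (intro sum.cong refl) (auto simp: M_def)
  have "\<exists>G. \<forall>p\<in>P. \<forall>p'\<in>P. (\<Sum>i\<in>I. G p i * M i p') = (if p = p' then 1 else 0)"
  proof (rule left_inverse_matrix)
    fix x assume x: "\<And>i. i \<in> I \<Longrightarrow> (\<Sum>p\<in>P. M i p * x p) = 0"
    define om where "om = (\<lambda>u v. if (u, v) \<in> P then x (u, v) else if (v, u) \<in> P then x (v, u) else 0)"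
    have asym: "(u, v) \<in> P \<Longrightarrow> (v, u) \<notin> P" for u v by (auto simp: P_def nonedges_def)
    have "nonedge_form n E om"
      using asym by (auto simp: nonedge_form_def om_def P_def nonedges_def insert_commute split: if_splits)
    moreover have "form_val n om (z a) (z b) = 0" if "a < D" "b < D" for a b
    proof -
      have "form_val n om (z a) (z b) = (\<Sum>p\<in>P. M (a, b) p * x p)"
        unfolding fv[OF calculation] by (intro sum.cong refl) (auto simp: om_def)
      also have "\<dots> = 0" using x that by (simp add: I_def)
      finally show ?thesis .
    qed
    ultimately have z: "\<forall>u v. om u v = 0" by (rule inj)
    show "\<forall>j\<in>P. x j = 0"
    proof
      fix j assume "j \<in> P"
      then have "x j = om (fst j) (snd j)" by (simp add: om_def)
      with z show "x j = 0" by simp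
    qed
  qed (simp_all add: P_def I_def)
  then obtain G where G: "\<And>p. p \<in> P \<Longrightarrow> \<forall>p'\<in>P. (\<Sum>i\<in>I. G p i * M i p') = (if p = p' then 1 else 0)" by blast
  define C where "C = (\<Sum>p\<in>P. \<Sum>i\<in>I. \<bar>G p i\<bar>)"
  have C0: "C \<ge> 0" unfolding C_def by (intro sum_nonneg) auto
  have bd: "\<bar>om u v\<bar> \<le> C * B"
    if om: "nonedge_form n E om" and B: "\<forall>a<D. \<forall>b<D. \<bar>form_val n om (z a) (z b)\<bar> \<le> B" "0 \<le> B" for om B u v
  proof -
    have main: "\<bar>om u v\<bar> \<le> C * B" if uv: "(u, v) \<in> P" for u v
    proof -
      have "om u v = (\<Sum>i\<in>I. G (u, v) i * (\<Sum>p\<in>P. M i p * om (fst p) (snd p)))"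
        using left_inverse_apply[where M = M and g = "G (u, v)" and x = "\<lambda>p. om (fst p) (snd p)", OF _ uv G[OF uv]]
        by (simp add: P_def)
      also have "\<bar>\<dots>\<bar> \<le> (\<Sum>i\<in>I. \<bar>G (u, v) i\<bar> * B)"
      proof (rule order.trans[OF sum_abs], rule sum_mono)
        fix i assume "i \<in> I"
        then obtain a b where ab: "i = (a, b)" "a < D" "b < D" by (auto simp: I_def)
        then have "\<bar>\<Sum>p\<in>P. M i p * om (fst p) (snd p)\<bar> \<le> B"
          using B(1) unfolding fv[OF om] by simp
        then show "\<bar>G (u, v) i * (\<Sum>p\<in>P. M i p * om (fst p) (snd p))\<bar> \<le> \<bar>G (u, v) i\<bar> * B"
          by (simp add: abs_mult mult_left_mono)
      qed
      also have "\<dots> = (\<Sum>i\<in>I. \<bar>G (u, v) i\<bar>) * B" by (rule sum_distrib_right[symmetric])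
      also have "\<dots> \<le> C * B" unfolding C_def
        by (intro mult_right_mono B member_le_sum[where f = "\<lambda>p. \<Sum>i\<in>I. \<bar>G p i\<bar>"] uv)
          (auto simp: P_def intro: sum_nonneg)
      finally show ?thesis .
    qed
    show ?thesis
    proof (cases "om u v = 0")
      case True
      then show ?thesis using C0 B(2) by simp
    next
      case False
      then have h: "u < n" "v < n" "u \<noteq> v" "{u, v} \<notin> E" and sym: "om u v = om v u"
        using om by (auto simp: nonedge_form_def)
      from h have "(u, v) \<in> P \<or> (v, u) \<in> P" by (auto simp: P_def nonedges_def insert_commute)
      then show ?thesis using main[of u v] main[of v u] sym by auto
    qed
  qed
  show ?thesis by (intro exI[of _ C] conjI C0 allI impI) (rule bd)
qed

lemma form_val_add_left: "form_val n om (\<lambda>v. x v + x' v) y = form_val n om x y + form_val n om x' y"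
  by (simp add: form_val_def sum.distrib algebra_simps)

lemma form_val_add_right: "form_val n om x (\<lambda>v. y v + y' v) = form_val n om x y + form_val n om x y'"
  by (simp add: form_val_def sum.distrib algebra_simps)

lemma near_identity_lower_bound:
  fixes M :: "nat \<Rightarrow> nat \<Rightarrow> real"
  assumes M: "\<And>k l. k < d \<Longrightarrow> l < d \<Longrightarrow> \<bar>M k l - (if k = l then 1 else 0)\<bar> \<le> t"
    and t: "0 \<le> t" "2 * real d * t \<le> 1"
  shows "1 / 4 * (\<Sum>k<d. (c k)^2) \<le> (\<Sum>l<d. (\<Sum>k<d. c k * M k l)^2)"
proof -
  define s where "s = (\<Sum>k<d. (c k)^2)"
  have s0: "s \<ge> 0" by (simp add: s_def sum_nonneg)
  have step: "(c l)^2 \<le> 2 * (\<Sum>k<d. c k * M k l)^2 + 2 * (t^2 * (real d * s))" if l: "l < d" for l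
  proof -
    define r where "r = (\<Sum>k<d. c k * (M k l - (if k = l then 1 else 0)))"
    have "(\<Sum>k<d. c k * M k l) = r + (\<Sum>k<d. if k = l then c k else 0)"
      unfolding r_def sum.distrib[symmetric] by (intro sum.cong refl) (auto simp: algebra_simps)
    then have eq: "(\<Sum>k<d. c k * M k l) = r + c l" using l by simp
    have "\<bar>r\<bar> \<le> (\<Sum>k<d. \<bar>c k\<bar> * t)" unfolding r_def
      by (rule order.trans[OF sum_abs]) (auto simp: abs_mult intro!: sum_mono mult_left_mono M l)
    also have "\<dots> = t * (\<Sum>k<d. \<bar>c k\<bar>)" by (simp add: sum_distrib_left mult.commute)
    finally have "\<bar>r\<bar>^2 \<le> (t * (\<Sum>k<d. \<bar>c k\<bar>))^2" by (rule power_mono) simp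
    also have "\<dots> = t^2 * (\<Sum>k<d. \<bar>c k\<bar>)^2" by (rule power_mult_distrib)
    also have "\<dots> \<le> t^2 * (real d * s)" unfolding s_def by (intro mult_left_mono sum_abs_square_le) auto
    finally have r: "r^2 \<le> t^2 * (real d * s)" by simp
    have "0 \<le> (r + (r + c l))^2" by simp
    then have "(c l)^2 \<le> 2 * (r + c l)^2 + 2 * r^2" by (simp add: power2_eq_square algebra_simps)
    with r eq show ?thesis by simp
  qed
  have "s \<le> (\<Sum>l<d. 2 * (\<Sum>k<d. c k * M k l)^2 + 2 * (t^2 * (real d * s)))"
    unfolding s_def by (rule sum_mono) (use step in \<open>auto simp: s_def\<close>)
  also have "\<dots> = 2 * (\<Sum>l<d. (\<Sum>k<d. c k * M k l)^2) + (2 * real d * t)^2 * s / 2"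
    by (simp add: sum.distrib sum_distrib_left power2_eq_square)
  also have "\<dots> \<le> 2 * (\<Sum>l<d. (\<Sum>k<d. c k * M k l)^2) + 1 * s / 2"
  proof -
    have "(2 * real d * t)^2 \<le> 1" using t by (simp add: power_le_one)
    then have "(2 * real d * t)^2 * s \<le> 1 * s" using s0 by (rule mult_right_mono)
    then show ?thesis by simp
  qed
  finally show ?thesis by (simp add: s_def)
qed

text \<open>For \<open>q\<close> near \<open>x\<close>, subtracting from each \<open>z a\<close> a
  small combination of the \<open>x k\<close> makes it annihilate \<open>q\<close>, because the
  matrix \<open>M\<close> of products of the \<open>x k\<close> with the coordinates of
  \<open>q\<close> is close to the identity. The correction changes the values of a form by a small
  multiple of its largest entry, so the constant at most doubles, and the \<open>x k\<close> serve
  as \<open>w\<close> with \<open>l = 1/4\<close>.\<close>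

lemma certificate_near:
  fixes x z :: "nat \<Rightarrow> nat \<Rightarrow> real" and D :: nat
  assumes orth: "\<And>j k. j < d \<Longrightarrow> k < d \<Longrightarrow> (\<Sum>v<n. x j v * x k v) = (if j = k then 1 else 0)"
    and x0: "\<And>j. j < d \<Longrightarrow> (\<Sum>v<n. x j v) = 0"
    and z0: "\<And>a. a < D \<Longrightarrow> (\<Sum>v<n. z a v) = 0"
    and zx: "\<And>a k. a < D \<Longrightarrow> k < d \<Longrightarrow> (\<Sum>v<n. z a v * x k v) = 0"
    and inj: "\<And>om. nonedge_form n E om \<Longrightarrow> (\<And>a b. a < D \<Longrightarrow> b < D \<Longrightarrow> form_val n om (z a) (z b) = 0)
     \<Longrightarrow> \<forall>u v. om u v = 0"
  shows "\<exists>e>0. \<forall>q. (\<forall>v<n. \<forall>k<d. \<bar>q v k - x k v\<bar> < e) \<longrightarrow> rigidity_certificate d n E q"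
proof -
  have "\<exists>C\<ge>0. \<forall>om B. nonedge_form n E om \<longrightarrow> (\<forall>a<D. \<forall>b<D. \<bar>form_val n om (z a) (z b)\<bar> \<le> B) \<longrightarrow>
            0 \<le> B \<longrightarrow> (\<forall>u v. \<bar>om u v\<bar> \<le> C * B)"
    by (rule nonedge_form_bound) (rule inj)
  then obtain C where C0: "C \<ge> 0" and
    C': "\<forall>om B. nonedge_form n E om \<longrightarrow> (\<forall>a<D. \<forall>b<D. \<bar>form_val n om (z a) (z b)\<bar> \<le> B) \<longrightarrow>
            0 \<le> B \<longrightarrow> (\<forall>u v. \<bar>om u v\<bar> \<le> C * B)" by (elim exE conjE) (rule that)
  define S where "S = 1 + (\<Sum>a<D. \<Sum>v<n. \<bar>z a v\<bar>) + (\<Sum>j<d. \<Sum>v<n. \<bar>x j v\<bar>)"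
  have nn: "(\<Sum>a<D. \<Sum>v<n. \<bar>z a v\<bar>) \<ge> 0" "(\<Sum>j<d. \<Sum>v<n. \<bar>x j v\<bar>) \<ge> 0"
    by (intro sum_nonneg, simp)+
  then have S1: "S \<ge> 1" by (simp add: S_def)
  have Sz: "(\<Sum>v<n. \<bar>z a v\<bar>) \<le> S" if "a < D" for a
    using sum_abs_le_total[OF that, where z = z and n = n] nn by (simp add: S_def)
  have Sx: "(\<Sum>v<n. \<bar>x a v\<bar>) \<le> S" if "a < d" for a
    using sum_abs_le_total[OF that, where z = x and n = n] nn by (simp add: S_def)
  \<comment> \<open>Large enough for three needs at once: \<open>M\<close> is near the identity
    (\<open>de\<close>), the correction has size at most 1 (\<open>dlS\<close>), and its effect,
    once multiplied by \<open>C\<close>, is at most half of the largest entry of the form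
    (\<open>dlC\<close>).\<close>
  define A where "A = 4 * (real d + 1)^2 * S^2 * (2 * S + 1) * (C + 1)"
  have A0: "A > 0" using S1 C0 by (simp add: A_def)
  define e where "e = 1 / A"
  have e0: "e > 0" using A0 by (simp add: e_def)
  define dl where "dl = 2 * (real d)^2 * e * S^2"
  have dl0: "dl \<ge> 0" using e0 by (simp add: dl_def)
  have eA: "e * A = 1" using A0 by (simp add: e_def)
  have dl1: "2 * dl * (2 * S + 1) * (C + 1) \<le> 1"
  proof -
    have "2 * dl * (2 * S + 1) * (C + 1) = e * (4 * (real d)^2 * S^2 * (2 * S + 1) * (C + 1))"
      by (simp add: dl_def)
    also have "\<dots> \<le> e * A" unfolding A_def
      using e0 S1 C0 by (intro mult_left_mono mult_right_mono power_mono) auto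
    finally show ?thesis using eA by simp
  qed
  have de: "2 * real d * (e * S) \<le> 1"
  proof -
    have "2 * real d * S * 1 \<le> (4 * (real d + 1)^2 * S^2) * ((2 * S + 1) * (C + 1))"
    proof (rule mult_mono)
      have "1 * (2 * real d) * (1 * S) \<le> (4 * (real d + 1)^2) * (S * S)"
        using S1 by (intro mult_mono) (auto simp: power2_eq_square algebra_simps)
      then show "2 * real d * S \<le> 4 * (real d + 1)^2 * S^2" by (simp add: power2_eq_square)
      have "1 * 1 \<le> (2 * S + 1) * (C + 1)" using S1 C0 by (intro mult_mono) auto
      then show "1 \<le> (2 * S + 1) * (C + 1)" by simp
    qed (use S1 in auto)
    then have "2 * real d * S \<le> A" by (simp add: A_def mult_ac)
    then have "e * (2 * real d * S) \<le> e * A" using e0 by (intro mult_left_mono) auto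
    with eA show ?thesis by (simp add: mult_ac)
  qed
  have dlS: "dl \<le> 1" and dlC: "C * (dl * (2 * S + 1)) \<le> 1 / 2"
  proof -
    have "2 * dl * 1 * 1 \<le> 2 * dl * (2 * S + 1) * (C + 1)"
      using dl0 S1 C0 by (intro mult_mono) auto
    with dl1 dl0 show "dl \<le> 1" by simp
    have "C * (dl * (2 * S + 1)) \<le> (C + 1) * (dl * (2 * S + 1))"
      using dl0 S1 by (intro mult_right_mono) auto
    also have "\<dots> \<le> 1 / 2" using dl1 by (simp add: mult_ac)
    finally show "C * (dl * (2 * S + 1)) \<le> 1 / 2" .
  qed
  have "rigidity_certificate d n E q" if q: "\<forall>v<n. \<forall>k<d. \<bar>q v k - x k v\<bar> < e" for q
  proof -
    define M where "M = (\<lambda>k l. \<Sum>v<n. x k v * q v l)"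
    have pert: "\<bar>(\<Sum>v<n. y v * q v l) - (\<Sum>v<n. y v * x l v)\<bar> \<le> e * (\<Sum>v<n. \<bar>y v\<bar>)" if l: "l < d" for y l
    proof -
      have "\<bar>(\<Sum>v<n. y v * q v l) - (\<Sum>v<n. y v * x l v)\<bar> = \<bar>\<Sum>v<n. y v * (q v l - x l v)\<bar>"
        by (simp add: sum_subtractf right_diff_distrib)
      also have "\<dots> \<le> (\<Sum>v<n. \<bar>y v\<bar> * e)"
      proof (rule order.trans[OF sum_abs], rule sum_mono)
        fix v assume "v \<in> {..<n}"
        with q l have "\<bar>q v l - x l v\<bar> \<le> e" by (simp add: less_imp_le)
        then show "\<bar>y v * (q v l - x l v)\<bar> \<le> \<bar>y v\<bar> * e" by (simp add: abs_mult mult_left_mono)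
      qed
      also have "\<dots> = e * (\<Sum>v<n. \<bar>y v\<bar>)" by (simp add: sum_distrib_left mult.commute)
      finally show ?thesis .
    qed
    have Mid: "\<bar>M k l - (if k = l then 1 else 0)\<bar> \<le> e * S" if "k < d" "l < d" for k l
    proof -
      have "\<bar>M k l - (if k = l then 1 else 0)\<bar> \<le> e * (\<Sum>v<n. \<bar>x k v\<bar>)"
        using pert[OF that(2), of "x k"] orth[OF that] by (simp add: M_def)
      also have "\<dots> \<le> e * S" using e0 Sx that by (intro mult_left_mono) auto
      finally show ?thesis .
    qed
    have low: "1 / 4 * (\<Sum>k<d. (c k)^2) \<le> (\<Sum>l<d. (\<Sum>k<d. c k * M k l)^2)" for c
      by (rule near_identity_lower_bound[OF Mid _ de]) (use e0 S1 in auto)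
    define b where "b = (\<lambda>a l. \<Sum>v<n. z a v * q v l)"
    have "\<exists>c. \<forall>l\<in>{..<d}. (\<Sum>k<d. M k l * c k) = b a l" for a
    proof (rule square_system_solvable)
      fix c assume "\<And>l. l \<in> {..<d} \<Longrightarrow> (\<Sum>k<d. M k l * c k) = 0"
      then have "(\<Sum>k<d. (c k)^2) \<le> 0" using low[of c] by (simp add: mult.commute)
      then have "(\<Sum>k<d. (c k)^2) = 0" by (intro antisym sum_nonneg) auto
      then show "\<forall>k\<in>{..<d}. c k = 0" by (simp add: sum_nonneg_eq_0_iff)
    qed auto
    then obtain c where c: "\<And>a. \<forall>l\<in>{..<d}. (\<Sum>k<d. M k l * c a k) = b a l" by metis
    have cM: "(\<Sum>k<d. c a k * M k l) = b a l" if "l < d" for a l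
      using c[of a] that by (simp add: mult.commute)
    have cb: "\<bar>c a k\<bar> \<le> 2 * real d * e * S" if a: "a < D" and k: "k < d" for a k
    proof -
      have "(c a k)^2 \<le> (\<Sum>k<d. (c a k)^2)"
        by (rule member_le_sum[where f = "\<lambda>k. (c a k)^2"]) (use k in auto)
      also have "\<dots> \<le> 4 * (\<Sum>l<d. (b a l)^2)" using low[of "c a"] by (simp add: cM)
      also have "\<dots> \<le> 4 * (\<Sum>l<d. (e * S)^2)"
      proof (intro mult_left_mono sum_mono)
        fix l assume "l \<in> {..<d}"
        then have "\<bar>b a l\<bar> \<le> e * (\<Sum>v<n. \<bar>z a v\<bar>)"
          using pert[of l "z a"] zx[OF a, of l] by (simp add: b_def)
        also have "\<dots> \<le> e * S" using e0 Sz a by (intro mult_left_mono) auto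
        finally have "\<bar>b a l\<bar>^2 \<le> (e * S)^2" by (rule power_mono) simp
        then show "(b a l)^2 \<le> (e * S)^2" by simp
      qed simp
      also have "\<dots> = 4 * real d * (e * S)^2" by simp
      also have "\<dots> \<le> 4 * (real d)^2 * (e * S)^2"
        using k by (intro mult_right_mono) (auto simp: power2_eq_square)
      also have "\<dots> = (2 * real d * e * S)^2" by (simp add: power2_eq_square)
      finally have "\<bar>c a k\<bar> \<le> \<bar>2 * real d * e * S\<bar>" by (simp only: abs_le_square_iff)
      then show ?thesis using e0 S1 by (simp add: abs_mult)
    qed
    define y where "y = (\<lambda>a v. - (\<Sum>k<d. c a k * x k v))"
    define z' where "z' = (\<lambda>a v. z a v + y a v)"
    have yabs: "(\<Sum>v<n. \<bar>y a v\<bar>) \<le> dl" if a: "a < D" for a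
    proof -
      have "(\<Sum>v<n. \<bar>y a v\<bar>) \<le> (\<Sum>v<n. \<Sum>k<d. \<bar>c a k\<bar> * \<bar>x k v\<bar>)"
      proof (rule sum_mono)
        fix v
        show "\<bar>y a v\<bar> \<le> (\<Sum>k<d. \<bar>c a k\<bar> * \<bar>x k v\<bar>)"
          using sum_abs[of "\<lambda>k. c a k * x k v" "{..<d}"] by (simp add: y_def abs_mult)
      qed
      also have "\<dots> = (\<Sum>k<d. \<bar>c a k\<bar> * (\<Sum>v<n. \<bar>x k v\<bar>))"
        by (subst sum.swap) (simp add: sum_distrib_left)
      also have "\<dots> \<le> (\<Sum>k<d. (2 * real d * e * S) * S)"
        using e0 S1 by (intro sum_mono mult_mono cb a Sx) (auto intro: sum_nonneg)
      also have "\<dots> = dl" by (simp add: dl_def power2_eq_square)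
      finally show ?thesis .
    qed
    have z'0: "(\<Sum>v<n. z' a v) = 0" if "a < D" for a
    proof -
      have "(\<Sum>v<n. \<Sum>k<d. c a k * x k v) = 0"
        by (subst sum.swap) (simp add: x0 flip: sum_distrib_left)
      then show ?thesis using z0[OF that] by (simp add: z'_def y_def sum_subtractf)
    qed
    have z'q: "(\<Sum>v<n. z' a v * q v l) = 0" if "l < d" for a l
    proof -
      have "(\<Sum>v<n. (\<Sum>k<d. c a k * x k v) * q v l) = (\<Sum>k<d. c a k * M k l)"
        unfolding sum_distrib_right by (subst sum.swap) (simp add: M_def sum_distrib_left mult.assoc)
      then show ?thesis
        using cM[OF that, of a] by (simp add: z'_def y_def b_def sum_subtractf left_diff_distrib)
    qed
    have bound: "\<bar>om u v\<bar> \<le> 2 * C * B"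
      if om: "nonedge_form n E om" and B: "\<forall>a<D. \<forall>b<D. \<bar>form_val n om (z' a) (z' b)\<bar> \<le> B"
        and B0: "0 \<le> B" for om B u v
    proof -
      obtain m where m0: "m \<ge> 0" and m: "\<And>u v. \<bar>om u v\<bar> \<le> m" and mP: "m = 0 \<or> (\<exists>u v. m = \<bar>om u v\<bar>)"
        by (rule nonedge_form_max[OF om]) (rule that)
      have diff: "\<bar>form_val n om (z a) (z b)\<bar> \<le> B + m * (dl * (2 * S + 1))" if ab: "a < D" "b < D" for a b
      proof -
        have e1: "form_val n om (z' a) (z' b) = form_val n om (z a) (z b) + form_val n om (z a) (y b)
           + (form_val n om (y a) (z b) + form_val n om (y a) (y b))"
          unfolding z'_def by (simp only: form_val_add_left form_val_add_right)
        have a1: "\<bar>form_val n om p r\<bar> \<le> m * (s * s')" if "(\<Sum>v<n. \<bar>p v\<bar>) \<le> s" "(\<Sum>v<n. \<bar>r v\<bar>) \<le> s'" for p r s s'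
        proof -
          have "\<bar>form_val n om p r\<bar> \<le> m * ((\<Sum>v<n. \<bar>p v\<bar>) * (\<Sum>v<n. \<bar>r v\<bar>))"
            by (rule abs_form_val_le) (rule m)
          also have "\<dots> \<le> m * (s * s')"
            using m0 that by (intro mult_left_mono mult_mono) (auto intro: sum_nonneg order.trans[OF sum_nonneg])
          finally show ?thesis .
        qed
        have "\<bar>form_val n om (z a) (z b)\<bar> \<le> B + m * (S * dl) + m * (dl * S) + m * (dl * dl)"
          using e1 a1[OF Sz[OF ab(1)] yabs[OF ab(2)]] a1[OF yabs[OF ab(1)] Sz[OF ab(2)]]
            a1[OF yabs[OF ab(1)] yabs[OF ab(2)]] B[rule_format, OF ab] by linarith
        also have "\<dots> \<le> B + m * (S * dl) + m * (dl * S) + m * (dl * 1)"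
          using m0 dl0 dlS by (intro add_left_mono mult_left_mono) auto
        also have "\<dots> = B + m * (dl * (2 * S + 1))" by (simp add: algebra_simps)
        finally show ?thesis .
      qed
      have "\<bar>om u v\<bar> \<le> C * (B + m * (dl * (2 * S + 1)))" for u v
        using C' om diff B0 m0 dl0 S1 by simp
      then have "m \<le> C * (B + m * (dl * (2 * S + 1)))"
        using mP B0 C0 m0 dl0 S1 by auto
      also have "\<dots> = C * B + m * (C * (dl * (2 * S + 1)))" by (simp add: algebra_simps)
      also have "\<dots> \<le> C * B + m * (1 / 2)" using m0 dlC by (intro add_left_mono mult_left_mono) auto
      finally have "m \<le> 2 * C * B" by simp
      with m[of u v] show ?thesis by simp
    qed
    show ?thesis
      unfolding rigidity_certificate_def
      by (rule exI[of _ D], rule exI[of _ z'], rule exI[of _ "2 * C"], rule exI[of _ x], rule exI[of _ "1/4"])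
        (use low bound z'0 z'q x0 in \<open>simp add: M_def\<close>)
  qed
  then show ?thesis using e0 by (intro exI[of _ e]) simp
qed

section \<open>Generic points\<close>

text \<open>The ring generated over the rationals by the \<open>c i\<close>, written with the same
  sums as \<open>alg_indep_rat\<close> so that coefficients can be matched.\<close>

definition rat_span :: "'i set \<Rightarrow> ('i \<Rightarrow> real) \<Rightarrow> real set" where
  "rat_span I c = {(\<Sum>m\<in>M. of_rat (a m) * (\<Prod>i\<in>I. c i ^ m i)) | (M :: ('i \<Rightarrow> nat) set) a.
     finite M \<and> (\<forall>m\<in>M. \<forall>i. i \<notin> I \<longrightarrow> m i = 0)}"

lemma countable_rat_span:
  assumes "finite I"
  shows "countable (rat_span I c)"
proof -
  obtain ii where ii: "set ii = I" using finite_list[OF assms] by blast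
  have "\<exists>k. k < length ii \<and> ii ! k = i" if "i \<in> I" for i
    using that ii by (metis in_set_conv_nth)
  then obtain idx where idx: "\<And>i. i \<in> I \<Longrightarrow> idx i < length ii \<and> ii ! idx i = i" by metis
  define val where "val = (\<lambda>l :: (rat \<times> nat list) list.
    (\<Sum>(r, es)\<leftarrow>l. of_rat r * (\<Prod>i\<in>I. c i ^ (es ! idx i))))"
  have "rat_span I c \<subseteq> range val"
  proof
    fix s assume "s \<in> rat_span I c"
    then obtain M a where M: "finite M" "s = (\<Sum>m\<in>M. of_rat (a m) * (\<Prod>i\<in>I. c i ^ m i))"
      unfolding rat_span_def by blast
    obtain ms where ms: "set ms = M" "distinct ms" using finite_distinct_list[OF M(1)] by blast
    have "val (map (\<lambda>m. (a m, map m ii)) ms) = s"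
      using ms idx by (simp add: val_def M(2) comp_def sum_list_distinct_conv_sum_set)
    then show "s \<in> range val" by blast
  qed
  moreover have "countable (range val)" by (rule countable_image) (rule countableI_type)
  ultimately show ?thesis by (rule countable_subset)
qed

text \<open>Grouping the monomials of a vanishing polynomial by their exponent at \<open>j\<close>
  gives a polynomial \<open>p\<close> in one variable with coefficients in
  \<open>rat_span I c\<close> and root \<open>v\<close>. Hence \<open>p\<close> is zero, and each of
  its coefficients is a polynomial vanishing at the old values.\<close>

lemma alg_indep_rat_extend:
  assumes fin: "finite I" and j: "j \<notin> I" and indep: "alg_indep_rat I c"
    and v: "\<And>p. p \<noteq> 0 \<Longrightarrow> set (coeffs p) \<subseteq> rat_span I c \<Longrightarrow> poly p v \<noteq> 0"
  shows "alg_indep_rat (insert j I) (c(j := v))"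
  unfolding alg_indep_rat_def
proof (intro allI impI ballI)
  fix M :: "('a \<Rightarrow> nat) set" and a m0
  assume M: "finite M" and supp: "\<forall>m\<in>M. \<forall>i. i \<notin> insert j I \<longrightarrow> m i = 0"
    and zero: "(\<Sum>m\<in>M. of_rat (a m) * (\<Prod>i\<in>insert j I. (c(j := v)) i ^ m i)) = 0"
    and m0: "m0 \<in> M"
  define p where "p = (\<Sum>m\<in>M. monom (of_rat (a m) * (\<Prod>i\<in>I. c i ^ m i)) (m j))"
  have prod: "(\<Prod>i\<in>insert j I. (c(j := v)) i ^ m i) = v ^ m j * (\<Prod>i\<in>I. c i ^ m i)" for m :: "'a \<Rightarrow> nat"
  proof -
    have "(\<Prod>i\<in>I. (c(j := v)) i ^ m i) = (\<Prod>i\<in>I. c i ^ m i)"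
      using j by (intro prod.cong) auto
    then show ?thesis using fin j by simp
  qed
  have "poly p v = 0"
    using zero by (simp only: p_def poly_sum poly_monom prod mult_ac)
  define N where "N = (\<lambda>k. (\<lambda>m. m(j := 0)) ` {m \<in> M. m j = k})"
  define b where "b = (\<lambda>k m. a (m(j := k)))"
  have coeff: "coeff p k = (\<Sum>m\<in>N k. of_rat (b k m) * (\<Prod>i\<in>I. c i ^ m i))" for k
  proof -
    have inj: "inj_on (\<lambda>m. m(j := 0)) {m \<in> M. m j = k}"
    proof (rule inj_onI)
      fix m m' assume h: "m \<in> {m \<in> M. m j = k}" "m' \<in> {m \<in> M. m j = k}" "m(j := 0) = m'(j := 0)"
      then have "m i = m' i" for i by (cases "i = j") (auto dest: fun_cong[of _ _ i])
      then show "m = m'" by blast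
    qed
    have "coeff p k = (\<Sum>m\<in>M. if m j = k then of_rat (a m) * (\<Prod>i\<in>I. c i ^ m i) else 0)"
      by (simp add: p_def coeff_sum coeff_monom)
    also have "\<dots> = (\<Sum>m\<in>{m \<in> M. m j = k}. of_rat (a m) * (\<Prod>i\<in>I. c i ^ m i))"
      using M by (simp add: sum.inter_filter)
    also have "\<dots> = (\<Sum>m\<in>N k. of_rat (b k m) * (\<Prod>i\<in>I. c i ^ m i))"
      unfolding N_def sum.reindex[OF inj] comp_def
    proof (rule sum.cong[OF refl])
      fix m assume m: "m \<in> {m \<in> M. m j = k}"
      then have "b k (m(j := 0)) = a m" by (auto simp: b_def)
      moreover have "(\<Prod>i\<in>I. c i ^ (m(j := 0)) i) = (\<Prod>i\<in>I. c i ^ m i)"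
        using j by (intro prod.cong) auto
      ultimately show "of_rat (a m) * (\<Prod>i\<in>I. c i ^ m i) =
          of_rat (b k (m(j := 0))) * (\<Prod>i\<in>I. c i ^ (m(j := 0)) i)" by simp
    qed
    finally show ?thesis .
  qed
  have N: "finite (N k)" "\<forall>m\<in>N k. \<forall>i. i \<notin> I \<longrightarrow> m i = 0" for k
    using M supp by (auto simp: N_def)
  have "coeff p k \<in> rat_span I c" for k
    unfolding rat_span_def coeff by (intro CollectI exI[of _ "N k"] exI[of _ "b k"] conjI refl N)
  then have "set (coeffs p) \<subseteq> rat_span I c"
    by (auto simp: coeffs_def split: if_splits)
  with v \<open>poly p v = 0\<close> have "p = 0" by blast
  then have "(\<Sum>m\<in>N (m0 j). of_rat (b (m0 j) m) * (\<Prod>i\<in>I. c i ^ m i)) = 0"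
    using coeff[of "m0 j"] by simp
  then have "\<forall>m\<in>N (m0 j). b (m0 j) m = 0"
    using indep[unfolded alg_indep_rat_def, THEN spec[of _ "N (m0 j)"], THEN spec[of _ "b (m0 j)"]] N
    by simp
  moreover have "m0(j := 0) \<in> N (m0 j)" using m0 by (auto simp: N_def)
  ultimately have "b (m0 j) (m0(j := 0)) = 0" by blast
  then show "a m0 = 0" by (simp add: b_def)
qed

text \<open>Countably many polynomials have coefficients in \<open>rat_span I c\<close>, and each
  nonzero one has finitely many roots, so an open interval contains a value avoiding all of
  them.\<close>

lemma alg_indep_rat_near:
  assumes "finite I" "e > 0"
  shows "\<exists>c. alg_indep_rat I c \<and> (\<forall>i\<in>I. \<bar>c i - x i\<bar> < e)"
  using assms(1)
proof induction
  case empty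
  have "alg_indep_rat {} c" for c :: "'a \<Rightarrow> real"
    unfolding alg_indep_rat_def
  proof (intro allI impI ballI)
    fix M :: "('a \<Rightarrow> nat) set" and a m
    assume h: "\<forall>m\<in>M. \<forall>i. i \<notin> {} \<longrightarrow> m i = 0" "m \<in> M"
      "(\<Sum>m\<in>M. of_rat (a m) * (\<Prod>i\<in>{}. c i ^ m i)) = 0"
    \<comment> \<open>Exponents supported in the empty set are zero, so \<open>M\<close> consists of
      one monomial and the vanishing sum is its coefficient.\<close>
    have z: "m' = (\<lambda>_. 0)" if "m' \<in> M" for m' using h(1) that by (intro ext) blast
    have "M = {m}"
    proof (intro set_eqI iffI)
      fix m' assume "m' \<in> M"
      with z[OF this] z[OF h(2)] show "m' \<in> {m}" by simp
    next
      fix m' assume "m' \<in> {m}"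
      with h(2) show "m' \<in> M" by simp
    qed
    with h show "a m = 0" by simp
  qed
  then show ?case by auto
next
  case (insert j I)
  then obtain c where c: "alg_indep_rat I c" "\<forall>i\<in>I. \<bar>c i - x i\<bar> < e" by blast
  define P where "P = {p. p \<noteq> 0 \<and> set (coeffs p) \<subseteq> rat_span I c}"
  have "P \<subseteq> Poly ` lists (rat_span I c)"
  proof
    fix p assume "p \<in> P"
    then have "coeffs p \<in> lists (rat_span I c)" by (auto simp: P_def in_lists_conv_set)
    then show "p \<in> Poly ` lists (rat_span I c)" by (metis Poly_coeffs imageI)
  qed
  then have "countable P"
    by (rule countable_subset) (intro countable_image countable_lists countable_rat_span insert)
  then have "countable (\<Union>p\<in>P. {v. poly p v = 0})"
    by (rule countable_UN) (auto simp: P_def intro!: countable_finite poly_roots_finite)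
  moreover have "uncountable {x j - e<..<x j + e}"
    using assms(2) by (simp add: uncountable_open_interval)
  ultimately obtain v where v: "v \<in> {x j - e<..<x j + e}" "v \<notin> (\<Union>p\<in>P. {v. poly p v = 0})"
    by (meson countable_subset subsetI)
  have "alg_indep_rat (insert j I) (c(j := v))"
    by (rule alg_indep_rat_extend[OF insert(1,2) c(1)]) (use v(2) in \<open>auto simp: P_def\<close>)
  moreover have "\<forall>i\<in>insert j I. \<bar>(c(j := v)) i - x i\<bar> < e"
    using c(2) v(1) insert(2) by auto
  ultimately show ?case by blast
qed

lemma generic_framework_near:
  assumes "e > 0"
  shows "\<exists>q. generic_framework d n q \<and> (\<forall>v<n. \<forall>k<d. \<bar>q v k - x v k\<bar> < e)"
proof -
  obtain c where c: "alg_indep_rat ({..<n} \<times> {..<d}) c"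
     "\<forall>i\<in>{..<n} \<times> {..<d}. \<bar>c i - (case i of (v, k) \<Rightarrow> x v k)\<bar> < e"
    using alg_indep_rat_near[OF _ assms, of "{..<n} \<times> {..<d}"] by blast
  then have "generic_framework d n (\<lambda>v k. c (v, k))"
    by (simp add: generic_framework_def)
  with c(2) show ?thesis by (intro exI[of _ "\<lambda>v k. c (v, k)"]) auto
qed

section \<open>Splitting vertices\<close>

text \<open>Each new vector solves a homogeneous system with fewer than \<open>n\<close> equations:
  orthogonality to the \<open>z a\<close>, to the earlier vectors and to the all-ones
  vector.\<close>

lemma orthonormal_complement:
  fixes z :: "nat \<Rightarrow> nat \<Rightarrow> real"
  assumes "D + d < n"
  shows "\<exists>x. (\<forall>j<d. \<forall>k<d. (\<Sum>v<n. x j v * x k v) = (if j = k then 1 else 0)) \<and>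
     (\<forall>j<d. (\<Sum>v<n. x j v) = 0 \<and> (\<forall>a<D. (\<Sum>v<n. z a v * x j v) = 0))"
  using assms
proof (induction d)
  case 0
  show ?case by simp
next
  case (Suc d)
  then have "\<exists>x. (\<forall>j<d. \<forall>k<d. (\<Sum>v<n. x j v * x k v) = (if j = k then 1 else 0)) \<and>
     (\<forall>j<d. (\<Sum>v<n. x j v) = 0 \<and> (\<forall>a<D. (\<Sum>v<n. z a v * x j v) = 0))" by simp
  then obtain x :: "nat \<Rightarrow> nat \<Rightarrow> real" where
    x1: "\<forall>j<d. \<forall>k<d. (\<Sum>v<n. x j v * x k v) = (if j = k then 1 else 0)" and
    x2: "\<forall>j<d. (\<Sum>v<n. x j v) = 0 \<and> (\<forall>a<D. (\<Sum>v<n. z a v * x j v) = 0)"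
    by (elim exE conjE) (rule that)
  have x: "\<And>j k. j < d \<Longrightarrow> k < d \<Longrightarrow> (\<Sum>v<n. x j v * x k v) = (if j = k then 1 else 0)"
      "\<And>j. j < d \<Longrightarrow> (\<Sum>v<n. x j v) = 0"
      "\<And>j a. j < d \<Longrightarrow> a < D \<Longrightarrow> (\<Sum>v<n. z a v * x j v) = 0"
    using x1 x2 by simp_all
  define A where "A = (\<lambda>i v. if i < D then z i v else if i < D + d then x (i - D) v else 1)"
  have "card {..<D + d + 1} < card {..<n}" using Suc.prems by simp
  from homogeneous_system_nontrivial[OF _ _ this, of A] obtain y where
    y: "\<exists>v\<in>{..<n}. y v \<noteq> 0" and A: "\<forall>i\<in>{..<D+d+1}. (\<Sum>v<n. A i v * y v) = 0" by auto
  have yz: "(\<Sum>v<n. z a v * y v) = 0" if "a < D" for a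
    using A[THEN bspec, of a] that by (simp add: A_def)
  have yx: "(\<Sum>v<n. x j v * y v) = 0" if "j < d" for j
    using A[THEN bspec, of "D + j"] that by (simp add: A_def)
  have y1: "(\<Sum>v<n. y v) = 0"
    using A[THEN bspec, of "D + d"] by (simp add: A_def)
  define r where "r = sqrt (\<Sum>v<n. (y v)^2)"
  have "(\<Sum>v<n. (y v)^2) \<noteq> 0" using y by (auto simp: sum_nonneg_eq_0_iff)
  moreover have "(\<Sum>v<n. (y v)^2) \<ge> 0" by (simp add: sum_nonneg)
  ultimately have r: "r \<noteq> 0" "r^2 = (\<Sum>v<n. (y v)^2)" by (auto simp: r_def)
  define x' where "x' = x(d := \<lambda>v. y v / r)"
  have "(\<Sum>v<n. x' d v * x' d v) = 1"
  proof -
    have "(\<Sum>v<n. x' d v * x' d v) = (\<Sum>v<n. (y v)^2) / r^2"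
      by (simp add: x'_def power2_eq_square sum_divide_distrib)
    then show ?thesis using r(1) by (simp add: r(2)[symmetric])
  qed
  moreover have "(\<Sum>v<n. x' j v * x' d v) = 0" "(\<Sum>v<n. x' d v * x' j v) = 0" if "j < d" for j
  proof -
    have "(\<Sum>v<n. x' j v * x' d v) = (\<Sum>v<n. x j v * y v) / r"
      using that by (simp add: x'_def sum_divide_distrib)
    then show "(\<Sum>v<n. x' j v * x' d v) = 0" using yx[OF that] by simp
    then show "(\<Sum>v<n. x' d v * x' j v) = 0" by (simp add: mult.commute)
  qed
  moreover have "(\<Sum>v<n. x' j v * x' k v) = (if j = k then 1 else 0)" if "j < d" "k < d" for j k
    using that x(1)[OF that] by (simp add: x'_def)
  moreover have "(\<Sum>v<n. x' j v) = 0" if "j \<le> d" for j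
  proof (cases "j = d")
    case True
    then show ?thesis using y1 by (simp add: x'_def flip: sum_divide_distrib)
  next
    case False
    then show ?thesis using x(2)[of j] that by (simp add: x'_def)
  qed
  moreover have "(\<Sum>v<n. z a v * x' j v) = 0" if "j \<le> d" "a < D" for a j
  proof (cases "j = d")
    case True
    then show ?thesis using yz[OF that(2)] by (simp add: x'_def flip: sum_divide_distrib)
  next
    case False
    then show ?thesis using x(3)[of j a] that by (simp add: x'_def)
  qed
  ultimately show ?case
    by (intro exI[of _ x']) (auto simp: less_Suc_eq less_Suc_eq_le)
qed

text \<open>Cell \<open>j < k\<close> is the pair \<open>{2j, 2j+1}\<close>, cell \<open>j \<ge> k\<close> the single vertex \<open>j + k\<close>.\<close>

definition cell :: "nat \<Rightarrow> nat \<Rightarrow> nat" where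
  "cell k v = (if v < 2 * k then v div 2 else v - k)"

text \<open>A pair is represented by its odd vertex because \<open>split_matrix\<close> places
  \<open>Y\<close> there and zero on the even one.\<close>

definition cell_rep :: "nat \<Rightarrow> nat \<Rightarrow> nat" where
  "cell_rep k j = (if j < k then 2 * j + 1 else j + k)"

definition members :: "nat \<Rightarrow> nat \<Rightarrow> nat set" where
  "members k j = (if j < k then {2 * j, 2 * j + 1} else {j + k})"

definition cell_graph :: "nat \<Rightarrow> nat set set \<Rightarrow> nat set set" where
  "cell_graph k E = {e. \<exists>j l. e = {j, l} \<and> (\<exists>u\<in>members k j. \<exists>v\<in>members k l. {u, v} \<in> E)}"

text \<open>A pair \<open>j\<close> other than \<open>i\<close> drops out as soon as one of its
  vertices is adjacent to both vertices of \<open>i\<close>; the zero obtained there passes to the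
  other vertex of \<open>j\<close> by pairing with the unit vector of \<open>j\<close>. The cell
  \<open>i\<close> always counts, since its two vertices may form a non-edge.\<close>

definition missed_cells :: "nat \<Rightarrow> nat \<Rightarrow> nat set set \<Rightarrow> nat \<Rightarrow> nat set" where
  "missed_cells n k E i = {j. j < n - k \<and> (j = i \<or> (\<forall>v\<in>members k j. \<exists>u\<in>members k i. {u, v} \<notin> E))}"

text \<open>The index \<open>a\<close> runs over coordinates and \<open>v\<close> over vertices. The
  two vectors of a pair add up to the vector of its cell, so on forms that are constant on blocks of
  cells the test reduces to the contracted graph.\<close>

definition split_matrix :: "nat \<Rightarrow> (nat \<Rightarrow> nat \<Rightarrow> real) \<Rightarrow> nat \<Rightarrow> nat \<Rightarrow> real" where
  "split_matrix k Y a v =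
     (if a < k then (if v = 2 * a then 1 else if v = 2 * a + 1 then -1 else 0)
      else if even v \<and> v < 2 * k then 0 else Y (cell k v) (a - k))"

lemma cell_rep_members [simp]: "cell_rep k j \<in> members k j"
  by (simp add: cell_rep_def members_def)

lemma cell_cell_rep [simp]: "cell k (cell_rep k j) = j"
  by (auto simp: cell_def cell_rep_def)

lemma cell_rep_bound: "2 * k \<le> n \<Longrightarrow> j < n - k \<Longrightarrow> cell_rep k j < n"
  by (auto simp: cell_rep_def)

lemma members_bound: "2 * k \<le> n \<Longrightarrow> j < n - k \<Longrightarrow> v \<in> members k j \<Longrightarrow> v < n"
  by (auto simp: members_def split: if_splits)

lemma cell_bound: "2 * k \<le> n \<Longrightarrow> v < n \<Longrightarrow> cell k v < n - k"
  by (auto simp: cell_def)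

lemma members_cell: "v \<in> members k (cell k v)"
  by (auto simp: cell_def members_def)

lemma cell_eq_rep: "\<not> (even v \<and> v < 2 * k) \<Longrightarrow> cell_rep k (cell k v) = v"
  by (auto simp: cell_def cell_rep_def)

lemma members_iff: "v \<in> members k j \<longleftrightarrow> v = cell_rep k j \<or> (j < k \<and> v = 2 * j)"
  by (auto simp: members_def cell_rep_def)

lemma sum_split_matrix_low:
  assumes "2 * k \<le> n" "i < k"
  shows "(\<Sum>v<n. f v * split_matrix k Y i v) = f (2 * i) - f (2 * i + 1)"
proof -
  have "(\<Sum>v<n. f v * split_matrix k Y i v) =
      (\<Sum>v<n. (if v = 2 * i then f v else 0) + (if v = 2 * i + 1 then - f v else 0))"
    using assms(2) by (intro sum.cong refl) (auto simp: split_matrix_def)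
  then show ?thesis using assms by (simp add: sum.distrib)
qed

lemma sum_split_matrix_high:
  assumes "2 * k \<le> n"
  shows "(\<Sum>v<n. f v * split_matrix k Y (k + a) v) = (\<Sum>j<n - k. f (cell_rep k j) * Y j a)"
proof -
  have inj: "inj_on (cell_rep k) {..<n - k}" by (rule inj_on_inverseI[of _ "cell k"]) simp
  have "(\<Sum>v<n. f v * split_matrix k Y (k + a) v) =
     (\<Sum>v\<in>cell_rep k ` {..<n - k}. f v * split_matrix k Y (k + a) v)"
  proof (rule sum.mono_neutral_right)
    show "cell_rep k ` {..<n - k} \<subseteq> {..<n}" using cell_rep_bound[OF assms] by auto
    show "\<forall>v\<in>{..<n} - cell_rep k ` {..<n - k}. f v * split_matrix k Y (k + a) v = 0"
    proof
      fix v assume v: "v \<in> {..<n} - cell_rep k ` {..<n - k}"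
      have "even v \<and> v < 2 * k"
      proof (rule ccontr)
        assume "\<not> (even v \<and> v < 2 * k)"
        then have "v = cell_rep k (cell k v)" by (simp add: cell_eq_rep)
        moreover have "cell k v \<in> {..<n - k}" using v cell_bound[OF assms] by simp
        ultimately have "v \<in> cell_rep k ` {..<n - k}" by (rule image_eqI)
        with v show False by simp
      qed
      then show "f v * split_matrix k Y (k + a) v = 0" by (simp add: split_matrix_def)
    qed
  qed simp
  also have "\<dots> = (\<Sum>j<n - k. f (cell_rep k j) * split_matrix k Y (k + a) (cell_rep k j))"
    unfolding sum.reindex[OF inj] comp_def ..
  also have "\<dots> = (\<Sum>j<n - k. f (cell_rep k j) * Y j a)"
    by (intro sum.cong refl) (auto simp: split_matrix_def cell_rep_def cell_def)
  finally show ?thesis .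
qed

text \<open>This is vertex splitting read on the non-edges: pairing with the \<open>i\<close>-th unit vector shows that the
  rows \<open>2 i\<close> and \<open>2 i + 1\<close> of \<open>om\<close> differ by a dependency among the vectors of the cells missed by \<open>i\<close>.\<close>

lemma split_matrix_injective:
  fixes Y :: "nat \<Rightarrow> nat \<Rightarrow> real"
  assumes k: "2 * k \<le> n"
    and indep: "\<And>i c. i < k \<Longrightarrow> (\<And>j. c j \<noteq> 0 \<Longrightarrow> j \<in> missed_cells n k E i) \<Longrightarrow>
         (\<And>a. a < p \<Longrightarrow> (\<Sum>j<n - k. c j * Y j a) = 0) \<Longrightarrow> \<forall>j. c j = 0"
    and quot: "\<And>om. nonedge_form (n - k) (cell_graph k E) om \<Longrightarrow>
         (\<And>a b. a < p \<Longrightarrow> b < p \<Longrightarrow> form_val (n - k) om (\<lambda>j. Y j a) (\<lambda>j. Y j b) = 0) \<Longrightarrow> \<forall>j l. om j l = 0"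
    and om: "nonedge_form n E om"
    and iso: "\<And>a b. a < k + p \<Longrightarrow> b < k + p \<Longrightarrow>
         form_val n om (split_matrix k Y a) (split_matrix k Y b) = 0"
  shows "\<forall>u v. om u v = 0"
proof -
  have sym: "om u v = om v u" for u v using om by (simp add: nonedge_form_def)
  have supp: "om u v = 0" if "\<not> (u < n \<and> v < n \<and> u \<noteq> v \<and> {u, v} \<notin> E)" for u v
    using om that unfolding nonedge_form_def by blast
  define dl where "dl = (\<lambda>i v. om (2 * i) v - om (2 * i + 1) v)"
  have fv1: "form_val n om x y = (\<Sum>v<n. (\<Sum>u<n. om u v * x u) * y v)" for x y
    unfolding form_val_def sum_distrib_right by (subst sum.swap) (simp add: mult_ac)
  have fv: "form_val n om (split_matrix k Y i) y = (\<Sum>v<n. dl i v * y v)" if "i < k" for i y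
    unfolding fv1 sum_split_matrix_low[OF k that] dl_def ..
  have dl2: "dl i (2 * l) = dl i (2 * l + 1)" if "i < k" "l < k" for i l
    using iso[of i l] that unfolding fv[OF that(1)] sum_split_matrix_low[OF k that(2)] by simp
  have dlrep: "dl i (cell_rep k j) = 0" if i: "i < k" and j: "j < n - k" for i j
  proof -
    define c where "c = (\<lambda>j. if j < n - k then dl i (cell_rep k j) else 0)"
    have "\<forall>j. c j = 0"
    proof (rule indep[OF i])
      fix a assume "a < p"
      then have "0 = form_val n om (split_matrix k Y i) (split_matrix k Y (k + a))"
        using iso[of i "k + a"] i by simp
      also have "\<dots> = (\<Sum>j<n - k. c j * Y j a)"
        unfolding fv[OF i] sum_split_matrix_high[OF k] by (simp add: c_def)
      finally show "(\<Sum>j<n - k. c j * Y j a) = 0" by simp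
    next
      fix j assume "c j \<noteq> 0"
      then have j: "j < n - k" "dl i (cell_rep k j) \<noteq> 0" by (auto simp: c_def split: if_splits)
      show "j \<in> missed_cells n k E i"
      proof (rule ccontr)
        assume "j \<notin> missed_cells n k E i"
        then obtain v where v: "v \<in> members k j" "\<forall>u\<in>members k i. {u, v} \<in> E"
          using j(1) by (auto simp: missed_cells_def)
        then have "{2 * i, v} \<in> E" "{2 * i + 1, v} \<in> E" using i by (auto simp: members_def)
        then have "dl i v = 0" by (simp add: dl_def supp)
        with j(2) v(1) have "j < k" "v = 2 * j" by (auto simp: members_iff)
        with dl2[OF i \<open>j < k\<close>] \<open>dl i v = 0\<close> j(2) show False by (simp add: cell_rep_def)
      qed
    qed
    with j show ?thesis by (auto simp: c_def dest: spec[of _ j])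
  qed
  have dl0: "dl i v = 0" if i: "i < k" and v: "v < n" for i v
  proof (cases "even v \<and> v < 2 * k")
    case True
    then obtain l where l: "v = 2 * l" "l < k" by auto
    then show ?thesis using dl2[OF i l(2)] dlrep[OF i, of l] k by (simp add: cell_rep_def)
  next
    case False
    then show ?thesis using dlrep[OF i cell_bound[OF k v]] cell_eq_rep[of v k] by simp
  qed
  have row: "om u v = om (cell_rep k j) v" if "u \<in> members k j" "v < n" for u v j
    using that dl0[of j v] by (auto simp: members_iff dl_def cell_rep_def)
  \<comment> \<open>Equal rows together with symmetry make \<open>om\<close> constant on each block
    between two cells, so it descends to a form \<open>q\<close> on the cells. One edge inside a
    block makes the whole block zero, which is why adjacency in \<open>cell_graph\<close> asks for a
    single edge.\<close>
  have block: "om u v = om (cell_rep k j) (cell_rep k l)"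
    if "u \<in> members k j" "v \<in> members k l" "j < n - k" "l < n - k" for u v j l
  proof -
    have "om u v = om (cell_rep k j) v" using row that members_bound[OF k] by simp
    also have "\<dots> = om v (cell_rep k j)" by (rule sym)
    also have "\<dots> = om (cell_rep k l) (cell_rep k j)" using row that cell_rep_bound[OF k] by simp
    finally show ?thesis by (simp add: sym)
  qed
  define q where "q = (\<lambda>j l. if j < n - k \<and> l < n - k then om (cell_rep k j) (cell_rep k l) else 0)"
  have "\<forall>j l. q j l = 0"
  proof (rule quot)
    show "nonedge_form (n - k) (cell_graph k E) q"
      unfolding nonedge_form_def
    proof (intro conjI allI impI)
      fix j l assume nz: "q j l \<noteq> 0"
      then show jl: "j < n - k" "l < n - k" by (auto simp: q_def split: if_splits)
      from nz jl have nz': "om (cell_rep k j) (cell_rep k l) \<noteq> 0" by (simp add: q_def)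
      show "j \<noteq> l" using nz' supp[of "cell_rep k j" "cell_rep k j"] by auto
      have no: "{u, v} \<notin> E" if "u \<in> members k j" "v \<in> members k l" for u v
        using block[OF that jl] nz' supp[of u v] by auto
      show "{j, l} \<notin> cell_graph k E"
      proof
        assume "{j, l} \<in> cell_graph k E"
        then obtain j' l' u v where "{j, l} = {j', l'}" "u \<in> members k j'" "v \<in> members k l'" "{u, v} \<in> E"
          by (auto simp: cell_graph_def)
        then show False using no[of u v] no[of v u] by (auto simp: doubleton_eq_iff insert_commute)
      qed
    qed (simp add: q_def sym)
  next
    fix a b assume ab: "a < p" "b < p"
    have "form_val n om (split_matrix k Y (k + a)) (split_matrix k Y (k + b)) =
       (\<Sum>l<n - k. (\<Sum>j<n - k. om (cell_rep k j) (cell_rep k l) * Y j a) * Y l b)"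
      unfolding fv1 sum_split_matrix_high[OF k] ..
    also have "\<dots> = form_val (n - k) q (\<lambda>j. Y j a) (\<lambda>j. Y j b)"
      unfolding form_val_def sum_distrib_right
      by (subst sum.swap) (auto intro!: sum.cong simp: q_def mult_ac)
    finally show "form_val (n - k) q (\<lambda>j. Y j a) (\<lambda>j. Y j b) = 0"
      using iso[of "k + a" "k + b"] ab by simp
  qed
  show ?thesis
  proof (intro allI)
    fix u v
    show "om u v = 0"
    proof (cases "u < n \<and> v < n")
      case True
      then have "om u v = q (cell k u) (cell k v)"
        using block[OF members_cell members_cell cell_bound[OF k] cell_bound[OF k], of u v]
        by (simp add: q_def cell_bound[OF k])
      then show ?thesis using \<open>\<forall>j l. q j l = 0\<close> by simp
    qed (use supp in blast)
  qed
qed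

text \<open>The weights \<open>s\<close> produce the zero sums: they are constant on a pair, so the
  unit vectors still cancel, and for the coordinates of \<open>Y\<close> the sum is
  \<open>sY\<close>. Moving them from the test vectors into the form leaves its support unchanged,
  since they do not vanish on cells. An orthonormal complement of the resulting vectors is a
  framework near which a generic one is then chosen.\<close>

lemma d_rigid_of_split_matrix:
  fixes Y :: "nat \<Rightarrow> nat \<Rightarrow> real"
  assumes k: "2 * k \<le> n" and d: "k + p + d < n"
    and indep: "\<And>i c. i < k \<Longrightarrow> (\<And>j. c j \<noteq> 0 \<Longrightarrow> j \<in> missed_cells n k E i) \<Longrightarrow>
         (\<And>a. a < p \<Longrightarrow> (\<Sum>j<n - k. c j * Y j a) = 0) \<Longrightarrow> \<forall>j. c j = 0"
    and quot: "\<And>om. nonedge_form (n - k) (cell_graph k E) om \<Longrightarrow>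
         (\<And>a b. a < p \<Longrightarrow> b < p \<Longrightarrow> form_val (n - k) om (\<lambda>j. Y j a) (\<lambda>j. Y j b) = 0) \<Longrightarrow> \<forall>j l. om j l = 0"
    and s0: "\<And>j. j < n - k \<Longrightarrow> s j \<noteq> 0"
    and sY: "\<And>a. a < p \<Longrightarrow> (\<Sum>j<n - k. s j * Y j a) = 0"
  shows "d_rigid d n E"
proof -
  define z where "z = (\<lambda>a v. s (cell k v) * split_matrix k Y a v)"
  have z0: "(\<Sum>v<n. z a v) = 0" if a: "a < k + p" for a
  proof (cases "a < k")
    case True
    then show ?thesis unfolding z_def sum_split_matrix_low[OF k True] by (simp add: cell_def)
  next
    case False
    define b where "b = a - k"
    have b: "a = k + b" "b < p" using a False by (auto simp: b_def)
    then show ?thesis unfolding z_def b(1) sum_split_matrix_high[OF k] using sY by simp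
  qed
  obtain x :: "nat \<Rightarrow> nat \<Rightarrow> real" where
    x: "\<forall>j<d. \<forall>l<d. (\<Sum>v<n. x j v * x l v) = (if j = l then 1 else 0)"
     "\<forall>j<d. (\<Sum>v<n. x j v) = 0 \<and> (\<forall>a<k + p. (\<Sum>v<n. z a v * x j v) = 0)"
    using orthonormal_complement[OF d, of z] by (elim exE conjE) (rule that)
  have inj: "\<forall>u v. om u v = 0" if om: "nonedge_form n E om"
    and iso: "\<And>a b. a < k + p \<Longrightarrow> b < k + p \<Longrightarrow> form_val n om (z a) (z b) = 0" for om
  proof -
    define om' where "om' = (\<lambda>u v. s (cell k u) * om u v * s (cell k v))"
    have "\<forall>u v. om' u v = 0"
    proof (rule split_matrix_injective[OF k indep quot])
      show "nonedge_form n E om'"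
        using om by (auto simp: nonedge_form_def om'_def)
      show "form_val n om' (split_matrix k Y a) (split_matrix k Y b) = 0" if "a < k + p" "b < k + p" for a b
        using iso[OF that] by (simp add: form_val_def om'_def z_def mult_ac)
    qed
    moreover have "om u v = 0" if "\<not> (u < n \<and> v < n)" for u v
      using om that by (auto simp: nonedge_form_def)
    moreover have "om u v = 0" if "om' u v = 0" "u < n" "v < n" for u v
      using that s0[OF cell_bound[OF k]] by (simp add: om'_def)
    ultimately show ?thesis by metis
  qed
  have "\<exists>e>0. \<forall>q. (\<forall>v<n. \<forall>l<d. \<bar>q v l - x l v\<bar> < e) \<longrightarrow> rigidity_certificate d n E q"
  proof (rule certificate_near[where z = z and D = "k + p"])
    show "\<forall>u v. om u v = 0" if "nonedge_form n E om"
      "\<And>a b. a < k + p \<Longrightarrow> b < k + p \<Longrightarrow> form_val n om (z a) (z b) = 0" for om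
      by (rule inj[OF that])
    show "(\<Sum>v<n. x j v * x l v) = (if j = l then 1 else 0)" if "j < d" "l < d" for j l
      using x(1) that by simp
    show "(\<Sum>v<n. x j v) = 0" if "j < d" for j using x(2) that by simp
    show "(\<Sum>v<n. z a v) = 0" if "a < k + p" for a by (rule z0[OF that])
    show "(\<Sum>v<n. z a v * x l v) = 0" if "a < k + p" "l < d" for a l using x(2) that by simp
  qed
  then obtain e where e: "e > 0" and
    cert: "\<forall>q. (\<forall>v<n. \<forall>l<d. \<bar>q v l - x l v\<bar> < e) \<longrightarrow> rigidity_certificate d n E q"
    by (elim exE conjE) (rule that)
  obtain q where q: "generic_framework d n q" "\<forall>v<n. \<forall>l<d. \<bar>q v l - x l v\<bar> < e"
    using generic_framework_near[OF e, of d n "\<lambda>v l. x l v"] by (elim exE conjE) (rule that)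
  then show ?thesis unfolding d_rigid_def
    using certificate_imp_rigid[OF cert[THEN spec, THEN mp, OF q(2)]] q(1) by (intro exI conjI)
qed

section \<open>Counting over the field with two elements\<close>

text \<open>Equal positions are not tested: the forms arising from \<open>bit_forms\<close> are
  alternating, so \<open>\<beta> x x = 0\<close> holds for them anyway.\<close>

fun iso_list :: "('v \<Rightarrow> 'v \<Rightarrow> bit) \<Rightarrow> 'v list \<Rightarrow> bool" where
  "iso_list \<beta> [] = True"
| "iso_list \<beta> (x # xs) = ((\<forall>y\<in>set xs. \<beta> x y = 0) \<and> iso_list \<beta> xs)"

text \<open>A finite vector space over the field with two elements, without a scalar action. It is a
  set rather than a type because the induction in \<open>card_iso_lists\<close> passes to
  hyperplanes.\<close>

definition elementary2 :: "'v::ab_group_add set \<Rightarrow> bool" where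
  "elementary2 W \<longleftrightarrow> finite W \<and> 0 \<in> W \<and> (\<forall>x\<in>W. \<forall>y\<in>W. x + y \<in> W) \<and> (\<forall>x\<in>W. x + x = 0)"

definition additive_on :: "'v::ab_group_add set \<Rightarrow> ('v \<Rightarrow> bit) \<Rightarrow> bool" where
  "additive_on W f \<longleftrightarrow> (\<forall>x\<in>W. \<forall>y\<in>W. f (x + y) = f x + f y)"

definition radical :: "('v \<Rightarrow> 'v \<Rightarrow> bit) \<Rightarrow> 'v set \<Rightarrow> 'v set" where
  "radical \<beta> W = {x \<in> W. \<forall>y\<in>W. \<beta> x y = 0}"

lemma elementary2_cancel:
  assumes "elementary2 W" "x \<in> W" "y \<in> W"
  shows "x + y + y = x"
proof -
  have "y + y = 0" using assms by (simp add: elementary2_def)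
  then show ?thesis by (simp add: add.assoc)
qed

lemma elementary2_kernel:
  assumes "elementary2 W" "additive_on W f"
  shows "elementary2 {x \<in> W. f x = 0}"
proof -
  have "f (0 + 0) = f 0 + f 0" using assms unfolding elementary2_def additive_on_def by blast
  then have "f 0 = 0" by simp
  then show ?thesis using assms by (auto simp: elementary2_def additive_on_def)
qed

lemma card_kernel:
  assumes W: "elementary2 W" and f: "additive_on W f" and w: "w \<in> W" "f w = 1"
  shows "2 * card {x \<in> W. f x = 0} = card W"
proof -
  have fin: "finite W" and cl: "\<And>x y. x \<in> W \<Longrightarrow> y \<in> W \<Longrightarrow> x + y \<in> W" using W by (auto simp: elementary2_def)
  have add: "f (x + y) = f x + f y" if "x \<in> W" "y \<in> W" for x y using f that by (simp add: additive_on_def)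
  have "bij_betw (\<lambda>x. x + w) {x \<in> W. f x = 0} {x \<in> W. f x = 1}"
    by (rule bij_betw_byWitness[where f' = "\<lambda>x. x + w"])
      (use w cl add elementary2_cancel[OF W] in auto)
  then have "card {x \<in> W. f x = 0} = card {x \<in> W. f x = 1}" by (rule bij_betw_same_card)
  moreover have "W = {x \<in> W. f x = 0} \<union> {x \<in> W. f x = 1}" by auto
  then have "card W = card {x \<in> W. f x = 0} + card {x \<in> W. f x = 1}"
    using fin by (metis (mono_tags, lifting) card_Un_disjoint disjoint_iff finite_Un mem_Collect_eq zero_neq_one)
  ultimately show ?thesis by simp
qed

text \<open>If \<open>\<beta> x\<close> vanishes on the hyperplane orthogonal to \<open>c\<close>
  but not on all of \<open>W\<close>, then \<open>\<beta> x\<close> and \<open>\<beta> c\<close> are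
  nonzero functionals with the same kernel. Over the field with two elements they are equal, so
  \<open>x + c\<close> lies in the radical of \<open>W\<close>. Hence the old radical and its
  translate by \<open>c\<close> cover the new one.\<close>

lemma card_radical_hyperplane:
  assumes W: "elementary2 W" and sym: "\<And>x y. x \<in> W \<Longrightarrow> y \<in> W \<Longrightarrow> \<beta> x y = \<beta> y x"
    and add: "\<And>x. x \<in> W \<Longrightarrow> additive_on W (\<beta> x)" and c: "c \<in> W"
  shows "card (radical \<beta> {y \<in> W. \<beta> c y = 0}) \<le> 2 * card (radical \<beta> W)"
proof -
  have fin: "finite W" and cl: "\<And>x y. x \<in> W \<Longrightarrow> y \<in> W \<Longrightarrow> x + y \<in> W" using W by (auto simp: elementary2_def)
  have addr: "\<beta> x (y + z) = \<beta> x y + \<beta> x z" if "x \<in> W" "y \<in> W" "z \<in> W" for x y z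
    using add that by (simp add: additive_on_def)
  have addl: "\<beta> (y + z) x = \<beta> y x + \<beta> z x" if "x \<in> W" "y \<in> W" "z \<in> W" for x y z
    using addr[OF that] sym cl that by metis
  have "radical \<beta> {y \<in> W. \<beta> c y = 0} \<subseteq> radical \<beta> W \<union> (\<lambda>x. x + c) ` radical \<beta> W"
  proof
    fix x assume "x \<in> radical \<beta> {y \<in> W. \<beta> c y = 0}"
    then have x: "x \<in> W" "\<And>y. y \<in> W \<Longrightarrow> \<beta> c y = 0 \<Longrightarrow> \<beta> x y = 0" by (auto simp: radical_def)
    show "x \<in> radical \<beta> W \<union> (\<lambda>x. x + c) ` radical \<beta> W"
    proof (cases "x \<in> radical \<beta> W")
      case False
      then obtain w where w: "w \<in> W" "\<beta> x w = 1" using x(1) by (auto simp: radical_def)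
      then have cw: "\<beta> c w = 1" using x(2)[OF w(1)] by (cases "\<beta> c w = 0") auto
      have "x + c \<in> radical \<beta> W"
        unfolding radical_def
      proof (intro CollectI conjI ballI cl x c)
        fix y assume y: "y \<in> W"
        show "\<beta> (x + c) y = 0"
        proof (cases "\<beta> c y = 0")
          case True
          then show ?thesis using x(2)[OF y] addl[OF y x(1) c] by simp
        next
          case False
          then have "\<beta> c (y + w) = 0" using addr[OF c y w(1)] cw by simp
          then have "\<beta> x (y + w) = 0" using x(2) cl y w(1) by blast
          then have "\<beta> x y = 1" using addr[OF x(1) y w(1)] w(2) by (cases "\<beta> x y = 0") auto
          then show ?thesis using False addl[OF y x(1) c] by simp
        qed
      qed
      moreover have "x = (x + c) + c" using elementary2_cancel[OF W x(1) c] by simp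
      ultimately show ?thesis by blast
    qed simp
  qed
  moreover have finr: "finite (radical \<beta> W)" using fin by (simp add: radical_def)
  ultimately have "card (radical \<beta> {y \<in> W. \<beta> c y = 0}) \<le> card (radical \<beta> W \<union> (\<lambda>x. x + c) ` radical \<beta> W)"
    by (intro card_mono) auto
  also have "\<dots> \<le> card (radical \<beta> W) + card ((\<lambda>x. x + c) ` radical \<beta> W)" by (rule card_Un_le)
  also have "\<dots> \<le> 2 * card (radical \<beta> W)" using card_image_le[OF finr, of "\<lambda>x. x + c"] by simp
  finally show ?thesis .
qed

definition iso_lists :: "('v \<Rightarrow> 'v \<Rightarrow> bit) \<Rightarrow> 'v set \<Rightarrow> nat \<Rightarrow> 'v list set" where
  "iso_lists \<beta> W p = {xs. set xs \<subseteq> W \<and> length xs = p \<and> iso_list \<beta> xs}"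

lemma card_iso_lists_le:
  assumes "finite W"
  shows "finite (iso_lists \<beta> W p)" "card (iso_lists \<beta> W p) \<le> card W ^ p"
proof -
  have sub: "iso_lists \<beta> W p \<subseteq> {xs. set xs \<subseteq> W \<and> length xs = p}" by (auto simp: iso_lists_def)
  then show "finite (iso_lists \<beta> W p)" by (rule finite_subset) (rule finite_lists_length_eq[OF assms])
  show "card (iso_lists \<beta> W p) \<le> card W ^ p"
    using card_mono[OF finite_lists_length_eq[OF assms] sub] card_lists_length_eq[OF assms] by simp
qed

lemma card_iso_lists_Suc:
  assumes "finite W"
  shows "card (iso_lists \<beta> W (Suc p)) = (\<Sum>x\<in>W. card (iso_lists \<beta> {y \<in> W. \<beta> x y = 0} p))"
proof -
  have "iso_lists \<beta> W (Suc p) = (\<lambda>(x, xs). x # xs) ` (SIGMA x:W. iso_lists \<beta> {y \<in> W. \<beta> x y = 0} p)"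
  proof (intro set_eqI iffI)
    fix xs assume "xs \<in> iso_lists \<beta> W (Suc p)"
    then obtain y ys where "xs = y # ys" "y \<in> W" "ys \<in> iso_lists \<beta> {z \<in> W. \<beta> y z = 0} p"
      by (cases xs) (auto simp: iso_lists_def)
    then show "xs \<in> (\<lambda>(x, xs). x # xs) ` (SIGMA x:W. iso_lists \<beta> {y \<in> W. \<beta> x y = 0} p)" by auto
  next
    fix xs assume "xs \<in> (\<lambda>(x, xs). x # xs) ` (SIGMA x:W. iso_lists \<beta> {y \<in> W. \<beta> x y = 0} p)"
    then show "xs \<in> iso_lists \<beta> W (Suc p)" by (auto simp: iso_lists_def)
  qed
  moreover have "inj_on (\<lambda>(x, xs). x # xs) (SIGMA x:W. iso_lists \<beta> {y \<in> W. \<beta> x y = 0} p)"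
    by (auto simp: inj_on_def)
  ultimately have "card (iso_lists \<beta> W (Suc p)) = card (SIGMA x:W. iso_lists \<beta> {y \<in> W. \<beta> x y = 0} p)"
    by (simp add: card_image)
  also have "\<dots> = (\<Sum>x\<in>W. card (iso_lists \<beta> {y \<in> W. \<beta> x y = 0} p))"
    using assms by (intro card_SigmaI) (auto intro!: card_iso_lists_le)
  finally show ?thesis .
qed

definition triangular :: "nat \<Rightarrow> nat" where "triangular h = (\<Sum>i\<le>h. i)"

lemma triangular_simps [simp]: "triangular 0 = 0" "triangular (Suc h) = triangular h + Suc h"
  by (simp_all add: triangular_def)

text \<open>The first vector \<open>x\<close> of an isotropic list either lies in the radical, which is rare, or forces all the
  others into a hyperplane, on which the rank drops by two.\<close>

lemma card_iso_lists:
  assumes "elementary2 W" "\<And>x y. x \<in> W \<Longrightarrow> y \<in> W \<Longrightarrow> \<beta> x y = \<beta> y x"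
    "\<And>x. x \<in> W \<Longrightarrow> additive_on W (\<beta> x)" "card (radical \<beta> W) * 2 ^ (2 * h) \<le> 2 * card W"
  shows "card (iso_lists \<beta> W p) * 2 ^ (h * p) \<le> card W ^ p * (p + 1) ^ h * 2 ^ triangular h"
  using assms
proof (induction p arbitrary: W h)
  case 0
  have "iso_lists \<beta> W 0 = {[]}" by (auto simp: iso_lists_def)
  then show ?case by simp
next
  case (Suc p)
  note W = Suc.prems(1) and sym = Suc.prems(2) and add = Suc.prems(3) and rad = Suc.prems(4)
  have fin: "finite W" using W by (simp add: elementary2_def)
  show ?case
  proof (cases h)
    case 0
    then show ?thesis using card_iso_lists_le(2)[OF fin, of \<beta> "Suc p"] by simp
  next
    case (Suc g)
    define w where "w = card W"
    define R where "R = radical \<beta> W"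
    have R: "R \<subseteq> W" "finite R" using fin by (auto simp: R_def radical_def)
    define A where "A = (p + 1) ^ g * 2 ^ triangular h * w ^ p"
    have in_rad: "card (iso_lists \<beta> {y \<in> W. \<beta> x y = 0} p) * 2 ^ (h * p) \<le> (p + 1) * A" if "x \<in> R" for x
    proof -
      have "{y \<in> W. \<beta> x y = 0} = W" using that by (auto simp: R_def radical_def)
      then have "card (iso_lists \<beta> {y \<in> W. \<beta> x y = 0} p) * 2 ^ (h * p) \<le> w ^ p * (p + 1) ^ h * 2 ^ triangular h"
        using Suc.IH[OF W sym add rad] by (simp add: w_def)
      also have "\<dots> = (p + 1) * A" by (simp add: A_def Suc algebra_simps)
      finally show ?thesis .
    qed
    have out_rad: "card (iso_lists \<beta> {y \<in> W. \<beta> x y = 0} p) * 2 ^ (h * Suc p) \<le> A" if x: "x \<in> W - R" for x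
    proof -
      define V where "V = {y \<in> W. \<beta> x y = 0}"
      have VW: "V \<subseteq> W" by (auto simp: V_def)
      obtain v where "v \<in> W" "\<beta> x v = 1" using x by (auto simp: R_def radical_def)
      then have half: "2 * card V = w"
        unfolding V_def w_def using card_kernel[OF W add] x by blast
      \<comment> \<open>Halving the space while at most doubling the radical costs a factor 4 in the
        hypothesis on \<open>h\<close>, which is exactly one step from \<open>h\<close> to
        \<open>g\<close>.\<close>
      have "card (radical \<beta> V) \<le> 2 * card R"
        unfolding V_def R_def using card_radical_hyperplane[OF W sym add] x by blast
      then have "card (radical \<beta> V) * 2 ^ (2 * g) * 4 \<le> 2 * (card R * 2 ^ (2 * h))"
        by (simp add: Suc)
      also have "\<dots> \<le> 2 * (2 * w)" using rad by (simp add: R_def w_def)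
      finally have radV: "card (radical \<beta> V) * 2 ^ (2 * g) \<le> 2 * card V" using half by simp
      have "card (iso_lists \<beta> V p) * 2 ^ (g * p) \<le> card V ^ p * (p + 1) ^ g * 2 ^ triangular g"
      proof (rule Suc.IH[OF _ _ _ radV])
        show "elementary2 V" unfolding V_def using W add x by (intro elementary2_kernel) auto
      qed (use sym add VW in \<open>auto simp: additive_on_def subset_iff\<close>)
      then have "card (iso_lists \<beta> V p) * 2 ^ (g * p) * (2 ^ p * 2 ^ h)
          \<le> card V ^ p * (p + 1) ^ g * 2 ^ triangular g * (2 ^ p * 2 ^ h)" by (rule mult_le_mono1)
      also have "\<dots> = (2 * card V) ^ p * (p + 1) ^ g * 2 ^ triangular h"
        by (simp add: Suc power_add power_mult_distrib)
      also have "\<dots> = A" by (simp add: half A_def)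
      also have "card (iso_lists \<beta> V p) * 2 ^ (g * p) * (2 ^ p * 2 ^ h) = card (iso_lists \<beta> V p) * 2 ^ (h * Suc p)"
        by (simp add: Suc power_add algebra_simps)
      finally show ?thesis by (simp add: V_def)
    qed
    \<comment> \<open>A first vector in the radical imposes no condition on the others and loses a
      factor \<open>2 ^ h\<close>; the small size of the radical makes up for it. The factor 2 in
      the hypothesis is absorbed by \<open>2 \<le> 2 ^ h\<close>.\<close>
    have "card R * 2 ^ h * 2 ^ h \<le> w * 2 ^ h"
    proof -
      have "card R * 2 ^ h * 2 ^ h = card R * 2 ^ (2 * h)" by (simp add: mult_2 power_add)
      also have "\<dots> \<le> 2 * w" using rad by (simp add: R_def w_def)
      also have "\<dots> \<le> w * 2 ^ h" by (simp add: Suc)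
      finally show ?thesis .
    qed
    then have Rh: "card R * 2 ^ h \<le> w" by simp
    have "card (iso_lists \<beta> W (Suc p)) * 2 ^ (h * Suc p)
       = (\<Sum>x\<in>R. card (iso_lists \<beta> {y \<in> W. \<beta> x y = 0} p) * 2 ^ (h * p) * 2 ^ h)
       + (\<Sum>x\<in>W - R. card (iso_lists \<beta> {y \<in> W. \<beta> x y = 0} p) * 2 ^ (h * Suc p))"
      unfolding card_iso_lists_Suc[OF fin] sum.subset_diff[OF R(1) fin] distrib_right sum_distrib_right
      by (simp add: power_add mult_ac)
    also have "\<dots> \<le> (\<Sum>x\<in>R. (p + 1) * A * 2 ^ h) + (\<Sum>x\<in>W - R. A)"
      by (intro add_mono sum_mono mult_le_mono1 in_rad out_rad)
    \<comment> \<open>First vectors inside and outside the radical contribute \<open>p + 1\<close>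
      units and one unit of \<open>w * A\<close>; this is how the factor \<open>p + 1\<close> of the
      bound grows to \<open>p + 2\<close>.\<close>
    also have "\<dots> \<le> (p + 1) * A * w + w * A"
    proof (intro add_mono)
      show "(\<Sum>x\<in>R. (p + 1) * A * 2 ^ h) \<le> (p + 1) * A * w"
        using mult_le_mono2[OF Rh, of "(p + 1) * A"] by (simp add: mult_ac)
      show "(\<Sum>x\<in>W - R. A) \<le> w * A"
        using card_mono[OF fin, of "W - R"] by (simp add: w_def)
    qed
    also have "\<dots> = (p + 2) * ((p + 1) ^ g) * (2 ^ triangular h * w ^ Suc p)"
      by (simp add: A_def algebra_simps)
    also have "\<dots> \<le> (p + 2) * ((p + 2) ^ g) * (2 ^ triangular h * w ^ Suc p)"
      by (intro mult_le_mono1 mult_le_mono2 power_mono) auto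
    also have "\<dots> = card W ^ Suc p * (Suc p + 1) ^ h * 2 ^ triangular h"
      by (simp add: Suc w_def)
    finally show ?thesis .
  qed
qed

declare add_bit_eq_xor [simp del] mult_bit_eq_and [simp del]

lemma bit_add_self [simp]: "(a::bit) + a = 0"
  by (cases a) auto

lemma bit_add_eq_0: "(a::bit) + b = 0 \<longleftrightarrow> a = b"
  by (cases a; cases b) auto

lemma bit_neq_0: "(a::bit) \<noteq> 0 \<longleftrightarrow> a = 1"
  by (cases a) auto

section \<open>Bit matrices supported on non-edges and their rank\<close>

definition bvecs :: "nat \<Rightarrow> (nat \<Rightarrow> bit) set" where
  "bvecs N = {c. \<forall>j\<ge>N. c j = 0}"

definition dotp :: "nat \<Rightarrow> (nat \<Rightarrow> bit) \<Rightarrow> (nat \<Rightarrow> bit) \<Rightarrow> bit" where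
  "dotp N a c = (\<Sum>l<N. a l * c l)"

definition unit_vec :: "nat \<Rightarrow> nat \<Rightarrow> bit" where
  "unit_vec l = (\<lambda>j. if j = l then 1 else 0)"

definition bform :: "nat \<Rightarrow> (nat \<Rightarrow> nat \<Rightarrow> bit) \<Rightarrow> (nat \<Rightarrow> bit) \<Rightarrow> (nat \<Rightarrow> bit) \<Rightarrow> bit" where
  "bform N om x y = (\<Sum>j<N. x j * dotp N (om j) y)"

definition bit_forms :: "nat \<Rightarrow> nat set set \<Rightarrow> (nat \<Rightarrow> nat \<Rightarrow> bit) set" where
  "bit_forms N E = {om. (\<forall>j l. om j l = om l j) \<and>
     (\<forall>j l. om j l \<noteq> 0 \<longrightarrow> j < N \<and> l < N \<and> j \<noteq> l \<and> {j, l} \<notin> E)}"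

definition non_nbrs :: "nat \<Rightarrow> nat set set \<Rightarrow> nat \<Rightarrow> nat set" where
  "non_nbrs N E j = {l. l < N \<and> l \<noteq> j \<and> {j, l} \<notin> E}"

lemma finite_bvecs: "finite (bvecs N)" and card_bvecs: "card (bvecs N) = 2 ^ N"
proof -
  define f where "f = (\<lambda>S (j::nat). if j \<in> S then 1 else 0 :: bit)"
  have "bij_betw f (Pow {..<N}) (bvecs N)"
  proof (rule bij_betw_byWitness[where f' = "\<lambda>c. {j. c j = 1}"])
    show "\<forall>S\<in>Pow {..<N}. {j. f S j = 1} = S" by (auto simp: f_def)
    show "\<forall>c\<in>bvecs N. f {j. c j = 1} = c"
    proof (intro ballI ext)
      fix c :: "nat \<Rightarrow> bit" and j show "f {j. c j = 1} j = c j" by (cases "c j") (auto simp: f_def)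
    qed
    show "f ` Pow {..<N} \<subseteq> bvecs N" by (auto simp: f_def bvecs_def)
    show "(\<lambda>c. {j. c j = 1}) ` bvecs N \<subseteq> Pow {..<N}"
      by (auto simp: bvecs_def not_le[symmetric])
  qed
  then show "finite (bvecs N)" "card (bvecs N) = 2 ^ N"
    by (auto simp: bij_betw_finite[symmetric] bij_betw_same_card[symmetric] card_Pow)
qed

lemma elementary2_bvecs: "elementary2 (bvecs N)"
  unfolding elementary2_def by (auto simp: finite_bvecs) (auto simp: bvecs_def fun_eq_iff)

lemma dotp_add: "dotp N a (x + y) = dotp N a x + dotp N a y"
  by (simp add: dotp_def distrib_left sum.distrib)

lemma dotp_scale: "dotp N a (\<lambda>j. t * x j) = t * dotp N a x"
  by (simp add: dotp_def sum_distrib_left mult_ac)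

lemma dotp_sum: "dotp N a (\<lambda>j. \<Sum>r\<in>R. t r * x r j) = (\<Sum>r\<in>R. t r * dotp N a (x r))"
  unfolding dotp_def sum_distrib_left by (subst sum.swap) (simp add: mult_ac)

lemma dotp_unit: "l < N \<Longrightarrow> dotp N a (unit_vec l) = a l"
  by (simp add: dotp_def unit_vec_def if_distrib cong: if_cong)

lemma unit_vec_bvecs: "l < N \<Longrightarrow> unit_vec l \<in> bvecs N"
  by (auto simp: unit_vec_def bvecs_def)

lemma bform_add: "bform N om x (y + z) = bform N om x y + bform N om x z"
  by (simp add: bform_def dotp_add distrib_left sum.distrib)

lemma bform_sym:
  assumes "\<And>j l. om j l = om l j"
  shows "bform N om x y = bform N om y x"
  unfolding bform_def dotp_def sum_distrib_left
  by (subst sum.swap) (intro sum.cong refl, simp add: assms mult_ac)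

text \<open>A dual system certifies that the rows of \<open>om\<close> indexed by \<open>R\<close>
  are linearly independent, in a form that can be extended and counted with directly.\<close>

definition dual_rows :: "nat \<Rightarrow> (nat \<Rightarrow> nat \<Rightarrow> bit) \<Rightarrow> nat set \<Rightarrow> (nat \<Rightarrow> nat \<Rightarrow> bit) \<Rightarrow> bool" where
  "dual_rows N om R D \<longleftrightarrow> (\<forall>r\<in>R. D r \<in> bvecs N \<and> (\<forall>r'\<in>R. dotp N (om r') (D r) = (if r' = r then 1 else 0)))"

definition row_basis :: "nat \<Rightarrow> (nat \<Rightarrow> nat \<Rightarrow> bit) \<Rightarrow> nat set \<Rightarrow> bool" where
  "row_basis N om R \<longleftrightarrow> R \<subseteq> {..<N} \<and> (\<exists>D. dual_rows N om R D) \<and>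
     (\<forall>u<N. \<exists>t. \<forall>l<N. om u l = (\<Sum>r\<in>R. t r * om r l))"

text \<open>Take \<open>R\<close> of largest size admitting a dual system. A vector killed by the
  rows in \<open>R\<close> is killed by every row, since otherwise it would extend the system.
  Applied to a unit vector corrected by the \<open>D r\<close>, this expresses every row through
  those in \<open>R\<close>.\<close>

lemma row_basis_exists: "\<exists>R. row_basis N om R"
proof -
  define P where "P = (\<lambda>R. R \<subseteq> {..<N} \<and> (\<exists>D. dual_rows N om R D))"
  have "P {}" by (simp add: P_def dual_rows_def)
  moreover have "\<forall>R. P R \<longrightarrow> card R < Suc N"
  proof (intro allI impI)
    fix R assume "P R"
    then have "card R \<le> card {..<N}" by (intro card_mono) (auto simp: P_def)
    then show "card R < Suc N" by simp
  qed
  ultimately obtain R where R: "P R" and max: "\<forall>R'. P R' \<longrightarrow> card R' \<le> card R"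
    using ex_has_greatest_nat[of P "{}" card "Suc N"] by blast
  obtain D where D: "dual_rows N om R D" using R by (auto simp: P_def)
  have fR: "finite R" using R by (auto simp: P_def intro: finite_subset)
  have DR: "D r \<in> bvecs N" "dotp N (om r') (D r) = (if r' = r then 1 else 0)" if "r \<in> R" "r' \<in> R" for r r'
    using D that by (auto simp: dual_rows_def)
  have zero: "dotp N (om u) c = 0"
    if u: "u < N" and c: "c \<in> bvecs N" "\<And>r. r \<in> R \<Longrightarrow> dotp N (om r) c = 0" for u c
  proof (cases "u \<in> R")
    case False
    show ?thesis
    proof (rule ccontr)
      assume nz: "dotp N (om u) c \<noteq> 0"
      then have one: "dotp N (om u) c = 1" by (simp add: bit_neq_0)
      define D' where "D' = (\<lambda>r. if r = u then c else D r + (\<lambda>j. dotp N (om u) (D r) * c j))"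
      have "dual_rows N om (insert u R) D'"
        unfolding dual_rows_def
      proof (intro ballI conjI)
        fix r assume r: "r \<in> insert u R"
        show "D' r \<in> bvecs N"
          using r DR c(1) by (auto simp: D'_def bvecs_def)
        fix r' assume r': "r' \<in> insert u R"
        show "dotp N (om r') (D' r) = (if r' = r then 1 else 0)"
          using r r' False one c(2) DR(2) by (auto simp: D'_def dotp_add dotp_scale)
      qed
      then have "P (insert u R)" using R u by (auto simp: P_def)
      then have "card (insert u R) \<le> card R" using max by blast
      with False fR show False by simp
    qed
  qed (use c in simp)
  have "\<exists>t. \<forall>l<N. om u l = (\<Sum>r\<in>R. t r * om r l)" if u: "u < N" for u
  proof (intro exI allI impI)
    fix l assume l: "l < N"
    define s where "s = (\<lambda>j. \<Sum>r\<in>R. om r l * D r j)"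
    have sb: "s \<in> bvecs N" using DR(1) by (auto simp: s_def bvecs_def)
    have "dotp N (om u) (unit_vec l + s) = 0"
    proof (rule zero[OF u])
      show "unit_vec l + s \<in> bvecs N" using sb unit_vec_bvecs[OF l] by (auto simp: bvecs_def)
      fix r assume r: "r \<in> R"
      have "dotp N (om r) s = (\<Sum>r'\<in>R. om r' l * (if r = r' then 1 else 0))"
        unfolding s_def dotp_sum using DR(2) r by (intro sum.cong) auto
      also have "\<dots> = om r l" using r fR by (simp add: if_distrib cong: if_cong)
      finally show "dotp N (om r) (unit_vec l + s) = 0" by (simp add: dotp_add dotp_unit[OF l])
    qed
    then have "om u l = dotp N (om u) s" by (simp add: dotp_add dotp_unit[OF l] bit_add_eq_0)
    also have "\<dots> = (\<Sum>r\<in>R. dotp N (om u) (D r) * om r l)"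
      unfolding s_def dotp_sum by (simp add: mult.commute)
    finally show "om u l = (\<Sum>r\<in>R. dotp N (om u) (D r) * om r l)" .
  qed
  with R show ?thesis unfolding row_basis_def P_def by blast
qed

text \<open>The \<open>2 ^ card R\<close> subset sums of the dual vectors are told apart by their
  products with the rows in \<open>R\<close>, on which the radical is zero. So the translates of the
  radical by these sums are disjoint.\<close>

lemma card_radical_row_basis:
  assumes sym: "\<And>j l. om j l = om l j" and R: "row_basis N om R"
  shows "card (radical (bform N om) (bvecs N)) * 2 ^ card R \<le> 2 ^ N"
proof -
  obtain D where D: "dual_rows N om R D" and RN: "R \<subseteq> {..<N}" using R by (auto simp: row_basis_def)
  have fR: "finite R" using RN finite_subset by blast
  have DR: "D r \<in> bvecs N" "dotp N (om r') (D r) = (if r' = r then 1 else 0)" if "r \<in> R" "r' \<in> R" for r r'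
    using D that by (auto simp: dual_rows_def)
  define K where "K = radical (bform N om) (bvecs N)"
  have K: "c \<in> bvecs N" "dotp N (om r) c = 0" if "c \<in> K" "r \<in> R" for c r
  proof -
    show "c \<in> bvecs N" using that by (simp add: K_def radical_def)
    have "r < N" using that RN by auto
    then have "bform N om c (unit_vec r) = 0"
      using that unit_vec_bvecs by (auto simp: K_def radical_def)
    then have "bform N om (unit_vec r) c = 0" by (simp add: bform_sym[OF sym])
    then show "dotp N (om r) c = 0"
      using \<open>r < N\<close> by (simp add: bform_def unit_vec_def if_distrib[of "\<lambda>x. x * _"] cong: if_cong)
  qed
  define g where "g = (\<lambda>(c, S) j. c j + (\<Sum>r\<in>R. (if r \<in> S then 1 else 0) * D r j))"
  have g: "dotp N (om r) (g (c, S)) = (if r \<in> S then 1 else 0)" if "c \<in> K" "r \<in> R" for c S r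
  proof -
    have eq: "g (c, S) = c + (\<lambda>j. \<Sum>r\<in>R. (if r \<in> S then 1 else 0) * D r j)"
      by (simp add: g_def fun_eq_iff)
    have "dotp N (om r) (g (c, S)) = (\<Sum>r'\<in>R. (if r' \<in> S then 1 else 0) * dotp N (om r) (D r'))"
      unfolding eq by (simp only: dotp_add dotp_sum K(2)[OF that]) simp
    also have "\<dots> = (\<Sum>r'\<in>R. if r' = r then (if r' \<in> S then 1 else 0) else 0)"
      using DR(2) that by (intro sum.cong) auto
    also have "\<dots> = (if r \<in> S then 1 else 0)" using that fR by simp
    finally show ?thesis .
  qed
  have "inj_on g (K \<times> Pow R)"
  proof (rule inj_onI, clarify)
    fix c S c' S' assume h: "c \<in> K" "S \<subseteq> R" "c' \<in> K" "S' \<subseteq> R" "g (c, S) = g (c', S')"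
    have "r \<in> S \<longleftrightarrow> r \<in> S'" if "r \<in> R" for r
      using g[OF h(1) that, of S] g[OF h(3) that, of S'] h(5) by (auto split: if_splits)
    then have S: "S = S'" using h by blast
    have "c j = c' j" for j using fun_cong[OF h(5), of j] S by (simp add: g_def)
    then show "c = c' \<and> S = S'" using S by (simp add: fun_eq_iff)
  qed
  then have "card (K \<times> Pow R) = card (g ` (K \<times> Pow R))" by (simp add: card_image)
  also have "\<dots> \<le> card (bvecs N)"
  proof (rule card_mono[OF finite_bvecs], clarify)
    fix c S assume "c \<in> K" "S \<subseteq> R"
    then show "g (c, S) \<in> bvecs N" using DR(1)
      by (auto simp: g_def bvecs_def K_def radical_def intro!: sum.neutral)
  qed
  finally show ?thesis using fR by (simp add: card_cartesian_product card_Pow card_bvecs K_def)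
qed

text \<open>The difference \<open>v\<close> of the two \<open>u\<close>-th rows is a combination of
  the common rows. By symmetry it vanishes in the columns of \<open>R\<close>, and by symmetry again
  every column is a combination of those columns, so \<open>v\<close> vanishes everywhere.\<close>

lemma row_basis_determines:
  assumes om: "om \<in> bit_forms N E" and om': "om' \<in> bit_forms N E"
    and R: "row_basis N om R" "row_basis N om' R" and eq: "\<And>r l. r \<in> R \<Longrightarrow> om r l = om' r l"
  shows "om = om'"
proof -
  have sym: "om j l = om l j" "om' j l = om' l j" for j l
    using om om' by (auto simp: bit_forms_def)
  have RN: "R \<subseteq> {..<N}" using R by (simp add: row_basis_def)
  have "om u l = om' u l" if ul: "u < N" "l < N" for u l
  proof -
    obtain t where t: "\<And>l. l < N \<Longrightarrow> om u l = (\<Sum>r\<in>R. t r * om r l)"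
      using R(1) ul unfolding row_basis_def by blast
    obtain t' where t': "\<And>l. l < N \<Longrightarrow> om' u l = (\<Sum>r\<in>R. t' r * om r l)"
      using R(2) ul eq unfolding row_basis_def by fastforce
    obtain a where a: "\<And>r. r < N \<Longrightarrow> om l r = (\<Sum>r'\<in>R. a r' * om r' r)"
      using R(1) ul unfolding row_basis_def by blast
    define v where "v = (\<lambda>l. \<Sum>r\<in>R. (t r + t' r) * om r l)"
    have v: "v l = om u l + om' u l" if "l < N" for l
      using t[OF that] t'[OF that] by (simp add: v_def distrib_right sum.distrib)
    have vR: "v r = 0" if "r \<in> R" for r
    proof -
      have "om u r = om' u r" using eq[OF that, of u] sym by metis
      then show ?thesis using v[of r] that RN by auto
    qed
    have "v l = (\<Sum>r\<in>R. (t r + t' r) * om l r)" unfolding v_def by (simp add: sym(1)[of l])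
    also have "\<dots> = (\<Sum>r\<in>R. \<Sum>r'\<in>R. a r' * ((t r + t' r) * om r' r))"
      using a RN by (intro sum.cong refl) (auto simp: sum_distrib_left mult_ac subset_iff)
    also have "\<dots> = (\<Sum>r'\<in>R. a r' * v r')"
      by (subst sum.swap) (simp add: v_def sum_distrib_left sym(1))
    also have "\<dots> = 0" using vR by simp
    finally have "om u l + om' u l = 0" using v ul by simp
    then show ?thesis by (simp add: bit_add_eq_0)
  qed
  moreover have "om u l \<noteq> 0 \<Longrightarrow> u < N \<and> l < N" "om' u l \<noteq> 0 \<Longrightarrow> u < N \<and> l < N" for u l
    using om om' unfolding bit_forms_def mem_Collect_eq by blast+
  ultimately show ?thesis by (intro ext) metis
qed

text \<open>Once \<open>R\<close> is fixed, a form is its rows in \<open>R\<close>, and row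
  \<open>r\<close> amounts to a set of non-neighbours of \<open>r\<close>.\<close>

lemma card_forms_with_row_basis:
  fixes N :: nat and E :: "nat set set"
  assumes R: "R \<subseteq> {..<N}"
  defines "F \<equiv> {om \<in> bit_forms N E. row_basis N om R}"
  shows "finite F" "card F \<le> 2 ^ (\<Sum>r\<in>R. card (non_nbrs N E r))"
proof -
  have fR: "finite R" using R finite_subset by blast
  define f where "f = (\<lambda>om :: nat \<Rightarrow> nat \<Rightarrow> bit. \<lambda>r\<in>R. {l. om r l = 1})"
  have fin: "finite (non_nbrs N E r)" for r
    by (rule finite_subset[of _ "{..<N}"]) (auto simp: non_nbrs_def)
  have inj: "inj_on f F"
  proof (rule inj_onI)
    fix om om' assume h: "om \<in> F" "om' \<in> F" "f om = f om'"
    show "om = om'"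
    proof (rule row_basis_determines)
      fix r l assume "r \<in> R"
      then have "{l. om r l = 1} = {l. om' r l = 1}" using fun_cong[OF h(3), of r] by (simp add: f_def)
      then have "om r l = 1 \<longleftrightarrow> om' r l = 1" by blast
      then show "om r l = om' r l" by (cases "om r l"; cases "om' r l") auto
    qed (use h in \<open>auto simp: F_def\<close>)
  qed
  have sub: "f ` F \<subseteq> (\<Pi>\<^sub>E r\<in>R. Pow (non_nbrs N E r))"
  proof (rule image_subsetI)
    fix om assume "om \<in> F"
    then have h: "\<forall>j l. om j l \<noteq> 0 \<longrightarrow> j < N \<and> l < N \<and> j \<noteq> l \<and> {j, l} \<notin> E"
      unfolding F_def bit_forms_def mem_Collect_eq by (elim conjE)
    have "l \<in> non_nbrs N E r" if "om r l = 1" for r l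
      using h[THEN spec, THEN spec, of r l] that by (simp add: non_nbrs_def)
    then show "f om \<in> (\<Pi>\<^sub>E r\<in>R. Pow (non_nbrs N E r))" by (auto simp: f_def)
  qed
  have fin': "finite (\<Pi>\<^sub>E r\<in>R. Pow (non_nbrs N E r))" using fR fin by (intro finite_PiE) auto
  show "finite F" using finite_imageD[OF finite_subset[OF sub fin'] inj] .
  have "card F = card (f ` F)" using inj by (simp add: card_image)
  also have "\<dots> \<le> card (\<Pi>\<^sub>E r\<in>R. Pow (non_nbrs N E r))" using fin' sub by (rule card_mono)
  also have "\<dots> = 2 ^ (\<Sum>r\<in>R. card (non_nbrs N E r))"
    using fR fin by (simp add: card_PiE card_Pow power_sum)
  finally show "card F \<le> 2 ^ (\<Sum>r\<in>R. card (non_nbrs N E r))" .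
qed

lemma sum_power_card_Pow:
  fixes x :: real
  assumes "finite A"
  shows "(\<Sum>R\<in>Pow A. x ^ card R) = (1 + x) ^ card A"
  using assms
proof induction
  case (insert a A)
  have "(\<Sum>R\<in>Pow (insert a A). x ^ card R) = (\<Sum>R\<in>Pow A. x ^ card R) + (\<Sum>R\<in>insert a ` Pow A. x ^ card R)"
    unfolding Pow_insert using insert by (intro sum.union_disjoint) auto
  also have "(\<Sum>R\<in>insert a ` Pow A. x ^ card R) = (\<Sum>R\<in>Pow A. x ^ card (insert a R))"
    using insert by (intro sum.reindex_cong[of "insert a"]) (auto intro!: inj_onI)
  also have "\<dots> = (\<Sum>R\<in>Pow A. x * x ^ card R)"
  proof (rule sum.cong[OF refl])
    fix R assume "R \<in> Pow A"
    then have "a \<notin> R" "finite R" using insert finite_subset by auto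
    then show "x ^ card (insert a R) = x * x ^ card R" by simp
  qed
  finally show ?case using insert by (simp add: distrib_right flip: sum_distrib_left)
qed simp

section \<open>Random lists of columns: the union bounds\<close>

text \<open>Linear independence modulo 2 of the rows in \<open>T\<close> of the matrix with columns
  \<open>cs\<close>: over this field a combination is a subset sum.\<close>

definition separating :: "nat set \<Rightarrow> (nat \<Rightarrow> bit) list \<Rightarrow> bool" where
  "separating T cs \<longleftrightarrow> (\<forall>S. S \<noteq> {} \<longrightarrow> S \<subseteq> T \<longrightarrow> (\<exists>c\<in>set cs. (\<Sum>j\<in>S. c j) = 1))"

text \<open>The columns stay independent modulo 2 after deletion of any single row \<open>v\<close>;
  this provides a relation between the rows with nonzero coefficient at \<open>v\<close>.\<close>

definition robust :: "nat \<Rightarrow> (nat \<Rightarrow> bit) list \<Rightarrow> bool" where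
  "robust N cs \<longleftrightarrow> (\<forall>A. A \<noteq> {} \<longrightarrow> A \<subseteq> {..<length cs} \<longrightarrow>
     (\<forall>v<N. \<exists>j<N. j \<noteq> v \<and> (\<Sum>a\<in>A. (cs ! a) j) = 1))"

definition column_lists :: "nat \<Rightarrow> nat \<Rightarrow> (nat \<Rightarrow> bit) list set" where
  "column_lists N p = {cs. set cs \<subseteq> bvecs N \<and> length cs = p}"

lemma finite_column_lists: "finite (column_lists N p)"
  and card_column_lists: "card (column_lists N p) = 2 ^ (N * p)"
  unfolding column_lists_def
  by (simp_all add: finite_lists_length_eq card_lists_length_eq finite_bvecs card_bvecs power_mult)

text \<open>For each nonempty \<open>S\<close> half of all columns have sum zero over
  \<open>S\<close>, so a fraction \<open>1 / 2 ^ p\<close> of the lists fails at \<open>S\<close>;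
  then a union bound over the subsets of \<open>T\<close>.\<close>

lemma card_not_separating:
  assumes T: "T \<subseteq> {..<N}"
  shows "card {cs \<in> column_lists N p. \<not> separating T cs} * 2 ^ p \<le> 2 ^ card T * 2 ^ (N * p)"
proof -
  have fT: "finite T" using T finite_subset by blast
  define B where "B = (\<lambda>S. {cs. set cs \<subseteq> {c \<in> bvecs N. (\<Sum>j\<in>S. c j) = 0} \<and> length cs = p})"
  have finK: "finite {c \<in> bvecs N. (\<Sum>j\<in>S. c j) = 0}" for S using finite_bvecs by simp
  have half: "2 * card {c \<in> bvecs N. (\<Sum>j\<in>S. c j) = 0} = 2 ^ N" if S: "S \<noteq> {}" "S \<subseteq> T" for S
  proof -
    obtain s where s: "s \<in> S" using S by blast
    have fS: "finite S" using S fT finite_subset by blast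
    have "2 * card {c \<in> bvecs N. (\<Sum>j\<in>S. c j) = 0} = card (bvecs N)"
    proof (rule card_kernel[OF elementary2_bvecs])
      show "additive_on (bvecs N) (\<lambda>c. \<Sum>j\<in>S. c j)" by (simp add: additive_on_def sum.distrib)
      show "unit_vec s \<in> bvecs N" using s S T by (intro unit_vec_bvecs) auto
      show "(\<Sum>j\<in>S. unit_vec s j) = 1" using s fS by (simp add: unit_vec_def)
    qed
    then show ?thesis by (simp add: card_bvecs)
  qed
  have cB: "card (B S) * 2 ^ p = 2 ^ (N * p)" if S: "S \<noteq> {}" "S \<subseteq> T" for S
  proof -
    have "card (B S) * 2 ^ p = (2 * card {c \<in> bvecs N. (\<Sum>j\<in>S. c j) = 0}) ^ p"
      unfolding B_def card_lists_length_eq[OF finK] power_mult_distrib by simp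
    then show ?thesis by (simp add: half[OF S] power_mult)
  qed
  have "{cs \<in> column_lists N p. \<not> separating T cs} \<subseteq> (\<Union>S\<in>Pow T - {{}}. B S)"
  proof
    fix cs assume "cs \<in> {cs \<in> column_lists N p. \<not> separating T cs}"
    then obtain S where S: "S \<noteq> {}" "S \<subseteq> T" "\<forall>c\<in>set cs. (\<Sum>j\<in>S. c j) \<noteq> 1" and cs: "cs \<in> column_lists N p"
      by (auto simp: separating_def)
    have "(\<Sum>j\<in>S. c j) = 0" if "c \<in> set cs" for c
      using S(3) that by (cases "(\<Sum>j\<in>S. c j) = 0") (auto simp: bit_neq_0)
    then have "cs \<in> B S" using cs by (auto simp: B_def column_lists_def)
    with S show "cs \<in> (\<Union>S\<in>Pow T - {{}}. B S)" by blast
  qed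
  then have "card {cs \<in> column_lists N p. \<not> separating T cs} \<le> card (\<Union>S\<in>Pow T - {{}}. B S)"
    using fT finK by (intro card_mono finite_UN_I) (auto simp: B_def finite_lists_length_eq)
  also have "\<dots> \<le> (\<Sum>S\<in>Pow T - {{}}. card (B S))" using fT by (intro card_UN_le) auto
  finally have "card {cs \<in> column_lists N p. \<not> separating T cs} * 2 ^ p \<le> (\<Sum>S\<in>Pow T - {{}}. card (B S)) * 2 ^ p"
    by (rule mult_le_mono1)
  also have "\<dots> = (\<Sum>S\<in>Pow T - {{}}. 2 ^ (N * p))"
    unfolding sum_distrib_right by (intro sum.cong refl cB) auto
  also have "\<dots> \<le> 2 ^ card T * 2 ^ (N * p)"
  proof -
    have "card (Pow T - {{}}) \<le> card (Pow T)" using fT by (intro card_mono) auto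
    then show ?thesis using fT by (simp add: card_Pow)
  qed
  finally show ?thesis .
qed

text \<open>Overwriting one fixed column \<open>b\<close> in \<open>A\<close> by an arbitrary vector
  is injective, because the prescribed sum recovers the lost column from the others.\<close>

lemma card_prescribed_sum:
  assumes A: "A \<noteq> {}" "A \<subseteq> {..<p}"
  shows "card {cs \<in> column_lists N p. (\<lambda>j. \<Sum>a\<in>A. (cs ! a) j) = t} * 2 ^ N \<le> 2 ^ (N * p)"
proof -
  obtain b where b: "b \<in> A" using A by blast
  then have bp: "b < p" using A by auto
  have fA: "finite A" using A finite_subset by blast
  define B where "B = {cs \<in> column_lists N p. (\<lambda>j. \<Sum>a\<in>A. (cs ! a) j) = t}"
  have inj: "inj_on (\<lambda>(cs, w). cs[b := w]) (B \<times> bvecs N)"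
  proof (rule inj_onI, clarify)
    fix cs w cs' w' assume h: "cs \<in> B" "cs' \<in> B" "cs[b := w] = cs'[b := w']"
    have len: "length cs = p" "length cs' = p" using h by (auto simp: B_def column_lists_def)
    have w: "w = w'" using arg_cong[OF h(3), of "\<lambda>l. l ! b"] len bp by simp
    have other: "cs ! a = cs' ! a" if "a \<noteq> b" for a
      using arg_cong[OF h(3), of "\<lambda>l. l ! a"] that by simp
    have "(cs ! b) j = (cs' ! b) j" for j
    proof -
      have "(\<lambda>j. \<Sum>a\<in>A. (cs ! a) j) = (\<lambda>j. \<Sum>a\<in>A. (cs' ! a) j)" using h(1,2) by (simp add: B_def)
      then have "(\<Sum>a\<in>A. (cs ! a) j) = (\<Sum>a\<in>A. (cs' ! a) j)" by (rule fun_cong)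
      then have "(cs ! b) j + (\<Sum>a\<in>A - {b}. (cs ! a) j) = (cs' ! b) j + (\<Sum>a\<in>A - {b}. (cs' ! a) j)"
        using sum.remove[OF fA b] by metis
      moreover have "(\<Sum>a\<in>A - {b}. (cs ! a) j) = (\<Sum>a\<in>A - {b}. (cs' ! a) j)"
        using other by (intro sum.cong) auto
      ultimately show ?thesis by simp
    qed
    then have "cs ! b = cs' ! b" by (rule ext)
    with other len have "cs = cs'" by (metis nth_equalityI)
    with w show "cs = cs' \<and> w = w'" by simp
  qed
  have "card B * 2 ^ N = card (B \<times> bvecs N)" by (simp add: card_cartesian_product card_bvecs)
  also have "\<dots> = card ((\<lambda>(cs, w). cs[b := w]) ` (B \<times> bvecs N))" using inj by (simp add: card_image)
  also have "\<dots> \<le> card (column_lists N p)"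
  proof (rule card_mono[OF finite_column_lists], clarify)
    fix cs w assume "cs \<in> B" "w \<in> bvecs N"
    then show "cs[b := w] \<in> column_lists N p"
      using set_update_subset_insert[of cs b w] by (auto simp: B_def column_lists_def)
  qed
  finally show ?thesis by (simp add: B_def card_column_lists)
qed

text \<open>A sum of columns that vanishes outside one row is zero or a unit vector, so there are at
  most \<open>2 ^ p * (N + 1)\<close> events to exclude.\<close>

lemma card_not_robust:
  "card {cs \<in> column_lists N p. \<not> robust N cs} * 2 ^ N \<le> 2 ^ p * (N + 1) * 2 ^ (N * p)"
proof -
  define V where "V = insert (\<lambda>_. 0) (unit_vec ` {..<N})"
  define I where "I = (Pow {..<p} - {{}}) \<times> V"
  define B where "B = (\<lambda>(A, t). {cs \<in> column_lists N p. (\<lambda>j. \<Sum>a\<in>A. (cs ! a) j) = t})"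
  have fV: "finite V" by (simp add: V_def)
  have cV: "card V \<le> N + 1"
    using card_image_le[of "{..<N}" unit_vec] card_insert_le_m1[of "N + 1" "unit_vec ` {..<N}" "\<lambda>_. 0"]
    by (simp add: V_def)
  have fI: "finite I" using fV by (simp add: I_def)
  have cI: "card I \<le> 2 ^ p * (N + 1)"
  proof -
    have "card (Pow {..<p} - {{}}) \<le> card (Pow {..<p})" by (intro card_mono) auto
    then have "card (Pow {..<p} - {{}}) \<le> 2 ^ p" by (simp add: card_Pow)
    then show ?thesis unfolding I_def card_cartesian_product using cV by (rule mult_le_mono)
  qed
  have "{cs \<in> column_lists N p. \<not> robust N cs} \<subseteq> (\<Union>i\<in>I. B i)"
  proof
    fix cs assume "cs \<in> {cs \<in> column_lists N p. \<not> robust N cs}"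
    then have cs: "cs \<in> column_lists N p" and nr: "\<not> robust N cs" by auto
    have len: "length cs = p" using cs by (simp add: column_lists_def)
    from nr[unfolded robust_def len] obtain A v where A: "A \<noteq> {}" "A \<subseteq> {..<p}" "v < N"
      and z: "\<And>j. j < N \<Longrightarrow> j \<noteq> v \<Longrightarrow> (\<Sum>a\<in>A. (cs ! a) j) \<noteq> 1"
      by blast
    define s where "s = (\<lambda>j. \<Sum>a\<in>A. (cs ! a) j)"
    have s0: "s j = 0" if "j \<noteq> v" for j
    proof (cases "j < N")
      case True
      then show ?thesis using z[OF True that] by (cases "s j = 0") (auto simp: bit_neq_0 s_def)
    next
      case False
      have "(cs ! a) j = 0" if "a \<in> A" for a
      proof -
        have "cs ! a \<in> bvecs N" using cs A that by (auto simp: column_lists_def subset_iff)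
        then show ?thesis using False by (simp add: bvecs_def)
      qed
      then show ?thesis by (simp add: s_def)
    qed
    have "s = (\<lambda>_. 0) \<or> s = unit_vec v"
    proof (cases "s v = 0")
      case True
      then have "s j = 0" for j using s0 by (cases "j = v") auto
      then show ?thesis by auto
    next
      case False
      then have "s j = unit_vec v j" for j using s0 by (cases "j = v") (auto simp: unit_vec_def bit_neq_0)
      then show ?thesis by auto
    qed
    then have "s \<in> V" using A(3) by (auto simp: V_def)
    then have "(A, s) \<in> I" using A by (auto simp: I_def)
    moreover have "cs \<in> B (A, s)" using cs by (simp add: B_def s_def)
    ultimately show "cs \<in> (\<Union>i\<in>I. B i)" by blast
  qed
  then have "card {cs \<in> column_lists N p. \<not> robust N cs} \<le> card (\<Union>i\<in>I. B i)"
    using fI by (intro card_mono finite_UN_I) (auto simp: B_def intro: finite_subset[OF _ finite_column_lists])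
  also have "\<dots> \<le> (\<Sum>i\<in>I. card (B i))" by (rule card_UN_le[OF fI])
  finally have "card {cs \<in> column_lists N p. \<not> robust N cs} * 2 ^ N \<le> (\<Sum>i\<in>I. card (B i)) * 2 ^ N"
    by (rule mult_le_mono1)
  also have "\<dots> \<le> (\<Sum>i\<in>I. 2 ^ (N * p))"
    unfolding sum_distrib_right
  proof (rule sum_mono)
    fix i assume "i \<in> I"
    then obtain A t where "i = (A, t)" "A \<noteq> {}" "A \<subseteq> {..<p}" by (cases i) (simp add: I_def)
    then show "card (B i) * 2 ^ N \<le> 2 ^ (N * p)" using card_prescribed_sum[of A p N t] by (simp add: B_def)
  qed
  also have "\<dots> = card I * 2 ^ (N * p)" by simp
  also have "\<dots> \<le> 2 ^ p * (N + 1) * 2 ^ (N * p)" using cI by (rule mult_le_mono1)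
  finally show ?thesis .
qed

text \<open>The number of forms with row basis \<open>R\<close> times the loss factors of
  \<open>card_iso_lists\<close> has to stay below the gain \<open>2 ^ (h * p)\<close>, where
  \<open>h\<close> is half the rank rounded up. The factor \<open>(4 * N) ^ card R\<close> is a
  reserve that makes the sum over all \<open>R\<close> small.\<close>

definition few_forms :: "nat \<Rightarrow> nat set set \<Rightarrow> nat \<Rightarrow> bool" where
  "few_forms N E p \<longleftrightarrow> (\<forall>R. R \<subseteq> {..<N} \<longrightarrow> R \<noteq> {} \<longrightarrow> (let h = (card R + 1) div 2 in
     2 ^ (\<Sum>r\<in>R. card (non_nbrs N E r)) * (p + 1) ^ h * 2 ^ triangular h * (4 * N) ^ card R \<le> (2::nat) ^ (h * p)))"

text \<open>Union bound over row bases and forms. The reserve in \<open>few_forms\<close> leaves a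
  fraction \<open>(1 / (4 * N)) ^ card R\<close> for each \<open>R\<close>, and the sum over
  nonempty \<open>R\<close> is
  \<open>(1 + 1 / (4 * N)) ^ N - 1 \<le> exp (1/4) - 1 < 1/2\<close>.\<close>

lemma card_isotropic_for_some_form:
  fixes N p :: nat and E :: "nat set set"
  assumes N: "N > 0" and num: "few_forms N E p"
  shows "real (card {cs \<in> column_lists N p. \<exists>om\<in>bit_forms N E. om \<noteq> (\<lambda>_ _. 0) \<and> iso_list (bform N om) cs})
    < 2 ^ (N * p) / 2"
proof -
  define I where "I = Pow {..<N} - {{}}"
  define F where "F = (\<lambda>R. {om \<in> bit_forms N E. row_basis N om R})"
  have fI: "finite I" by (simp add: I_def)
  have fF: "finite (F R)" "card (F R) \<le> 2 ^ (\<Sum>r\<in>R. card (non_nbrs N E r))" if "R \<in> I" for R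
    using card_forms_with_row_basis[of R N E] that by (auto simp: I_def F_def)
  have iso: "card (iso_lists (bform N om) (bvecs N) p) * 2 ^ ((card R + 1) div 2 * p)
      \<le> 2 ^ (N * p) * (p + 1) ^ ((card R + 1) div 2) * 2 ^ triangular ((card R + 1) div 2)"
    if "om \<in> F R" for R om
  proof -
    have sym: "om j l = om l j" for j l using that by (auto simp: F_def bit_forms_def)
    \<comment> \<open>\<open>2 * h\<close> may exceed \<open>card R\<close> by one; the factor 2 in
      the hypothesis of \<open>card_iso_lists\<close> is there for this rounding.\<close>
    have "card (radical (bform N om) (bvecs N)) * 2 ^ (2 * ((card R + 1) div 2))
        \<le> card (radical (bform N om) (bvecs N)) * 2 ^ (card R + 1)"
      by (intro mult_le_mono2 power_increasing) auto
    also have "\<dots> \<le> 2 * card (bvecs N)"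
      using card_radical_row_basis[where om = om and N = N and R = R, OF sym] that by (simp add: F_def card_bvecs)
    finally have rad: "card (radical (bform N om) (bvecs N)) * 2 ^ (2 * ((card R + 1) div 2)) \<le> 2 * card (bvecs N)" .
    have "card (iso_lists (bform N om) (bvecs N) p) * 2 ^ ((card R + 1) div 2 * p)
      \<le> card (bvecs N) ^ p * (p + 1) ^ ((card R + 1) div 2) * 2 ^ triangular ((card R + 1) div 2)"
      by (rule card_iso_lists[OF elementary2_bvecs bform_sym[OF sym] _ rad]) (simp add: additive_on_def bform_add)
    then show ?thesis by (simp add: card_bvecs power_mult)
  qed
  define x where "x = 1 / (4 * real N)"
  have "{cs \<in> column_lists N p. \<exists>om\<in>bit_forms N E. om \<noteq> (\<lambda>_ _. 0) \<and> iso_list (bform N om) cs}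
     \<subseteq> (\<Union>R\<in>I. \<Union>om\<in>F R. iso_lists (bform N om) (bvecs N) p)"
  proof
    fix cs assume "cs \<in> {cs \<in> column_lists N p. \<exists>om\<in>bit_forms N E. om \<noteq> (\<lambda>_ _. 0) \<and> iso_list (bform N om) cs}"
    then obtain om where cs: "cs \<in> column_lists N p" and om: "om \<in> bit_forms N E" "om \<noteq> (\<lambda>_ _. 0)"
      "iso_list (bform N om) cs" by blast
    obtain R where R: "row_basis N om R" using row_basis_exists by blast
    have "R \<noteq> {}"
    proof
      assume "R = {}"
      then have "om u l = 0" if "u < N" "l < N" for u l
        using R that unfolding row_basis_def by auto
      moreover have "om u l \<noteq> 0 \<Longrightarrow> u < N \<and> l < N" for u l
        using om(1) unfolding bit_forms_def mem_Collect_eq by blast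
      ultimately have "om u l = 0" for u l by blast
      with om(2) show False by (auto simp: fun_eq_iff)
    qed
    then have "R \<in> I" "om \<in> F R" using R om(1) by (auto simp: I_def F_def row_basis_def)
    moreover have "cs \<in> iso_lists (bform N om) (bvecs N) p"
      using cs om(3) by (auto simp: iso_lists_def column_lists_def)
    ultimately show "cs \<in> (\<Union>R\<in>I. \<Union>om\<in>F R. iso_lists (bform N om) (bvecs N) p)" by blast
  qed
  then have "card {cs \<in> column_lists N p. \<exists>om\<in>bit_forms N E. om \<noteq> (\<lambda>_ _. 0) \<and> iso_list (bform N om) cs}
     \<le> card (\<Union>R\<in>I. \<Union>om\<in>F R. iso_lists (bform N om) (bvecs N) p)"
    using fI fF by (intro card_mono finite_UN_I) (auto simp: card_iso_lists_le finite_bvecs)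
  also have "\<dots> \<le> (\<Sum>R\<in>I. card (\<Union>om\<in>F R. iso_lists (bform N om) (bvecs N) p))" by (rule card_UN_le[OF fI])
  also have "real \<dots> \<le> (\<Sum>R\<in>I. 2 ^ (N * p) * x ^ card R)"
    unfolding of_nat_sum
  proof (rule sum_mono)
    fix R assume R: "R \<in> I"
    define h where "h = (card R + 1) div 2"
    define M where "M = 2 ^ (N * p) * (p + 1) ^ h * 2 ^ triangular h"
    have "card (\<Union>om\<in>F R. iso_lists (bform N om) (bvecs N) p) * 2 ^ (h * p)
       \<le> (\<Sum>om\<in>F R. card (iso_lists (bform N om) (bvecs N) p)) * 2 ^ (h * p)"
      by (intro mult_le_mono1 card_UN_le fF R)
    also have "\<dots> \<le> (\<Sum>om\<in>F R. M)"
      unfolding sum_distrib_right M_def h_def by (intro sum_mono iso)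
    also have "\<dots> \<le> 2 ^ (\<Sum>r\<in>R. card (non_nbrs N E r)) * M"
      using mult_le_mono1[OF fF(2)[OF R]] by simp
    finally have 1: "card (\<Union>om\<in>F R. iso_lists (bform N om) (bvecs N) p) * 2 ^ (h * p)
       \<le> 2 ^ (\<Sum>r\<in>R. card (non_nbrs N E r)) * M" .
    have "card (\<Union>om\<in>F R. iso_lists (bform N om) (bvecs N) p) * (4 * N) ^ card R * 2 ^ (h * p)
       \<le> 2 ^ (\<Sum>r\<in>R. card (non_nbrs N E r)) * M * (4 * N) ^ card R"
      using mult_le_mono1[OF 1, of "(4 * N) ^ card R"] by (simp add: mult_ac)
    also have "\<dots> = 2 ^ (N * p) * (2 ^ (\<Sum>r\<in>R. card (non_nbrs N E r)) * (p + 1) ^ h * 2 ^ triangular h * (4 * N) ^ card R)"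
      by (simp add: M_def mult_ac)
    also have "\<dots> \<le> 2 ^ (N * p) * 2 ^ (h * p)"
      using num[unfolded few_forms_def Let_def, rule_format, of R] R unfolding h_def
      by (intro mult_le_mono2) (auto simp: I_def)
    finally have "card (\<Union>om\<in>F R. iso_lists (bform N om) (bvecs N) p) * (4 * N) ^ card R \<le> 2 ^ (N * p)" by simp
    then have "real (card (\<Union>om\<in>F R. iso_lists (bform N om) (bvecs N) p) * (4 * N) ^ card R) \<le> real (2 ^ (N * p))"
      by (rule of_nat_mono)
    then have "real (card (\<Union>om\<in>F R. iso_lists (bform N om) (bvecs N) p)) * (4 * real N) ^ card R \<le> 2 ^ (N * p)"
      by simp
    then show "real (card (\<Union>om\<in>F R. iso_lists (bform N om) (bvecs N) p)) \<le> 2 ^ (N * p) * x ^ card R"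
      using N by (simp add: x_def power_divide field_simps)
  qed
  also have "\<dots> = 2 ^ (N * p) * ((\<Sum>R\<in>Pow {..<N}. x ^ card R) - 1)"
    by (simp add: I_def sum_diff1 flip: sum_distrib_left)
  also have "(\<Sum>R\<in>Pow {..<N}. x ^ card R) = (1 + x) ^ N"
    by (subst sum_power_card_Pow) auto
  also have "2 ^ (N * p) * ((1 + x) ^ N - 1) < 2 ^ (N * p) * (1 / 2)"
  proof (rule mult_strict_left_mono)
    have "(1 + x) ^ N \<le> exp x ^ N" using N by (intro power_mono) (auto simp: x_def)
    also have "\<dots> = exp (1 / 4)" using N by (simp add: x_def flip: exp_of_nat_mult)
    also have "\<dots> \<le> 1 + 1 / 4 + (1 / 4)^2" by (rule exp_bound) auto
    finally show "(1 + x) ^ N - 1 < 1 / 2" by (simp add: power2_eq_square)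
  qed simp
  finally show ?thesis by simp
qed

text \<open>The three kinds of failure take up at most a quarter, at most a quarter and less than a
  half of all lists.\<close>

lemma good_columns_exist:
  fixes N p k :: nat and E :: "nat set set" and T :: "nat \<Rightarrow> nat set"
  assumes T: "\<And>i. i < k \<Longrightarrow> T i \<subseteq> {..<N}"
    and n1: "4 * (\<Sum>i<k. 2 ^ card (T i)) \<le> (2::nat) ^ p"
    and n2: "4 * (N + 1) * 2 ^ p \<le> (2::nat) ^ N"
    and num: "few_forms N E p"
  shows "\<exists>cs\<in>column_lists N p. (\<forall>i<k. separating (T i) cs) \<and> robust N cs \<and>
     (\<forall>om\<in>bit_forms N E. iso_list (bform N om) cs \<longrightarrow> om = (\<lambda>_ _. 0))"
proof -
  define L where "L = column_lists N p"
  define B1 where "B1 = (\<lambda>i. {cs \<in> L. \<not> separating (T i) cs})"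
  define B2 where "B2 = {cs \<in> L. \<not> robust N cs}"
  define B3 where "B3 = {cs \<in> L. \<exists>om\<in>bit_forms N E. om \<noteq> (\<lambda>_ _. 0) \<and> iso_list (bform N om) cs}"
  have fL: "finite L" by (simp add: L_def finite_column_lists)
  have cL: "card L = 2 ^ (N * p)" by (simp add: L_def card_column_lists)
  have N: "N > 0"
  proof (rule ccontr)
    assume "\<not> N > 0"
    then have "4 * 2 ^ p \<le> (1::nat)" using n2 by simp
    moreover have "(1::nat) \<le> 2 ^ p" by simp
    ultimately show False by linarith
  qed
  have "4 * card (\<Union>i<k. B1 i) * 2 ^ p \<le> 4 * (\<Sum>i<k. card (B1 i)) * 2 ^ p"
    by (intro mult_le_mono1 mult_le_mono2 card_UN_le) auto
  also have "\<dots> = 4 * (\<Sum>i<k. card (B1 i) * 2 ^ p)" by (simp add: sum_distrib_right)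
  also have "\<dots> \<le> 4 * (\<Sum>i<k. 2 ^ card (T i) * 2 ^ (N * p))"
    unfolding B1_def L_def by (intro mult_le_mono2 sum_mono card_not_separating T) auto
  also have "\<dots> = 4 * (\<Sum>i<k. 2 ^ card (T i)) * 2 ^ (N * p)" by (simp add: sum_distrib_right)
  also have "\<dots> \<le> 2 ^ p * 2 ^ (N * p)" using n1 by (rule mult_le_mono1)
  finally have b1: "4 * card (\<Union>i<k. B1 i) \<le> 2 ^ (N * p)" by simp
  have "4 * card B2 * 2 ^ N \<le> 4 * (2 ^ p * (N + 1) * 2 ^ (N * p))"
    using card_not_robust[of N p] unfolding B2_def L_def by simp
  also have "\<dots> = (4 * (N + 1) * 2 ^ p) * 2 ^ (N * p)" by (simp add: algebra_simps)
  also have "\<dots> \<le> 2 ^ N * 2 ^ (N * p)" using n2 by (rule mult_le_mono1)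
  finally have b2: "4 * card B2 \<le> 2 ^ (N * p)" by simp
  have b3: "real (card B3) < 2 ^ (N * p) / 2"
    unfolding B3_def L_def by (rule card_isotropic_for_some_form[OF N num])
  have "card ((\<Union>i<k. B1 i) \<union> B2 \<union> B3) \<le> card (\<Union>i<k. B1 i) + card B2 + card B3"
    by (meson add_le_mono card_Un_le le_refl order_trans)
  then have "real (card ((\<Union>i<k. B1 i) \<union> B2 \<union> B3)) \<le> real (card (\<Union>i<k. B1 i)) + real (card B2) + real (card B3)"
    by (metis of_nat_add of_nat_mono)
  also have "\<dots> < real (card L)"
  proof -
    have "real (4 * card (\<Union>i<k. B1 i)) \<le> real (2 ^ (N * p))" using b1 by (rule of_nat_mono)
    moreover have "real (4 * card B2) \<le> real (2 ^ (N * p))" using b2 by (rule of_nat_mono)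
    ultimately show ?thesis using b3 by (simp add: cL)
  qed
  finally have "card ((\<Union>i<k. B1 i) \<union> B2 \<union> B3) < card L" by simp
  then have "\<not> L \<subseteq> (\<Union>i<k. B1 i) \<union> B2 \<union> B3"
  proof (rule contrapos_pn)
    assume "L \<subseteq> (\<Union>i<k. B1 i) \<union> B2 \<union> B3"
    then have "card L \<le> card ((\<Union>i<k. B1 i) \<union> B2 \<union> B3)"
      using fL by (intro card_mono finite_UnI finite_UN_I) (auto simp: B1_def B2_def B3_def)
    then show "\<not> card ((\<Union>i<k. B1 i) \<union> B2 \<union> B3) < card L" by simp
  qed
  then obtain cs where "cs \<in> L" "cs \<notin> (\<Union>i<k. B1 i)" "cs \<notin> B2" "cs \<notin> B3" by blast
  then show ?thesis
    unfolding L_def[symmetric] by (intro bexI[of _ cs]) (auto simp: B1_def B2_def B3_def)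
qed

section \<open>From bits to real matrices\<close>

lemma of_int_bit_eq_0: "(of_int x :: bit) = 0 \<longleftrightarrow> even x"
proof (cases "even x")
  case True
  then obtain y where "x = 2 * y" by blast
  then show ?thesis using True by simp
next
  case False
  then obtain y where "x = 2 * y + 1" by (rule oddE)
  then show ?thesis using False by simp
qed

lemma of_int_bit: "(of_int x :: bit) = (if odd x then 1 else 0)"
  using of_int_bit_eq_0[of x] by (auto simp: bit_neq_0)

lemma even_imp_of_int_bit_0: "even x \<Longrightarrow> (of_int x :: bit) = 0"
  by (simp only: of_int_bit_eq_0)

definition lift_matrix :: "(nat \<Rightarrow> bit) list \<Rightarrow> nat \<Rightarrow> nat \<Rightarrow> int" where
  "lift_matrix cs j a = (if (cs ! a) j = 1 then 1 else 0)"

lemma of_int_lift_matrix [simp]: "of_int (lift_matrix cs j a) = (cs ! a) j"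
  by (cases "(cs ! a) j = 0") (auto simp: lift_matrix_def bit_neq_0)

text \<open>Modulo 2, an integer combination of the rows in \<open>T\<close> is the sum of those
  with odd coefficients, which \<open>separating\<close> keeps from vanishing unless there are
  none.\<close>

lemma lift_matrix_independent:
  fixes c :: "nat \<Rightarrow> real"
  assumes sep: "separating T cs" and T: "T \<subseteq> {..<N}"
    and c: "\<And>j. c j \<noteq> 0 \<Longrightarrow> j \<in> T"
    and ker: "\<And>a. a < length cs \<Longrightarrow> (\<Sum>j<N. c j * of_int (lift_matrix cs j a)) = 0"
  shows "\<forall>j. c j = 0"
proof -
  have fT: "finite T" by (rule finite_subset[OF T]) simp
  have "\<forall>j\<in>T. c j = 0"
  proof (rule real_kernel_trivial_of_parity[where I = "{..<length cs}" and M = "\<lambda>a j. lift_matrix cs j a"])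
    fix x :: "nat \<Rightarrow> int"
    assume ev: "\<And>a. a \<in> {..<length cs} \<Longrightarrow> even (\<Sum>j\<in>T. lift_matrix cs j a * x j)"
    define S where "S = {j \<in> T. odd (x j)}"
    have "S = {}"
    proof (rule ccontr)
      assume "S \<noteq> {}"
      moreover have "S \<subseteq> T" by (auto simp: S_def)
      ultimately have "\<exists>c\<in>set cs. (\<Sum>j\<in>S. c j) = 1"
        using sep[unfolded separating_def, THEN spec, of S] by simp
      then obtain a where a: "a < length cs" "(\<Sum>j\<in>S. (cs ! a) j) = 1"
        by (auto simp: in_set_conv_nth)
      define c where "c = cs ! a"
      have "of_int (\<Sum>j\<in>T. lift_matrix cs j a * x j) = (\<Sum>j\<in>T. if odd (x j) then c j else 0)"
        unfolding of_int_sum of_int_mult of_int_lift_matrix c_def by (intro sum.cong) (auto simp: of_int_bit)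
      also have "\<dots> = (\<Sum>j\<in>S. c j)" unfolding S_def using fT by (simp add: sum.inter_filter)
      finally have "of_int (\<Sum>j\<in>T. lift_matrix cs j a * x j) = (1::bit)" using a(2) by (simp only: c_def)
      moreover have "of_int (\<Sum>j\<in>T. lift_matrix cs j a * x j) = (0::bit)"
        using ev a(1) by (intro even_imp_of_int_bit_0) simp
      ultimately show False by (simp only: zero_neq_one)
    qed
    then show "\<forall>j\<in>T. even (x j)" by (auto simp: S_def)
  next
    fix a assume a: "a \<in> {..<length cs}"
    have "(\<Sum>j\<in>T. of_int (lift_matrix cs j a) * c j) = (\<Sum>j<N. c j * of_int (lift_matrix cs j a))"
      using T c by (intro sum.mono_neutral_cong_left) (auto simp: mult.commute)
    then show "(\<Sum>j\<in>T. of_int (lift_matrix cs j a) * c j) = 0" using ker a by simp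
  qed (use fT in auto)
  with c show ?thesis by blast
qed

lemma bform_nonedges:
  assumes "om \<in> bit_forms N E"
  shows "bform N om x y = (\<Sum>(u, v)\<in>nonedges N E. om u v * (x u * y v + x v * y u))"
proof -
  have sym: "om u v = om v u" and z: "u = v \<or> {u, v} \<in> E \<Longrightarrow> om u v = 0" for u v
    using assms unfolding bit_forms_def mem_Collect_eq by blast+
  have "bform N om x y = (\<Sum>u<N. \<Sum>v<N. x u * (om u v * y v))"
    by (simp add: bform_def dotp_def sum_distrib_left)
  also have "\<dots> = (\<Sum>(u, v)\<in>nonedges N E. x u * (om u v * y v) + x v * (om v u * y u))"
    by (rule sum_over_nonedges) (use z in auto)
  also have "\<dots> = (\<Sum>(u, v)\<in>nonedges N E. om u v * (x u * y v + x v * y u))"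
    using sym by (intro sum.cong refl) (auto simp: algebra_simps)
  finally show ?thesis .
qed

lemma iso_listI:
  "(\<And>a b. a < b \<Longrightarrow> b < length cs \<Longrightarrow> \<beta> (cs ! a) (cs ! b) = 0) \<Longrightarrow> iso_list \<beta> cs"
proof (induction cs)
  case (Cons c cs)
  have "\<beta> c y = 0" if "y \<in> set cs" for y
  proof -
    from that[unfolded in_set_conv_nth] obtain b where b: "b < length cs" "cs ! b = y" by (elim exE conjE)
    from Cons.prems[of 0 "Suc b"] b show ?thesis by (simp only: nth_Cons_0 nth_Cons_Suc list.size)
    qed
  moreover have "iso_list \<beta> cs"
  proof (rule Cons.IH)
    fix a b assume "a < b" "b < length cs"
    with Cons.prems[of "Suc a" "Suc b"] show "\<beta> (cs ! a) (cs ! b) = 0" by simp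
  qed
  ultimately show ?case by simp
qed simp

text \<open>The unknowns are the non-edge entries and the equations are the values on pairs of
  columns. An integer vector solving them modulo 2 reduces to a bit form \<open>w\<close> for which
  the columns are isotropic, so \<open>w\<close> is zero and the vector is even.\<close>

lemma lift_matrix_forms:
  fixes om :: "nat \<Rightarrow> nat \<Rightarrow> real"
  assumes iso: "\<And>om. om \<in> bit_forms N E \<Longrightarrow> iso_list (bform N om) cs \<Longrightarrow> om = (\<lambda>_ _. 0)"
    and om: "nonedge_form N E om"
    and ker: "\<And>a b. a < length cs \<Longrightarrow> b < length cs \<Longrightarrow>
       form_val N om (\<lambda>j. of_int (lift_matrix cs j a)) (\<lambda>j. of_int (lift_matrix cs j b)) = 0"
  shows "\<forall>u v. om u v = 0"
proof -
  define P where "P = nonedges N E"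
  define I where "I = {..<length cs} \<times> {..<length cs}"
  define M where "M = (\<lambda>(a, b) (u, v). lift_matrix cs u a * lift_matrix cs v b + lift_matrix cs v a * lift_matrix cs u b)"
  have asym: "(u, v) \<in> P \<Longrightarrow> (v, u) \<notin> P" for u v by (auto simp: P_def nonedges_def)
  have "\<forall>i\<in>P. om (fst i) (snd i) = 0"
  proof (rule real_kernel_trivial_of_parity[where I = I and M = M])
    fix x :: "nat \<times> nat \<Rightarrow> int"
    assume ev: "\<And>i. i \<in> I \<Longrightarrow> even (\<Sum>j\<in>P. M i j * x j)"
    define w :: "nat \<Rightarrow> nat \<Rightarrow> bit" where
      "w = (\<lambda>u v. if (u, v) \<in> P then of_int (x (u, v)) else if (v, u) \<in> P then of_int (x (v, u)) else 0)"
    have PD: "(u, v) \<in> P \<Longrightarrow> u < N \<and> v < N \<and> u \<noteq> v \<and> {u, v} \<notin> E \<and> {v, u} \<notin> E" for u v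
      by (auto simp: P_def nonedges_def insert_commute)
    have w: "w \<in> bit_forms N E"
      unfolding bit_forms_def
    proof (intro CollectI conjI allI impI)
      show "w u v = w v u" for u v using asym by (auto simp: w_def)
      fix u v assume "w u v \<noteq> 0"
      then have "(u, v) \<in> P \<or> (v, u) \<in> P" by (auto simp: w_def split: if_splits)
      then show "u < N" "v < N" "u \<noteq> v" "{u, v} \<notin> E" using PD by blast+
    qed
    have "bform N w (cs ! a) (cs ! b) = 0" if "a < length cs" "b < length cs" for a b
    proof -
      have "bform N w (cs ! a) (cs ! b) = of_int (\<Sum>j\<in>P. M (a, b) j * x j)"
        unfolding bform_nonedges[OF w] of_int_sum P_def[symmetric]
        by (intro sum.cong refl) (auto simp: M_def w_def mult.commute)
      also have "\<dots> = 0"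
        using ev[of "(a, b)"] that by (intro even_imp_of_int_bit_0) (simp add: I_def)
      finally show ?thesis .
    qed
    then have "w = (\<lambda>_ _. 0)" by (intro iso[OF w] iso_listI) auto
    then show "\<forall>j\<in>P. even (x j)"
    proof (intro ballI)
      fix j assume j: "j \<in> P"
      then have "w (fst j) (snd j) = of_int (x j)" by (simp add: w_def)
      with \<open>w = (\<lambda>_ _. 0)\<close> have "of_int (x j) = (0::bit)" by simp
      then show "even (x j)" by (simp only: of_int_bit_eq_0)
    qed
  next
    fix i assume "i \<in> I"
    then obtain a b where i: "i = (a, b)" "a < length cs" "b < length cs" by (auto simp: I_def)
    have "(\<Sum>j\<in>P. of_int (M i j) * om (fst j) (snd j)) =
       form_val N om (\<lambda>j. of_int (lift_matrix cs j a)) (\<lambda>j. of_int (lift_matrix cs j b))"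
      unfolding form_val_nonedges[OF om] P_def i(1) by (intro sum.cong refl) (auto simp: M_def mult.commute)
    then show "(\<Sum>j\<in>P. of_int (M i j) * om (fst j) (snd j)) = 0" using ker i by simp
  qed (simp_all add: P_def I_def)
  then have z: "om u v = 0" if "(u, v) \<in> P" for u v using that by auto
  show ?thesis
  proof (intro allI, rule ccontr)
    fix u v assume nz: "om u v \<noteq> 0"
    then have "u < N" "v < N" "u \<noteq> v" "{u, v} \<notin> E" "om v u \<noteq> 0" using om by (auto simp: nonedge_form_def)
    then have "(u, v) \<in> P \<or> (v, u) \<in> P" by (auto simp: P_def nonedges_def insert_commute)
    with z nz \<open>om v u \<noteq> 0\<close> show False by blast
  qed
qed

text \<open>Adding \<open>t\<close> times a vector that is nonzero at the next coordinate creates a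
  zero for only finitely many \<open>t\<close>.\<close>

lemma nowhere_zero_combination:
  fixes V :: "(nat \<Rightarrow> real) set"
  assumes "(\<lambda>_. 0) \<in> V" and cl: "\<And>x y t. x \<in> V \<Longrightarrow> y \<in> V \<Longrightarrow> (\<lambda>j. x j + t * y j) \<in> V"
    and ex: "\<And>v. v < N \<Longrightarrow> \<exists>x\<in>V. x v \<noteq> 0"
  shows "\<exists>s\<in>V. \<forall>v<N. s v \<noteq> 0"
  using ex
proof (induction N)
  case 0
  show ?case by (rule bexI[OF _ assms(1)]) simp
next
  case (Suc N)
  have "\<exists>s\<in>V. \<forall>v<N. s v \<noteq> 0" by (rule Suc.IH) (rule Suc.prems, simp)
  then obtain s where s: "s \<in> V" "\<forall>v<N. s v \<noteq> 0" by blast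
  obtain y where y: "y \<in> V" "y N \<noteq> 0" using Suc.prems by blast
  have "\<exists>t. t \<notin> (\<lambda>v. - s v / y v) ` {..N}"
    by (rule ex_new_if_finite[OF infinite_UNIV_char_0]) simp
  then obtain t where t: "t \<notin> (\<lambda>v. - s v / y v) ` {..N}" ..
  have "s v + t * y v \<noteq> 0" if v: "v < Suc N" for v
  proof (cases "y v = 0")
    case True
    then show ?thesis using s(2) y(2) v by (auto simp: less_Suc_eq)
  next
    case False
    have "t \<noteq> - s v / y v" using t v by auto
    then show ?thesis using False by (simp add: field_simps add_eq_0_iff)
  qed
  then show ?case by (intro bexI[OF _ cl[OF s(1) y(1), of t]]) simp
qed

text \<open>Without row \<open>v\<close> the lifted columns are still independent over the reals, so
  the remaining rows span and row \<open>v\<close> is a combination of them. This is a relation with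
  coefficient -1 at \<open>v\<close>; relations form a vector space, and
  \<open>nowhere_zero_combination\<close> merges them.\<close>

lemma lift_matrix_relation:
  assumes rob: "robust N cs"
  shows "\<exists>s :: nat \<Rightarrow> real. (\<forall>j<N. s j \<noteq> 0) \<and> (\<forall>a<length cs. (\<Sum>j<N. s j * of_int (lift_matrix cs j a)) = 0)"
proof -
  define p where "p = length cs"
  define Y where "Y = (\<lambda>j a. of_int (lift_matrix cs j a) :: real)"
  define V where "V = {s. \<forall>a<p. (\<Sum>j<N. s j * Y j a) = 0}"
  have "\<exists>s\<in>V. \<forall>v<N. s v \<noteq> 0"
  proof (rule nowhere_zero_combination)
    show "(\<lambda>_. 0) \<in> V" by (simp add: V_def)
    show "(\<lambda>j. x j + t * y j) \<in> V" if "x \<in> V" "y \<in> V" for x y t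
      using that by (simp add: V_def distrib_right sum.distrib mult.assoc flip: sum_distrib_left)
    fix v assume v: "v < N"
    define J where "J = {..<N} - {v}"
    have "\<exists>G. \<forall>a\<in>{..<p}. \<forall>b\<in>{..<p}. (\<Sum>j\<in>J. G a j * Y j b) = (if a = b then 1 else 0)"
    proof (rule left_inverse_matrix)
      fix x assume x: "\<And>j. j \<in> J \<Longrightarrow> (\<Sum>a<p. Y j a * x a) = 0"
      show "\<forall>a\<in>{..<p}. x a = 0"
      proof (rule real_kernel_trivial_of_parity[where I = J and M = "lift_matrix cs"])
        show "(\<Sum>a<p. real_of_int (lift_matrix cs j a) * x a) = 0" if "j \<in> J" for j
          using x[OF that] by (simp add: Y_def)
        fix y :: "nat \<Rightarrow> int"
        assume ev: "\<And>j. j \<in> J \<Longrightarrow> even (\<Sum>a<p. lift_matrix cs j a * y a)"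
        define A where "A = {a \<in> {..<p}. odd (y a)}"
        have "A = {}"
        proof (rule ccontr)
          assume "A \<noteq> {}"
          moreover have "A \<subseteq> {..<length cs}" by (auto simp: A_def p_def)
          ultimately have "\<exists>j<N. j \<noteq> v \<and> (\<Sum>a\<in>A. (cs ! a) j) = 1"
            using rob[unfolded robust_def, THEN spec, of A] v by simp
          then obtain j where j: "j < N" "j \<noteq> v" "(\<Sum>a\<in>A. (cs ! a) j) = 1" by (elim exE conjE) (rule that)
          have "of_int (\<Sum>a<p. lift_matrix cs j a * y a) = (\<Sum>a<p. if odd (y a) then (cs ! a) j else 0)"
            unfolding of_int_sum of_int_mult of_int_lift_matrix by (intro sum.cong) (auto simp: of_int_bit)
          also have "\<dots> = (\<Sum>a\<in>A. (cs ! a) j)"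
            unfolding A_def by (rule sum.inter_filter[symmetric]) simp
          finally have "of_int (\<Sum>a<p. lift_matrix cs j a * y a) = (1::bit)" using j(3) by (simp only:)
          moreover have "of_int (\<Sum>a<p. lift_matrix cs j a * y a) = (0::bit)"
            using ev[of j] j by (intro even_imp_of_int_bit_0) (simp add: J_def)
          ultimately show False by (simp only: zero_neq_one)
        qed
        then show "\<forall>a\<in>{..<p}. even (y a)" by (auto simp: A_def)
      qed (simp_all add: J_def)
    qed (simp_all add: J_def)
    then obtain G where G: "\<And>a b. a < p \<Longrightarrow> b < p \<Longrightarrow> (\<Sum>j\<in>J. G a j * Y j b) = (if a = b then 1 else 0)" by auto
    define s where "s = (\<lambda>j. if j = v then -1 else \<Sum>a<p. Y v a * G a j)"
    have "(\<Sum>j<N. s j * Y j b) = 0" if b: "b < p" for b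
    proof -
      have "(\<Sum>j<N. s j * Y j b) = s v * Y v b + (\<Sum>j\<in>J. s j * Y j b)"
        unfolding J_def using v by (intro sum.remove) auto
      also have "(\<Sum>j\<in>J. s j * Y j b) = (\<Sum>j\<in>J. \<Sum>a<p. Y v a * (G a j * Y j b))"
        by (intro sum.cong refl) (auto simp: J_def s_def sum_distrib_right mult.assoc)
      also have "\<dots> = (\<Sum>a<p. Y v a * (\<Sum>j\<in>J. G a j * Y j b))"
        by (subst sum.swap) (simp add: sum_distrib_left)
      also have "\<dots> = (\<Sum>a<p. if a = b then Y v a else 0)" using G b by (intro sum.cong) auto
      also have "\<dots> = Y v b" using b by simp
      finally show ?thesis by (simp add: s_def)
    qed
    then have "s \<in> V" by (simp add: V_def)
    then show "\<exists>x\<in>V. x v \<noteq> 0" by (intro bexI[of _ s]) (simp_all add: s_def)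
  qed
  then show ?thesis by (auto simp: V_def Y_def p_def)
qed

text \<open>The random choice of columns ends here. What remains are numerical conditions:
  \<open>n1\<close> for independence on the missed cells, \<open>n2\<close> for the nowhere zero
  weights and \<open>num\<close> for the forms on the contracted graph.\<close>

theorem d_rigid_of_counts:
  fixes n k p d :: nat and E :: "nat set set"
  defines "N \<equiv> n - k" and "E' \<equiv> cell_graph k E"
  assumes k: "2 * k \<le> n" and d: "k + p + d < n"
    and n1: "4 * (\<Sum>i<k. 2 ^ card (missed_cells n k E i)) \<le> (2::nat) ^ p"
    and n2: "4 * (N + 1) * 2 ^ p \<le> (2::nat) ^ N"
    and num: "few_forms N E' p"
  shows "d_rigid d n E"
proof -
  have T: "missed_cells n k E i \<subseteq> {..<N}" for i by (auto simp: missed_cells_def N_def)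
  have "\<exists>cs\<in>column_lists N p. (\<forall>i<k. separating (missed_cells n k E i) cs) \<and> robust N cs \<and>
     (\<forall>om\<in>bit_forms N E'. iso_list (bform N om) cs \<longrightarrow> om = (\<lambda>_ _. 0))"
    by (rule good_columns_exist[OF T n1 n2 num])
  then obtain cs where cs: "cs \<in> column_lists N p" "\<forall>i<k. separating (missed_cells n k E i) cs" "robust N cs"
     "\<forall>om\<in>bit_forms N E'. iso_list (bform N om) cs \<longrightarrow> om = (\<lambda>_ _. 0)"
    by (elim bexE conjE) (rule that)
  have len: "length cs = p" using cs(1) by (simp add: column_lists_def)
  obtain s :: "nat \<Rightarrow> real" where s: "\<forall>j<N. s j \<noteq> 0"
     "\<forall>a<p. (\<Sum>j<N. s j * of_int (lift_matrix cs j a)) = 0"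
    using lift_matrix_relation[OF cs(3)] unfolding len by (elim exE conjE) (rule that)
  show ?thesis
  proof (rule d_rigid_of_split_matrix[OF k d, where Y = "\<lambda>j a. of_int (lift_matrix cs j a)" and s = s])
    fix i c assume "i < k" and c: "\<And>j. c j \<noteq> 0 \<Longrightarrow> j \<in> missed_cells n k E i"
      "\<And>a. a < p \<Longrightarrow> (\<Sum>j<n - k. c j * real_of_int (lift_matrix cs j a)) = 0"
    then have sep: "separating (missed_cells n k E i) cs" using cs(2) by simp
    show "\<forall>j. c j = 0"
      by (rule lift_matrix_independent[OF sep T c(1)]) (simp_all add: len N_def c(2))
  next
    fix om assume om: "nonedge_form (n - k) (cell_graph k E) om"
      "\<And>a b. a < p \<Longrightarrow> b < p \<Longrightarrow> form_val (n - k) om (\<lambda>j. real_of_int (lift_matrix cs j a))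
           (\<lambda>j. real_of_int (lift_matrix cs j b)) = 0"
    show "\<forall>j l. om j l = 0"
    proof (rule lift_matrix_forms[where N = N and E = E' and cs = cs])
      show "om = (\<lambda>_ _. 0)" if "om \<in> bit_forms N E'" "iso_list (bform N om) cs" for om
        using cs(4) that by simp
      show "nonedge_form N E' om" using om(1) by (simp add: N_def E'_def)
      show "form_val N om (\<lambda>j. of_int (lift_matrix cs j a)) (\<lambda>j. of_int (lift_matrix cs j b)) = 0"
        if "a < length cs" "b < length cs" for a b using om(2) that by (simp add: N_def len)
    qed
  next
    show "s j \<noteq> 0" if "j < n - k" for j using s(1) that by (simp add: N_def)
    show "(\<Sum>j<n - k. s j * real_of_int (lift_matrix cs j a)) = 0" if "a < p" for a
      using s(2) that by (simp add: N_def)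
  qed
qed

section \<open>Concentration\<close>

definition coin_flips :: "nat \<Rightarrow> (nat set \<Rightarrow> bool) pmf" where
  "coin_flips n = Pi_pmf (all_pairs n) False (\<lambda>_. bernoulli_pmf (1/2))"

abbreviation coin_prob :: "nat \<Rightarrow> (nat set \<Rightarrow> bool) set \<Rightarrow> real" where
  "coin_prob n \<equiv> measure_pmf.prob (coin_flips n)"

definition heads :: "nat \<Rightarrow> (nat set \<Rightarrow> bool) \<Rightarrow> nat set set" where
  "heads n f = {e \<in> all_pairs n. f e}"

lemma erdos_renyi_half: "erdos_renyi n (1/2) = map_pmf (heads n) (coin_flips n)"
proof -
  have "heads n = (\<lambda>f. {e \<in> all_pairs n. f e})" by (simp add: fun_eq_iff heads_def)
  then show ?thesis by (simp add: erdos_renyi_def coin_flips_def)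
qed

lemma finite_all_pairs: "finite (all_pairs n)"
  by (rule finite_subset[of _ "Pow {..<n}"]) (auto simp: all_pairs_def)

lemma pair_in_all_pairs: "u < n \<Longrightarrow> v < n \<Longrightarrow> u \<noteq> v \<Longrightarrow> {u, v} \<in> all_pairs n"
  unfolding all_pairs_def by blast

lemma prob_constant_on:
  assumes "S \<subseteq> all_pairs n"
  shows "coin_prob n {f. \<forall>e\<in>S. f e = b} = (1/2) ^ card S"
proof -
  have "{f. \<forall>e\<in>S. f e = b} = Pi (all_pairs n) (\<lambda>e. if e \<in> S then {b} else UNIV)"
    using assms by (auto simp: Pi_def)
  then have "coin_prob n {f. \<forall>e\<in>S. f e = b} =
      (\<Prod>e\<in>all_pairs n. measure_pmf.prob (bernoulli_pmf (1/2)) (if e \<in> S then {b} else UNIV))"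
    unfolding coin_flips_def by (simp add: measure_Pi_pmf_Pi finite_all_pairs)
  also have "\<dots> = (\<Prod>e\<in>all_pairs n. if e \<in> S then 1/2 else 1)"
    by (intro prod.cong refl) (cases b; simp add: measure_pmf_single)
  also have "\<dots> = (1/2) ^ card S"
    using assms finite_all_pairs by (simp add: prod.If_cases Int_absorb1 flip: prod.inter_restrict)
  finally show ?thesis .
qed

text \<open>Hoeffding's inequality for the indicators of the \<open>Q j\<close>, which are
  independent because they read disjoint sets \<open>K j\<close> of coin flips. The means enter
  through their upper bounds \<open>p j\<close>.\<close>

lemma concentration:
  fixes K :: "'j \<Rightarrow> nat set set" and Q :: "'j \<Rightarrow> (nat set \<Rightarrow> bool) \<Rightarrow> bool"
  assumes J: "finite J" "J \<noteq> {}" and K: "\<And>j. j \<in> J \<Longrightarrow> K j \<subseteq> all_pairs n"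
    and disj: "disjoint_family_on K J"
    and dep: "\<And>j f g. j \<in> J \<Longrightarrow> (\<And>e. e \<in> K j \<Longrightarrow> f e = g e) \<Longrightarrow> Q j f = Q j g"
    and p: "\<And>j. j \<in> J \<Longrightarrow> coin_prob n {f. Q j f} \<le> p j"
    and t: "t \<ge> 0"
  shows "coin_prob n {f. (\<Sum>j\<in>J. p j) + t \<le> real (card {j \<in> J. Q j f})}
      \<le> exp (-2 * t^2 / real (card J))"
proof -
  define X where "X = (\<lambda>j f. if Q j f then 1 else 0 :: real)"
  have "prob_space.indep_vars (measure_pmf (coin_flips n)) (\<lambda>_. count_space UNIV) (\<lambda>x f. f x) (all_pairs n)"
    unfolding coin_flips_def by (rule indep_vars_Pi_pmf) (rule finite_all_pairs)
  then have "prob_space.indep_vars (measure_pmf (coin_flips n)) (\<lambda>j. PiM (K j) (\<lambda>_. count_space UNIV))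
      (\<lambda>j f. restrict (\<lambda>e. f e) (K j)) J"
    by (rule prob_space.indep_vars_restrict[OF measure_pmf.prob_space_axioms]) (use K disj in auto)
  then have "prob_space.indep_vars (measure_pmf (coin_flips n)) (\<lambda>_. borel) (\<lambda>j f. X j (restrict (\<lambda>e. f e) (K j))) J"
  proof (rule prob_space.indep_vars_compose2[OF measure_pmf.prob_space_axioms])
    fix j assume "j \<in> J"
    then have "finite (K j)" using K finite_all_pairs finite_subset by metis
    then show "X j \<in> PiM (K j) (\<lambda>_. count_space UNIV) \<rightarrow>\<^sub>M borel"
      by (simp add: count_space_PiM_finite)
  qed
  moreover have "X j (restrict (\<lambda>e. f e) (K j)) = X j f" if "j \<in> J" for j f
    unfolding X_def using dep[OF that, of "restrict f (K j)" f] by simp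
  ultimately have ind: "prob_space.indep_vars (measure_pmf (coin_flips n)) (\<lambda>_. borel) X J"
    by (subst prob_space.indep_vars_cong[OF measure_pmf.prob_space_axioms refl _ refl]) auto
  interpret Hoeffding_ineq "measure_pmf (coin_flips n)" J X "\<lambda>_. 0" "\<lambda>_. 1"
     "\<Sum>j\<in>J. measure_pmf.expectation (coin_flips n) (X j)"
    by unfold_locales (use J(1) ind in \<open>auto simp: X_def\<close>)
  have ex: "measure_pmf.expectation (coin_flips n) (X j) \<le> p j" if "j \<in> J" for j
  proof -
    have "X j = indicator {f. Q j f}" by (auto simp: X_def fun_eq_iff)
    then show ?thesis using p[OF that] by simp
  qed
  have cnt: "(\<Sum>j\<in>J. X j f) = real (card {j \<in> J. Q j f})" for f
    unfolding X_def using J(1) by (simp add: sum.If_cases Int_def)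
  have "coin_prob n {f. (\<Sum>j\<in>J. p j) + t \<le> real (card {j \<in> J. Q j f})}
    \<le> coin_prob n {f \<in> space (measure_pmf (coin_flips n)).
         (\<Sum>j\<in>J. measure_pmf.expectation (coin_flips n) (X j)) + t \<le> (\<Sum>j\<in>J. X j f)}"
  proof (rule measure_pmf.finite_measure_mono)
    have "(\<Sum>j\<in>J. measure_pmf.expectation (coin_flips n) (X j)) \<le> (\<Sum>j\<in>J. p j)"
      by (rule sum_mono) (rule ex)
    then show "{f. (\<Sum>j\<in>J. p j) + t \<le> real (card {j \<in> J. Q j f})} \<subseteq> {f \<in> space (measure_pmf (coin_flips n)).
         (\<Sum>j\<in>J. measure_pmf.expectation (coin_flips n) (X j)) + t \<le> (\<Sum>j\<in>J. X j f)}"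
      unfolding cnt by auto
  qed simp
  also have "\<dots> \<le> exp (-2 * t^2 / (\<Sum>j\<in>J. (1 - 0)^2))"
    by (rule Hoeffding_ineq_ge[OF t]) (use J in \<open>simp add: card_gt_0_iff\<close>)
  finally show ?thesis by simp
qed

section \<open>Degrees in the contracted graph and missed cells\<close>

definition block :: "nat \<Rightarrow> nat \<Rightarrow> nat \<Rightarrow> nat set set" where
  "block k i j = (\<lambda>(u, v). {u, v}) ` (members k i \<times> members k j)"

lemma members_disjoint: "u \<in> members k i \<Longrightarrow> u \<in> members k j \<Longrightarrow> i = j"
  by (auto simp: members_def split: if_splits)

lemma finite_members [simp]: "finite (members k i)"
  by (simp add: members_def)

lemma block_all_pairs:
  assumes "2 * k \<le> n" "i < n - k" "j < n - k" "i \<noteq> j"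
  shows "block k i j \<subseteq> all_pairs n"
proof
  fix e assume "e \<in> block k i j"
  then obtain u v where uv: "e = {u, v}" "u \<in> members k i" "v \<in> members k j" by (auto simp: block_def)
  then have "u \<noteq> v" using members_disjoint assms(4) by blast
  with uv members_bound[OF assms(1)] assms(2,3) show "e \<in> all_pairs n"
    by (auto intro: pair_in_all_pairs)
qed

lemma card_block:
  assumes "i \<noteq> j"
  shows "card (block k i j) = card (members k i) * card (members k j)"
proof -
  have "inj_on (\<lambda>(u, v). {u, v}) (members k i \<times> members k j)"
    using members_disjoint assms by (fastforce simp: inj_on_def doubleton_eq_iff)
  then show ?thesis by (simp add: block_def card_image card_cartesian_product)
qed

lemma disjoint_blocks: "i \<notin> J \<Longrightarrow> disjoint_family_on (block k i) J"
proof (unfold disjoint_family_on_def, intro ballI impI)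
  fix j l assume ij: "i \<notin> J" "j \<in> J" "l \<in> J" "j \<noteq> l"
  show "block k i j \<inter> block k i l = {}"
  proof (rule ccontr)
    assume "block k i j \<inter> block k i l \<noteq> {}"
    then obtain u v u' v' where uv: "u \<in> members k i" "v \<in> members k j" "u' \<in> members k i" "v' \<in> members k l"
      and eq: "{u, v} = {u', v'}" by (auto simp: block_def)
    from eq have "v = v' \<or> v = u'" by (auto simp: doubleton_eq_iff)
    then show False using uv ij members_disjoint[of v k j l] members_disjoint[of v k j i] by auto
  qed
qed

lemma sum_over_cells:
  fixes x y :: real
  assumes "k \<le> N" "0 \<le> x" "0 \<le> y" and p: "\<And>j. p j = (if j < k then x else y)"
  shows "(\<Sum>j\<in>{..<N} - {i}. p j) \<le> real k * x + real (N - k) * y"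
proof -
  have "(\<Sum>j\<in>{..<N} - {i}. p j) \<le> (\<Sum>j\<in>{..<N}. p j)"
    by (rule sum_mono2) (use assms in auto)
  also have "\<dots> = (\<Sum>j\<in>{..<k} \<union> {k..<N}. p j)"
    by (rule sum.cong) (use assms(1) in auto)
  also have "\<dots> = (\<Sum>j<k. p j) + (\<Sum>j\<in>{k..<N}. p j)"
    by (rule sum.union_disjoint) auto
  also have "\<dots> = real k * x + real (N - k) * y" by (simp add: p)
  finally show ?thesis .
qed

lemma heads_pair: "u < n \<Longrightarrow> v < n \<Longrightarrow> u \<noteq> v \<Longrightarrow> {u, v} \<in> heads n f \<longleftrightarrow> f {u, v}"
  by (simp add: heads_def pair_in_all_pairs)

lemma exp_tail_mono:
  assumes "0 < m" "m \<le> n"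
  shows "exp (-2 * t^2 / real m) \<le> exp (-2 * t^2 / real n)"
proof -
  have "2 * t^2 / real n \<le> 2 * t^2 / real m" using assms by (intro divide_left_mono) auto
  then show ?thesis by simp
qed

lemma cell_graph_pair:
  "{i, j} \<in> cell_graph k E \<longleftrightarrow> (\<exists>u\<in>members k i. \<exists>v\<in>members k j. {u, v} \<in> E)"
proof
  assume "{i, j} \<in> cell_graph k E"
  then obtain i' j' u v where h: "{i, j} = {i', j'}" "u \<in> members k i'" "v \<in> members k j'" "{u, v} \<in> E"
    by (auto simp: cell_graph_def)
  from h(1) consider "i = i'" "j = j'" | "i = j'" "j = i'" by (auto simp: doubleton_eq_iff)
  then show "\<exists>u\<in>members k i. \<exists>v\<in>members k j. {u, v} \<in> E"
  proof cases
    case 2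
    then have "v \<in> members k i" "u \<in> members k j" "{v, u} \<in> E" using h by (auto simp: insert_commute)
    then show ?thesis by blast
  qed (use h in blast)
qed (auto simp: cell_graph_def)

text \<open>For fixed \<open>i\<close> the blocks towards the other cells are disjoint.
  Non-adjacency means a block without edges, with probability \<open>1/16\<close>,
  \<open>1/4\<close> or \<open>1/2\<close> for blocks of 4, 2 or 1 pairs.\<close>

lemma prob_many_non_nbrs:
  assumes k: "2 * k \<le> n" and i: "i < n - k" and N: "n - k \<ge> 2" and t: "t \<ge> 0"
  shows "coin_prob n
     {f. (if i < k then real k / 16 + real (n - 2 * k) / 4 else real k / 4 + real (n - 2 * k) / 2) + t
        \<le> real (card (non_nbrs (n - k) (cell_graph k (heads n f)) i))} \<le> exp (-2 * t^2 / real n)"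
proof -
  define J where "J = {..<n - k} - {i}"
  define Q where "Q = (\<lambda>j (f :: nat set \<Rightarrow> bool). \<forall>e\<in>block k i j. f e = False)"
  define p where "p = (\<lambda>j. (1/2 :: real) ^ (card (members k i) * card (members k j)))"
  have cJ: "card J = n - k - 1" using i by (simp add: J_def)
  have J: "finite J" by (simp add: J_def)
  have J': "J \<noteq> {}" using cJ N by (intro notI) simp
  have conc: "coin_prob n {f. (\<Sum>j\<in>J. p j) + t \<le> real (card {j \<in> J. Q j f})}
      \<le> exp (-2 * t^2 / real (card J))"
  proof (rule concentration[where K = "block k i", OF J J' _ _ _ _ t])
    show "block k i j \<subseteq> all_pairs n" if "j \<in> J" for j
      using that by (intro block_all_pairs k i) (auto simp: J_def)
    show "disjoint_family_on (block k i) J" by (rule disjoint_blocks) (simp add: J_def)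
    show "Q j f = Q j g" if "\<And>e. e \<in> block k i j \<Longrightarrow> f e = g e" for j f g
      using that by (simp add: Q_def)
    show "coin_prob n {f. Q j f} \<le> p j" if "j \<in> J" for j
    proof -
      have "j \<noteq> i" "j < n - k" using that by (auto simp: J_def)
      then show ?thesis
        unfolding Q_def p_def using prob_constant_on[OF block_all_pairs[OF k i], of j False] card_block[of i j k]
        by simp
    qed
  qed
  have eq: "non_nbrs (n - k) (cell_graph k (heads n f)) i = {j \<in> J. Q j f}" for f
  proof -
    have "{i, j} \<notin> cell_graph k (heads n f) \<longleftrightarrow> Q j f" if j: "j < n - k" "j \<noteq> i" for j
    proof -
      have h: "{u, v} \<in> heads n f \<longleftrightarrow> f {u, v}" if "u \<in> members k i" "v \<in> members k j" for u v
        using that members_bound[OF k] i j members_disjoint[of u k i j] by (intro heads_pair) auto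
      have "{i, j} \<in> cell_graph k (heads n f) \<longleftrightarrow> (\<exists>u\<in>members k i. \<exists>v\<in>members k j. {u, v} \<in> heads n f)"
        by (rule cell_graph_pair)
      then show ?thesis using h by (auto simp: Q_def block_def)
    qed
    then show ?thesis by (auto simp: non_nbrs_def J_def)
  qed
  have sum: "(\<Sum>j\<in>J. p j) \<le> (if i < k then real k / 16 + real (n - 2 * k) / 4 else real k / 4 + real (n - 2 * k) / 2)"
  proof (cases "i < k")
    case True
    have "(\<Sum>j\<in>J. p j) \<le> real k * (1/16) + real (n - k - k) * (1/4)"
      unfolding J_def
      by (rule sum_over_cells) (use k True in \<open>auto simp: p_def members_def power_numeral_reduce\<close>)
    then show ?thesis using True by (simp add: mult_2)
  next
    case False
    have "(\<Sum>j\<in>J. p j) \<le> real k * (1/4) + real (n - k - k) * (1/2)"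
      unfolding J_def
      by (rule sum_over_cells) (use k False in \<open>auto simp: p_def members_def power_numeral_reduce\<close>)
    then show ?thesis using False by (simp add: mult_2)
  qed
  have "coin_prob n
     {f. (if i < k then real k / 16 + real (n - 2 * k) / 4 else real k / 4 + real (n - 2 * k) / 2) + t
        \<le> real (card (non_nbrs (n - k) (cell_graph k (heads n f)) i))}
     \<le> coin_prob n {f. (\<Sum>j\<in>J. p j) + t \<le> real (card {j \<in> J. Q j f})}"
    unfolding eq by (rule measure_pmf.finite_measure_mono) (use sum in auto)
  also have "\<dots> \<le> exp (-2 * t^2 / real (card J))" by (rule conc)
  also have "\<dots> \<le> exp (-2 * t^2 / real n)"
    by (rule exp_tail_mono) (use J J' cJ in \<open>auto simp: card_gt_0_iff\<close>)
  finally show ?thesis .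
qed

text \<open>By inclusion and exclusion the complement has probability
  \<open>1/4 + 1/4 - 1/16\<close>.\<close>

lemma prob_pair_missed:
  assumes S: "S1 \<subseteq> all_pairs n" "S2 \<subseteq> all_pairs n" "S1 \<inter> S2 = {}" "card S1 = 2" "card S2 = 2"
  shows "coin_prob n {f. \<not> (\<forall>e\<in>S1. f e) \<and> \<not> (\<forall>e\<in>S2. f e)} = 9 / 16"
proof -
  define A :: "nat set set \<Rightarrow> (nat set \<Rightarrow> bool) set" where "A = (\<lambda>S. {f. \<forall>e\<in>S. f e = True})"
  have fin: "finite S1" "finite S2" using S finite_all_pairs finite_subset by blast+
  have P: "coin_prob n (A S) = (1/2) ^ card S" if "S \<subseteq> all_pairs n" for S
    unfolding A_def by (rule prob_constant_on[OF that])
  have "A S1 \<inter> A S2 = A (S1 \<union> S2)" by (auto simp: A_def)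
  then have inter: "coin_prob n (A S1 \<inter> A S2) = 1 / 16"
    using S fin by (simp add: P card_Un_disjoint power_numeral_reduce)
  have "{f. \<not> (\<forall>e\<in>S1. f e) \<and> \<not> (\<forall>e\<in>S2. f e)} = UNIV - (A S1 \<union> A S2)" by (auto simp: A_def)
  then have "coin_prob n {f. \<not> (\<forall>e\<in>S1. f e) \<and> \<not> (\<forall>e\<in>S2. f e)}
     = 1 - coin_prob n (A S1 \<union> A S2)"
    using measure_pmf.prob_compl[of "A S1 \<union> A S2" "coin_flips n"] by simp
  also have "coin_prob n (A S1 \<union> A S2) = 1/4 + (1/4 - 1/16)"
    using measure_pmf.finite_measure_Union'[of "A S1" "coin_flips n" "A S2"]
      measure_pmf.finite_measure_Diff'[of "A S2" "coin_flips n" "A S1"] inter S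
    by (simp add: P power2_eq_square Int_commute)
  finally show ?thesis by simp
qed

text \<open>A vertex fails to be adjacent to both vertices of \<open>i\<close> with probability
  \<open>3/4\<close>, and both vertices of another pair fail with probability \<open>9/16\<close>.
  The summand 1 is the cell \<open>i\<close> itself, which is not in \<open>J\<close>.\<close>

lemma prob_many_missed_cells:
  assumes k: "2 * k \<le> n" and i: "i < k" and N: "n - k \<ge> 2" and t: "t \<ge> 0"
  shows "coin_prob n
     {f. 9 * real k / 16 + 3 * real (n - 2 * k) / 4 + 1 + t
        \<le> real (card (missed_cells n k (heads n f) i))} \<le> exp (-2 * t^2 / real n)"
proof -
  have iN: "i < n - k" using k i by simp
  define J where "J = {..<n - k} - {i}"
  define st where "st = (\<lambda>v. (\<lambda>u. {u, v}) ` members k i)"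
  define Q where "Q = (\<lambda>j (f :: nat set \<Rightarrow> bool). \<forall>v\<in>members k j. \<not> (\<forall>e\<in>st v. f e))"
  define p where "p = (\<lambda>j. if j < k then 9 / 16 else 3 / 4 :: real)"
  have cJ: "card J = n - k - 1" using iN by (simp add: J_def)
  have J: "finite J" by (simp add: J_def)
  have J': "J \<noteq> {}" using cJ N by (intro notI) simp
  have vi: "v \<notin> members k i" if "v \<in> members k j" "j \<in> J" for v j
    using members_disjoint[of v k i j] that by (auto simp: J_def)
  have card_st: "card (st v) = 2" if "v \<in> members k j" "j \<in> J" for v j
  proof -
    have "inj_on (\<lambda>u. {u, v}) (members k i)" by (auto simp: inj_on_def doubleton_eq_iff)
    then show ?thesis using i by (simp add: st_def card_image members_def)
  qed
  have st_sub: "st v \<subseteq> all_pairs n" if "v \<in> members k j" "j \<in> J" for v j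
  proof -
    have "st v \<subseteq> block k i j" using that by (auto simp: st_def block_def)
    also have "\<dots> \<subseteq> all_pairs n" using that by (intro block_all_pairs k iN) (auto simp: J_def)
    finally show ?thesis .
  qed
  have conc: "coin_prob n {f. (\<Sum>j\<in>J. p j) + t \<le> real (card {j \<in> J. Q j f})}
      \<le> exp (-2 * t^2 / real (card J))"
  proof (rule concentration[where K = "block k i", OF J J' _ _ _ _ t])
    show "block k i j \<subseteq> all_pairs n" if "j \<in> J" for j
      using that by (intro block_all_pairs k iN) (auto simp: J_def)
    show "disjoint_family_on (block k i) J" by (rule disjoint_blocks) (simp add: J_def)
    show "Q j f = Q j g" if "\<And>e. e \<in> block k i j \<Longrightarrow> f e = g e" for j f g
    proof -
      have "f e = g e" if "e \<in> st v" "v \<in> members k j" for e v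
        using that by (intro \<open>\<And>e. e \<in> block k i j \<Longrightarrow> f e = g e\<close>) (auto simp: st_def block_def)
      then show ?thesis by (simp add: Q_def)
    qed
    show "coin_prob n {f. Q j f} \<le> p j" if j: "j \<in> J" for j
    proof (cases "j < k")
      case True
      define a b where "a = 2 * j" and "b = 2 * j + 1"
      have mem: "members k j = {a, b}" using True by (simp add: members_def a_def b_def)
      have "st a \<inter> st b = {}"
        using vi[of a j] vi[of b j] j by (auto simp: st_def mem doubleton_eq_iff a_def b_def)
      then have "coin_prob n {f. \<not> (\<forall>e\<in>st a. f e) \<and> \<not> (\<forall>e\<in>st b. f e)} = 9 / 16"
        using j by (intro prob_pair_missed st_sub[of _ j] card_st[of _ j]) (auto simp: mem)
      then show ?thesis using True by (simp add: Q_def mem p_def)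
    next
      case False
      define a where "a = j + k"
      have mem: "members k j = {a}" using False by (simp add: members_def a_def)
      have "{f. Q j f} = UNIV - {f. \<forall>e\<in>st a. f e = True}" by (auto simp: Q_def mem)
      then have "coin_prob n {f. Q j f}
         = 1 - coin_prob n {f. \<forall>e\<in>st a. f e = True}"
        using measure_pmf.prob_compl[of "{f. \<forall>e\<in>st a. f e = True}" "coin_flips n"] by simp
      also have "\<dots> = 3 / 4"
        using prob_constant_on[OF st_sub[of a j], of True] card_st[of a j] j by (simp add: mem power2_eq_square)
      finally show ?thesis using False by (simp add: p_def)
    qed
  qed
  have le: "real (card (missed_cells n k (heads n f) i)) \<le> 1 + real (card {j \<in> J. Q j f})" for f
  proof -
    have "missed_cells n k (heads n f) i \<subseteq> insert i {j \<in> J. Q j f}"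
    proof
      fix j assume j: "j \<in> missed_cells n k (heads n f) i"
      show "j \<in> insert i {j \<in> J. Q j f}"
      proof (cases "j = i")
        case False
        then have jJ: "j \<in> J" and miss: "\<forall>v\<in>members k j. \<exists>u\<in>members k i. {u, v} \<notin> heads n f"
          using j by (auto simp: missed_cells_def J_def)
        have "\<not> (\<forall>e\<in>st v. f e)" if v: "v \<in> members k j" for v
        proof -
          obtain u where u: "u \<in> members k i" "{u, v} \<notin> heads n f" using miss v by blast
          have "u \<noteq> v" "u < n" "v < n"
            using vi[OF v jJ] u(1) v members_bound[OF k] iN jJ by (auto simp: J_def)
          then have "\<not> f {u, v}" using u(2) by (simp add: heads_pair)
          then show ?thesis using u(1) by (auto simp: st_def)
        qed
        then show ?thesis using jJ by (simp add: Q_def)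
      qed simp
    qed
    then have "card (missed_cells n k (heads n f) i) \<le> card (insert i {j \<in> J. Q j f})"
      using J by (intro card_mono) auto
    also have "\<dots> \<le> Suc (card {j \<in> J. Q j f})" using J by (simp add: card_insert_if)
    finally show ?thesis by simp
  qed
  have sum: "(\<Sum>j\<in>J. p j) \<le> 9 * real k / 16 + 3 * real (n - 2 * k) / 4"
  proof -
    have "(\<Sum>j\<in>J. p j) \<le> real k * (9/16) + real (n - k - k) * (3/4)"
      unfolding J_def by (rule sum_over_cells) (use k in \<open>auto simp: p_def\<close>)
    then show ?thesis by (simp add: mult_2 mult.commute)
  qed
  have "coin_prob n
     {f. 9 * real k / 16 + 3 * real (n - 2 * k) / 4 + 1 + t \<le> real (card (missed_cells n k (heads n f) i))}
     \<le> coin_prob n {f. (\<Sum>j\<in>J. p j) + t \<le> real (card {j \<in> J. Q j f})}"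
  proof (rule measure_pmf.finite_measure_mono, rule Collect_mono, rule impI)
    fix f assume "9 * real k / 16 + 3 * real (n - 2 * k) / 4 + 1 + t \<le> real (card (missed_cells n k (heads n f) i))"
    with le[of f] sum show "(\<Sum>j\<in>J. p j) + t \<le> real (card {j \<in> J. Q j f})" by linarith
  qed simp
  also have "\<dots> \<le> exp (-2 * t^2 / real (card J))" by (rule conc)
  also have "\<dots> \<le> exp (-2 * t^2 / real n)"
    by (rule exp_tail_mono) (use J J' cJ in \<open>auto simp: card_gt_0_iff\<close>)
  finally show ?thesis .
qed

section \<open>Exponents and limits\<close>

lemma two_triangular: "2 * triangular h = h * (h + 1)"
  by (induction h) (auto simp: algebra_simps)

text \<open>The condition \<open>few_forms\<close> in base 2 logarithms, for \<open>r\<close> rows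
  of which \<open>a\<close> are unpaired cells; \<open>L\<close> bounds the logarithms of
  \<open>p + 1\<close> and \<open>4 * N\<close>, and \<open>p \<ge> 19 * m - 1\<close>. Charging
  every row as a pair costs about \<open>79/16 * h * m\<close>. Of the remaining
  \<open>(14 + 1/16) * h * m\<close>, the part \<open>14 * h * m\<close> pays for the surplus of the
  unpaired cells and for \<open>h^2 / 2\<close>, and \<open>h * m / 16\<close> for three terms
  \<open>h * L\<close>; hence \<open>48 = 3 * 16\<close>.\<close>

lemma exponent_inequality:
  fixes m L h a r k s d1 d2 :: real
  assumes k: "31 * m - 1 \<le> k" "k \<le> 31 * m" and s: "s = 64 * m - 2 * k"
    and d1: "d1 = k / 16 + s / 4 + m / 32" and d2: "d2 = k / 4 + s / 2 + m / 32"
    and L: "0 \<le> L" "48 * L + 100 \<le> m"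
    and h: "1 \<le> h" "h \<le> 17 * m" and r: "0 \<le> r" "r \<le> 2 * h" and a: "0 \<le> a" "a \<le> r" "a \<le> s"
  shows "r * d1 + a * (d2 - d1) + h * L + h * (h + 1) / 2 + r * L \<le> h * (19 * m - 1)"
proof -
  have m: "m \<ge> 100" using L by linarith
  have b1: "0 \<le> d1" "d1 \<le> 79 / 32 * m + 7 / 16" using k m unfolding d1 s by (auto simp: field_simps)
  have b2: "0 \<le> d2 - d1" "d2 - d1 \<le> 101 / 16 * m + 5 / 16"
    using k m unfolding d1 d2 s by (auto simp: field_simps)
  define X where "X = h * m"
  define Y where "Y = h * h"
  define A where "A = a * (d2 - d1)"
  have hh: "h * (h + 1) / 2 = Y / 2 + h / 2" by (simp add: Y_def algebra_simps add_divide_distrib)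
  have "r * d1 \<le> (2 * h) * (79 / 32 * m + 7 / 16)" using r b1 h by (intro mult_mono) auto
  also have "\<dots> = 79 / 16 * X + 7 / 8 * h" by (simp add: X_def algebra_simps)
  finally have 1: "r * d1 \<le> 79 / 16 * X + 7 / 8 * h" .
  have "r * L \<le> (2 * h) * L" using r L by (intro mult_right_mono) auto
  then have 2: "r * L \<le> 2 * (h * L)" by simp
  have "h * (48 * L + 100) \<le> h * m" using L h by (intro mult_left_mono) auto
  then have 3: "48 * (h * L) + 100 * h \<le> X" by (simp add: X_def algebra_simps)
  have 4: "A + Y / 2 + h / 2 + 9 / 10 * h \<le> 14 * X"
  proof (cases "h \<le> m + 1")
    case True
    have "A \<le> (2 * h) * (101 / 16 * m + 5 / 16)" unfolding A_def using a r b2 by (intro mult_mono) auto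
    also have "\<dots> = 101 / 8 * X + 5 / 8 * h" by (simp add: X_def algebra_simps)
    finally have "A \<le> 101 / 8 * X + 5 / 8 * h" .
    moreover have "h * h \<le> h * (m + 1)" using True h by (intro mult_left_mono) auto
    then have "Y \<le> X + h" by (simp add: X_def Y_def algebra_simps)
    moreover have "h * 100 \<le> h * m" using m h by (intro mult_left_mono) auto
    then have "100 * h \<le> X" by (simp add: X_def)
    ultimately show ?thesis using h by linarith
  next
    case False
    have "A \<le> (2 * m + 2) * (101 / 16 * m + 5 / 16)"
      unfolding A_def using a b2 k s by (intro mult_mono) auto
    also have "\<dots> = 101 / 8 * (m * m) + 53 / 4 * m + 5 / 8" by (simp add: field_simps)
    finally have "A \<le> 101 / 8 * (m * m) + 53 / 4 * m + 5 / 8" .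
    moreover have "0 \<le> (h - m) * (27 * m - h)" using False h m by (intro mult_nonneg_nonneg) auto
    then have "27 / 2 * (m * m) \<le> 14 * X - Y / 2" by (simp add: X_def Y_def algebra_simps)
    moreover have "100 * m \<le> m * m" using m by (intro mult_right_mono) auto
    ultimately show ?thesis using m h by linarith
  qed
  have "h * (19 * m - 1) = 19 * X - h" by (simp add: X_def algebra_simps)
  then show ?thesis using 1 2 3 4 h unfolding hh A_def[symmetric] by linarith
qed

text \<open>With \<open>m = n / 64\<close> the expected number of missed cells is about
  \<open>(19 - 1/16) * m\<close>, against \<open>p\<close> of at least about \<open>19 * m\<close>.
  The tolerance \<open>n / 2048 = m / 32\<close> spends half of this gap, and the other half absorbs
  \<open>L\<close> and the rounding.\<close>

lemma d_rigid_of_degrees: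
  fixes n d k L :: nat and E :: "nat set set"
  assumes k: "k = 31 * n div 64"
    and d: "12 * real n / 64 \<le> real d" "real d \<le> 14 * real n / 64"
    and L: "4 * n \<le> 2 ^ L" "48 * real L + 100 \<le> real n / 64"
    and miss: "\<And>i. i < k \<Longrightarrow> real (card (missed_cells n k E i)) \<le>
        9 * real k / 16 + 3 * real (n - 2 * k) / 4 + 1 + real n / 2048"
    and deg: "\<And>i. i < n - k \<Longrightarrow> real (card (non_nbrs (n - k) (cell_graph k E) i)) \<le>
        (if i < k then real k / 16 + real (n - 2 * k) / 4 else real k / 4 + real (n - 2 * k) / 2) + real n / 2048"
  shows "d_rigid d n E"
proof -
  define m where "m = real n / 64"
  have n: "real n = 64 * m" by (simp add: m_def)
  have m: "m \<ge> 100" using L(2) unfolding m_def[symmetric] by linarith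
  have k1: "real k \<le> 31 * m" "31 * m - 1 \<le> real k"
  proof -
    have "64 * k \<le> 31 * n" "31 * n < 64 * k + 64" unfolding k by linarith+
    then have "64 * real k \<le> 31 * real n" "31 * real n \<le> 64 * real k + 64" by linarith+
    then show "real k \<le> 31 * m" "31 * m - 1 \<le> real k" by (auto simp: n)
  qed
  have k2: "2 * k \<le> n" unfolding k by linarith
  define s where "s = real (n - 2 * k)"
  have s: "s = 64 * m - 2 * real k" using k2 n by (simp add: s_def of_nat_diff)
  define p where "p = n - k - d - 1"
  have dm: "12 * m \<le> real d" "real d \<le> 14 * m" using d by (simp_all add: m_def)
  have kd: "k + d + 1 \<le> n"
  proof -
    have "real (k + d + 1) \<le> real n" using k1 dm n m by simp
    then show ?thesis by (simp only: of_nat_le_iff)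
  qed
  have pn: "p + k + d + 1 = n" using kd by (simp add: p_def)
  have p: "real p = 64 * m - real k - real d - 1" using arg_cong[OF pn, of real] n by simp
  have Lm: "48 * real L + 100 \<le> m" using L(2) by (simp add: m_def)
  have Lp: "L \<le> p"
  proof -
    have "real L \<le> real p" using p k1 dm Lm m by linarith
    then show ?thesis by (simp only: of_nat_le_iff)
  qed
  define N where "N = n - k"
  have N: "N = p + d + 1" using pn by (simp add: N_def)
  have kN: "k \<le> N" using k2 by (simp add: N_def)
  have Nn: "N + 1 \<le> n"
  proof -
    have "k \<ge> 1" using k1 m by (cases k) auto
    then show ?thesis using kd by (simp add: N_def)
  qed
  show ?thesis
  proof (rule d_rigid_of_counts[OF k2, where p = p])
    show "k + p + d < n" using pn by simp
    have T: "card (missed_cells n k E i) \<le> p - L" if "i < k" for i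
    proof -
      have "real (card (missed_cells n k E i)) \<le> 9 * real k / 16 + 3 * s / 4 + 1 + m / 32"
        using miss[OF that] by (simp add: s_def m_def)
      also have "\<dots> \<le> real p - real L"
      proof -
        have "3 * s / 4 = 48 * m - 3 / 2 * real k" by (simp add: s field_simps)
        moreover have "0 \<le> real L" by simp
        ultimately show ?thesis using k1 dm Lm unfolding p by linarith
      qed
      also have "\<dots> = real (p - L)" using Lp by (simp add: of_nat_diff)
      finally show ?thesis by (simp only: of_nat_le_iff)
    qed
    have "4 * (\<Sum>i<k. 2 ^ card (missed_cells n k E i)) \<le> 4 * (\<Sum>i<k. (2::nat) ^ (p - L))"
      by (intro mult_le_mono2 sum_mono power_increasing T) auto
    also have "\<dots> = (4 * k) * 2 ^ (p - L)" by simp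
    also have "\<dots> \<le> 2 ^ L * 2 ^ (p - L)" using L(1) kd by (intro mult_le_mono1) linarith
    also have "\<dots> = 2 ^ p" using Lp by (simp flip: power_add)
    finally show "4 * (\<Sum>i<k. 2 ^ card (missed_cells n k E i)) \<le> (2::nat) ^ p" .
    \<comment> \<open>Robustness needs more cells than dimensions by at least the logarithm of
      \<open>4 * (N + 1)\<close>, and \<open>N - p = d + 1\<close>. The lower bound on
      \<open>d\<close> provides this.\<close>
    have "L \<le> d + 1"
    proof -
      have "real L \<le> real d" using dm Lm m by linarith
      then show ?thesis by simp
    qed
    have "4 * (N + 1) \<le> 4 * n" using Nn by simp
    then have "4 * (N + 1) \<le> 2 ^ L" using L(1) by (rule order.trans)
    then have "4 * (N + 1) * 2 ^ p \<le> 2 ^ L * (2::nat) ^ p" by (rule mult_le_mono1)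
    also have "\<dots> \<le> 2 ^ (d + 1) * 2 ^ p" using \<open>L \<le> d + 1\<close> by (intro mult_le_mono1 power_increasing) auto
    also have "\<dots> = 2 ^ N" by (simp add: N power_add)
    finally show "4 * (n - k + 1) * 2 ^ p \<le> (2::nat) ^ (n - k)" by (simp only: N_def)
  next
    show "few_forms (n - k) (cell_graph k E) p"
      unfolding few_forms_def Let_def
    proof (intro allI impI)
      fix R assume R: "R \<subseteq> {..<n - k}" "R \<noteq> {}"
      define h where "h = (card R + 1) div 2"
      define A where "A = (\<Sum>r\<in>R. card (non_nbrs (n - k) (cell_graph k E) r))"
      define d1 where "d1 = real k / 16 + s / 4 + m / 32"
      define d2 where "d2 = real k / 4 + s / 2 + m / 32"
      define a where "a = card (R \<inter> {k..<N})"
      have fR: "finite R" using R(1) finite_subset by blast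
      have cR: "card R \<ge> 1" using fR R(2) by (simp add: Suc_leI card_gt_0_iff)
      have cRN: "card R \<le> N" using card_mono[OF _ R(1)] by (simp add: N_def)
      have h: "card R \<le> 2 * h" "2 * h \<le> card R + 1" "1 \<le> h" using cR unfolding h_def by linarith+
      have aR: "a \<le> card R" unfolding a_def using fR by (intro card_mono) auto
      have as: "real a \<le> s"
      proof -
        have "a \<le> card {k..<N}" unfolding a_def by (intro card_mono) auto
        also have "\<dots> = n - 2 * k" by (simp add: N_def)
        finally show ?thesis by (simp add: s_def)
      qed
      have "real A \<le> (\<Sum>r\<in>R. d1 + (if r \<in> {k..<N} then d2 - d1 else 0))"
        unfolding A_def of_nat_sum
      proof (rule sum_mono)
        fix r assume "r \<in> R"
        then have "r < n - k" using R(1) by auto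
        then show "real (card (non_nbrs (n - k) (cell_graph k E) r)) \<le> d1 + (if r \<in> {k..<N} then d2 - d1 else 0)"
          using deg[of r] by (auto simp: d1_def d2_def s_def m_def N_def)
      qed
      also have "\<dots> = real (card R) * d1 + real a * (d2 - d1)"
        unfolding sum.distrib sum.inter_restrict[OF fR, symmetric] by (simp add: a_def)
      finally have A: "real A \<le> real (card R) * d1 + real a * (d2 - d1)" .
      have h17: "real h \<le> 17 * m"
      proof -
        have "2 * real h \<le> real N + 1" using h cRN by linarith
        moreover have "real N = 64 * m - real k" using kd n by (simp add: N_def of_nat_diff)
        ultimately show ?thesis using k1 m by linarith
      qed
      have "real (card R) * d1 + real a * (d2 - d1) + real h * real L + real h * (real h + 1) / 2 + real (card R) * real L
        \<le> real h * (19 * m - 1)"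
        by (rule exponent_inequality[OF k1(2,1) s d1_def d2_def _ Lm]) (use h h17 aR as in auto)
      also have "\<dots> \<le> real h * real p" using p k1 dm by (intro mult_left_mono) auto
      finally have "real A + real h * real L + real h * (real h + 1) / 2 + real (card R) * real L \<le> real h * real p"
        using A by linarith
      moreover have "real (triangular h) = real h * (real h + 1) / 2"
        using arg_cong[OF two_triangular[of h], of real] by (simp add: algebra_simps)
      ultimately have "real (A + h * L + triangular h + card R * L) \<le> real (h * p)" by simp
      then have expo: "A + h * L + triangular h + card R * L \<le> h * p" by (simp only: of_nat_le_iff)
      have pL: "p + 1 \<le> 2 ^ L" using L(1) pn by linarith
      have NL: "4 * N \<le> 2 ^ L" using L(1) Nn by linarith
      have "2 ^ A * (p + 1) ^ h * 2 ^ triangular h * (4 * N) ^ card R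
         \<le> 2 ^ A * (2 ^ L) ^ h * 2 ^ triangular h * (2 ^ L) ^ card R"
        by (intro mult_le_mono power_mono pL NL le_refl) auto
      also have "\<dots> = 2 ^ (A + h * L + triangular h + card R * L)"
        by (simp add: power_add mult.commute flip: power_mult)
      also have "\<dots> \<le> (2::nat) ^ (h * p)" using expo by (intro power_increasing) auto
      finally show "2 ^ (\<Sum>r\<in>R. card (non_nbrs (n - k) (cell_graph k E) r)) * (p + 1) ^ ((card R + 1) div 2)
          * 2 ^ triangular ((card R + 1) div 2) * (4 * (n - k)) ^ card R \<le> (2::nat) ^ ((card R + 1) div 2 * p)"
        by (simp only: A_def h_def N_def)
    qed
  qed
qed

text \<open>Union bound over \<open>k\<close> events on missed cells and \<open>n - k\<close> events
  on degrees, \<open>n\<close> in all, each with the same Hoeffding bound.\<close>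

lemma prob_d_rigid_ge:
  fixes n d L :: nat
  assumes d: "12 * real n / 64 \<le> real d" "real d \<le> 14 * real n / 64"
    and L: "4 * n \<le> 2 ^ L" "48 * real L + 100 \<le> real n / 64"
  shows "1 - real n * exp (-2 * (real n / 2048)^2 / real n)
    \<le> measure_pmf.prob (erdos_renyi n (1/2)) {E. d_rigid d n E}"
proof -
  define k where "k = 31 * n div 64"
  define t where "t = real n / 2048"
  define B1 where "B1 = (\<lambda>i. {f. 9 * real k / 16 + 3 * real (n - 2 * k) / 4 + 1 + t
        \<le> real (card (missed_cells n k (heads n f) i))})"
  define B2 where "B2 = (\<lambda>i. {f. (if i < k then real k / 16 + real (n - 2 * k) / 4
        else real k / 4 + real (n - 2 * k) / 2) + t
        \<le> real (card (non_nbrs (n - k) (cell_graph k (heads n f)) i))})"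
  define P where "P = coin_prob n"
  define q where "q = exp (-2 * t^2 / real n)"
  have n: "n \<ge> 6400" using L(2) by linarith
  have k: "2 * k \<le> n" "n - k \<ge> 2" unfolding k_def using n by linarith+
  have t: "t \<ge> 0" by (simp add: t_def)
  have b1: "P (B1 i) \<le> q" if "i < k" for i
    unfolding P_def B1_def q_def by (rule prob_many_missed_cells[OF k(1) that k(2) t])
  have b2: "P (B2 i) \<le> q" if "i < n - k" for i
    unfolding P_def B2_def q_def by (rule prob_many_non_nbrs[OF k(1) that k(2) t])
  define B where "B = (\<Union>i<k. B1 i) \<union> (\<Union>i<n - k. B2 i)"
  have "P B \<le> P (\<Union>i<k. B1 i) + P (\<Union>i<n - k. B2 i)"
    unfolding P_def B_def by (rule measure_Un_le) auto
  also have "\<dots> \<le> (\<Sum>i<k. P (B1 i)) + (\<Sum>i<n - k. P (B2 i))"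
    unfolding P_def by (intro add_mono measure_pmf.finite_measure_subadditive_finite) auto
  also have "\<dots> \<le> (\<Sum>i<k. q) + (\<Sum>i<n - k. q)"
    by (intro add_mono sum_mono b1 b2) auto
  also have "\<dots> = real n * q" using k by (simp add: of_nat_diff algebra_simps)
  finally have PB: "P B \<le> real n * q" .
  have good: "d_rigid d n (heads n f)" if "f \<notin> B" for f
  proof (rule d_rigid_of_degrees[OF k_def d L], unfold t_def[symmetric])
    show "real (card (missed_cells n k (heads n f) i)) \<le> 9 * real k / 16 + 3 * real (n - 2 * k) / 4 + 1 + t"
      if "i < k" for i
      using that \<open>f \<notin> B\<close> unfolding B_def B1_def by force
    show "real (card (non_nbrs (n - k) (cell_graph k (heads n f)) i))
      \<le> (if i < k then real k / 16 + real (n - 2 * k) / 4 else real k / 4 + real (n - 2 * k) / 2) + t"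
      if "i < n - k" for i
      using that \<open>f \<notin> B\<close> unfolding B_def B2_def by force
  qed
  have "1 - real n * q \<le> 1 - P B" using PB by simp
  also have "\<dots> = P (UNIV - B)" unfolding P_def using measure_pmf.prob_compl[of B "coin_flips n"] by simp
  also have "\<dots> \<le> P (heads n -` {E. d_rigid d n E})"
    unfolding P_def by (rule measure_pmf.finite_measure_mono) (use good in auto)
  also have "\<dots> = measure_pmf.prob (erdos_renyi n (1/2)) {E. d_rigid d n E}"
    unfolding erdos_renyi_half P_def by simp
  finally show ?thesis by (simp only: q_def t_def)
qed

theorem theorem1p5:
  fixes d :: "nat \<Rightarrow> int"
  assumes "\<And>n. d n = \<lfloor>7 / 32 * real n - sqrt (15 * real n * ln (real n)) / 16\<rfloor>"
  shows "(\<lambda>n. measure_pmf.prob (erdos_renyi n (1/2)) {E. d_rigid (nat (d n)) n E})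
           \<longlonglongrightarrow> 1"
proof (rule tendsto_sandwich)
  show "(\<lambda>n. 1 - real n * exp (-2 * (real n / 2048)^2 / real n)) \<longlonglongrightarrow> 1"
    by real_asymp
  show "\<forall>\<^sub>F n in sequentially. measure_pmf.prob (erdos_renyi n (1/2)) {E. d_rigid (nat (d n)) n E} \<le> 1"
    by simp
  \<comment> \<open>The square root is of smaller order than \<open>n\<close> and
    \<open>7/32 = 14/64\<close>; the summand 1 makes room for the floor.\<close>
  have e1: "\<forall>\<^sub>F n in sequentially. 12 * real n / 64 + 1 \<le> 7 / 32 * real n - sqrt (15 * real n * ln (real n)) / 16"
    by real_asymp
  have e2: "\<forall>\<^sub>F n in sequentially. 48 * (log 2 (4 * real n) + 1) + 100 \<le> real n / 64"
    by real_asymp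
  show "\<forall>\<^sub>F n in sequentially. 1 - real n * exp (-2 * (real n / 2048)^2 / real n)
      \<le> measure_pmf.prob (erdos_renyi n (1/2)) {E. d_rigid (nat (d n)) n E}"
    using e1 e2 eventually_ge_at_top[of 1]
  proof eventually_elim
    case (elim n)
    define x where "x = 7 / 32 * real n - sqrt (15 * real n * ln (real n)) / 16"
    have dn: "d n = \<lfloor>x\<rfloor>" by (simp add: assms x_def)
    have x: "12 * real n / 64 + 1 \<le> x" using elim(1) by (simp add: x_def)
    have "0 \<le> \<lfloor>x\<rfloor>" using x by simp
    then have rd: "real (nat (d n)) = of_int \<lfloor>x\<rfloor>" unfolding dn by (rule of_nat_nat)
    define L where "L = nat \<lceil>log 2 (4 * real n)\<rceil>"
    have lg: "log 2 (4 * real n) \<ge> 0" using elim(3) by simp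
    have "real L = of_int \<lceil>log 2 (4 * real n)\<rceil>" using lg by (simp add: L_def)
    then have L: "log 2 (4 * real n) \<le> real L" "real L \<le> log 2 (4 * real n) + 1" by linarith+
    show ?case
    proof (rule prob_d_rigid_ge)
      show "12 * real n / 64 \<le> real (nat (d n))" using x unfolding rd by linarith
      have "real_of_int \<lfloor>x\<rfloor> \<le> x" by simp
      also have "x \<le> 14 * real n / 64" using elim(3) by (simp add: x_def)
      finally show "real (nat (d n)) \<le> 14 * real n / 64" unfolding rd .
      have "4 * real n = 2 powr log 2 (4 * real n)" using elim(3) by simp
      also have "\<dots> \<le> 2 powr real L" using L(1) by simp
      also have "\<dots> = 2 ^ L" by (simp add: powr_realpow)
      finally have "real (4 * n) \<le> real (2 ^ L)" by simp
      then show "4 * n \<le> 2 ^ L" by (simp only: of_nat_le_iff)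
      have "48 * real L \<le> 48 * (log 2 (4 * real n) + 1)" using L(2) by (intro mult_left_mono) auto
      then show "48 * real L + 100 \<le> real n / 64" using elim(2) by linarith
    qed
  qed
qed simp

end
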